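(* Let $H$ be a separable Hilbert space, $\alpha\in(0,1)$, and let $\phi:H\to\mathbb{R}$ be lower semicontinuous and convex with $\inf_{u\in H}\phi(u)>-\infty$. Assume moreover that whenever $v_n\to v$ strongly in $H$, any sequence $\{\xi_n\}$ with $\xi_n\in\partial\phi(v_n)$ for all $n$ converges weakly to some $\xi\in H$. Let $u_0\in H$. Then for any $T>0$ the time fractional gradient flow $$D_c^\alpha u\in-\partial\phi(u),\qquad u(0)=u_0,$$ has a unique strong solution $u$ on $[0,T)$. The strong solution is Hölder continuous on $[0,T)$: there is a constant $C$ such that $$\|u(t+\delta)-u(t)\|\le C|\delta|^{\alpha/2}\quad\text{whenever } t,\,t+\delta\in[0,T).$$ Moreover, let $k\in E_T=\{2^{-m}T:\ m\in\mathbb{N}\}$, $t_n=nk$, and let $\{U_n\}$ be the numerical solution defined by $U_0=u_0$ and, for $n\ge1$, $$U_n=\operatorname{argmin}_{u\in H}\left(\frac{1}{2k^\alpha}\Big(\sum_{j=1}^{n-1}c_j\|u-U_{n-j}\|^2+c_n^n\|u-U_0\|^2\Big)+\phi(u)\right).$$ Then there is a constant $C(\alpha,T)$ independent of $k$ (it may depend on $\phi$ and $u_0$) such that $$\sup_{n:\,nk\le T}\|U_n-u(t_n)\|\le C(\alpha,T)\,k^{\alpha/4},$$ where $u(T)$ denotes the continuous extension of $u$.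
   Context: $\langle\cdot,\cdot\rangle$ and $\|\cdot\|$ are the inner product and norm of $H$. The Fréchet subdifferential is $\partial\phi(u)=\{\xi\in H:\liminf_{w\to u}\frac{\phi(w)-\phi(u)-\langle\xi,w-u\rangle}{\|w-u\|}\ge0\}$; for convex $\phi$, $\xi\in\partial\phi(u)$ iff $\phi(w)-\phi(u)-\langle\xi,w-u\rangle\ge0$ for all $w\in H$. Generalized Caputo derivative: for $u\in L^1_{\mathrm{loc}}([0,T),H)$ and $u_0\in H$, $D_c^\alpha u$ is the $H$-valued distribution on $(-\infty,T)$ supported in $[0,T)$ given by $D_c^\alpha u=g_{-\alpha}*\big((u-u_0)\theta(t)\big)$, where $\theta$ is the Heaviside function and $g_{-\alpha}=\frac{1}{\Gamma(1-\alpha)}D(\theta(t)t^{-\alpha})$ with $D$ the distributional derivative. Equivalently, for $v\in L^1_{\mathrm{loc}}([0,T),H)$, $D_c^\alpha u=v$ iff $u(t)=u_0+\frac{1}{\Gamma(\alpha)}\int_0^t(t-s)^{\alpha-1}v(s)\,ds$ for a.e. $t$. Strong solution: $u\in L^1_{\mathrm{loc}}([0,T),H)$ is a strong solution of $D_c^\alpha u\in-\partial\phi(u)$, $u(0)=u_0$, if (i) $D_c^\alpha u$ is locally integrable on $[0,T)$; (ii) $\lim_{t\to0^+}\frac1t\int_0^t\|u(s)-u_0\|\,ds=0$; (iii) for almost every $t\in[0,T)$, $D_c^\alpha u(t)\in-\partial\phi(u(t))$. (Functions are identified when equal a.e.; Hölder continuity refers to the continuous representative.) Coefficients: let $a_n=\frac{(n+1)^\alpha-n^\alpha}{\Gamma(1+\alpha)}$,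 $n\ge0$, and let $a^{(-1)}$ be the convolution inverse of $a=(a_n)_{n\ge0}$, i.e. $a*a^{(-1)}=(1,0,0,\ldots)$ with $(p*q)_n=\sum_{m=0}^np_mq_{n-m}$. Set $c_0=a^{(-1)}_0$, $c_i=-a^{(-1)}_i$ for $i\ge1$, and $c_n^n=c_0-\sum_{i=1}^{n-1}c_i$ for $n\ge1$. (One has $c_i>0$ and $c_n^n>0$.) *)

theory Defs
  imports "HOL-Analysis.Analysis"
begin

subsection \<open>Convex analysis\<close>

definition lower_semicontinuous :: "('a::topological_space \<Rightarrow> real) \<Rightarrow> bool" where
  "lower_semicontinuous \<phi> \<longleftrightarrow> (\<forall>x. ereal (\<phi> x) \<le> Liminf (at x) (\<lambda>y. ereal (\<phi> y)))"

definition frechet_subdiff :: "('a::real_inner \<Rightarrow> real) \<Rightarrow> 'a \<Rightarrow> 'a set" where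
  "frechet_subdiff \<phi> u =
     {\<xi>. Liminf (at u) (\<lambda>w. ereal ((\<phi> w - \<phi> u - \<xi> \<bullet> (w - u)) / norm (w - u))) \<ge> 0}"

definition weakly_tendsto :: "(nat \<Rightarrow> 'a::real_inner) \<Rightarrow> 'a \<Rightarrow> bool" where
  "weakly_tendsto \<xi>s \<xi> \<longleftrightarrow> (\<forall>y. (\<lambda>n. \<xi>s n \<bullet> y) \<longlonglongrightarrow> \<xi> \<bullet> y)"

subsection \<open>Distributions and the generalized Caputo derivative\<close>

text \<open>Distributions are represented as functionals on real-valued test functions; those of
  vector-valued distributions take values in the vector space.\<close>

definition L1_loc :: "real \<Rightarrow> (real \<Rightarrow> 'a::{banach, second_countable_topology}) \<Rightarrow> bool" where
  "L1_loc T f \<longleftrightarrow> (\<forall>b<T. set_integrable lebesgue {0..b} f)"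

definition test_functions :: "real \<Rightarrow> (real \<Rightarrow> real) set" where
  "test_functions T =
     {\<psi>. (\<forall>n x. (deriv ^^ n) \<psi> differentiable (at x)) \<and>
         compact (closure {t. \<psi> t \<noteq> 0}) \<and> closure {t. \<psi> t \<noteq> 0} \<subseteq> {..<T}}"

definition heaviside :: "real \<Rightarrow> real" where
  "heaviside t = (if t \<ge> 0 then 1 else 0)"

definition regular_distr :: "(real \<Rightarrow> real) \<Rightarrow> (real \<Rightarrow> real) \<Rightarrow> real" where
  "regular_distr f \<psi> = (LINT t|lebesgue. \<psi> t * f t)"

definition distr_deriv :: "((real \<Rightarrow> real) \<Rightarrow> real) \<Rightarrow> (real \<Rightarrow> real) \<Rightarrow> real" where
  "distr_deriv S \<psi> = - S (deriv \<psi>)"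

definition g_neg :: "real \<Rightarrow> (real \<Rightarrow> real) \<Rightarrow> real" where
  "g_neg \<alpha> \<psi> =
     1 / Gamma (1 - \<alpha>) * distr_deriv (regular_distr (\<lambda>t. heaviside t * t powr (- \<alpha>))) \<psi>"

text \<open>Convolution of a scalar distribution on the line with a function on \<open>(-\<infinity>,T)\<close>, both
  supported in \<open>[0,\<infinity>)\<close>: \<open>\<langle>S * f, \<psi>\<rangle> = \<langle>S(s) \<otimes> f(t), \<psi>(t + s)\<rangle>\<close>.\<close>

definition distr_conv ::
  "real \<Rightarrow> ((real \<Rightarrow> real) \<Rightarrow> real) \<Rightarrow> (real \<Rightarrow> 'a::{banach, second_countable_topology}) \<Rightarrow>
   (real \<Rightarrow> real) \<Rightarrow> 'a" where
  "distr_conv T S f \<psi> = (LINT t:{..<T}|lebesgue. S (\<lambda>s. \<psi> (t + s)) *\<^sub>R f t)"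

definition caputo ::
  "real \<Rightarrow> real \<Rightarrow> 'a::{banach, second_countable_topology} \<Rightarrow> (real \<Rightarrow> 'a) \<Rightarrow>
   (real \<Rightarrow> real) \<Rightarrow> 'a" where
  "caputo \<alpha> T u0 u = distr_conv T (g_neg \<alpha>) (\<lambda>t. heaviside t *\<^sub>R (u t - u0))"

text \<open>\<open>D\<^sub>c\<^sup>\<alpha> u = v\<close> as distributions on \<open>(-\<infinity>,T)\<close>, with \<open>v\<close> in \<open>L\<^sup>1\<^sub>l\<^sub>o\<^sub>c\<close> extended by zero
  to negative times.\<close>

definition has_caputo_derivative ::
  "real \<Rightarrow> real \<Rightarrow> 'a::{banach, second_countable_topology} \<Rightarrow> (real \<Rightarrow> 'a) \<Rightarrow>
   (real \<Rightarrow> 'a) \<Rightarrow> bool" where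
  "has_caputo_derivative \<alpha> T u0 u v \<longleftrightarrow>
     L1_loc T v \<and>
     (\<forall>\<psi>\<in>test_functions T. caputo \<alpha> T u0 u \<psi> = (LINT t:{0..<T}|lebesgue. \<psi> t *\<^sub>R v t))"

definition strong_solution ::
  "real \<Rightarrow> ('a \<Rightarrow> real) \<Rightarrow> 'a \<Rightarrow> real \<Rightarrow>
   (real \<Rightarrow> 'a::{real_inner, banach, second_countable_topology}) \<Rightarrow> bool" where
  "strong_solution \<alpha> \<phi> u0 T u \<longleftrightarrow>
     L1_loc T u \<and>
     ((\<lambda>t. 1 / t * (LINT s:{0..t}|lebesgue. norm (u s - u0))) \<longlongrightarrow> 0) (at_right 0) \<and>
     (\<exists>v. has_caputo_derivative \<alpha> T u0 u v \<and>
          (AE t in lebesgue. t \<in> {0..<T} \<longrightarrow> v t \<in> uminus ` frechet_subdiff \<phi> (u t)))"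

subsection \<open>The numerical scheme\<close>

definition coeff_a :: "real \<Rightarrow> nat \<Rightarrow> real" where
  "coeff_a \<alpha> n = ((real n + 1) powr \<alpha> - real n powr \<alpha>) / Gamma (1 + \<alpha>)"

text \<open>The convolution of sequences is the product of formal power series, and
  \<^term>\<open>coeff_a \<alpha> 0 \<noteq> 0\<close> for \<open>\<alpha> > 0\<close>.\<close>

definition coeff_a_inv :: "real \<Rightarrow> nat \<Rightarrow> real" where
  "coeff_a_inv \<alpha> n = fps_nth (inverse (Abs_fps (coeff_a \<alpha>))) n"

definition coeff_c :: "real \<Rightarrow> nat \<Rightarrow> real" where
  "coeff_c \<alpha> i = (if i = 0 then coeff_a_inv \<alpha> 0 else - coeff_a_inv \<alpha> i)"

definition coeff_cnn :: "real \<Rightarrow> nat \<Rightarrow> real" where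
  "coeff_cnn \<alpha> n = coeff_c \<alpha> 0 - (\<Sum>i\<in>{1..<n}. coeff_c \<alpha> i)"

definition scheme_functional ::
  "real \<Rightarrow> ('a::real_inner \<Rightarrow> real) \<Rightarrow> real \<Rightarrow> (nat \<Rightarrow> 'a) \<Rightarrow> nat \<Rightarrow> 'a \<Rightarrow> real" where
  "scheme_functional \<alpha> \<phi> k U n u =
     1 / (2 * k powr \<alpha>) *
       ((\<Sum>j\<in>{1..<n}. coeff_c \<alpha> j * (norm (u - U (n - j)))\<^sup>2)
         + coeff_cnn \<alpha> n * (norm (u - U 0))\<^sup>2)
     + \<phi> u"

definition numerical_solution ::
  "real \<Rightarrow> ('a::real_inner \<Rightarrow> real) \<Rightarrow> 'a \<Rightarrow> real \<Rightarrow> (nat \<Rightarrow> 'a) \<Rightarrow> bool" where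
  "numerical_solution \<alpha> \<phi> u0 k U \<longleftrightarrow>
     U 0 = u0 \<and> (\<forall>n\<ge>1. is_arg_min (scheme_functional \<alpha> \<phi> k U n) (\<lambda>_. True) (U n))"

definition dyadic_steps :: "real \<Rightarrow> real set" where
  "dyadic_steps T = {T / 2 ^ m | m :: nat. True}"

end

theory Submission
  imports Defs "HOL-Real_Asymp.Real_Asymp"
begin

text \<open>
  Everything rests on one comparison inequality: if \<open>w = g\<^sub>\<alpha> * f\<close> with \<open>f\<close> integrable and
  \<open>\<langle>w, f\<rangle> \<le> \<epsilon> \<parallel>f\<parallel>\<close> almost everywhere, then \<open>\<parallel>w\<parallel>\<^sup>2 \<le> 2 \<epsilon> (g\<^sub>\<alpha> * \<parallel>f\<parallel>)\<close>. For step functions it is the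
  discrete chain inequality, a consequence of the signs of the coefficients \<open>c\<^sub>i\<close>; refining the grid
  gives continuous \<open>f\<close> and density in \<open>L\<^sup>1\<close> the general case, where the smoothed norms
  \<open>sqrt (\<rho>\<^sup>2 + \<parallel>w\<parallel>\<^sup>2)\<close> keep all integrands integrable. With \<open>\<epsilon> = 0\<close> and monotonicity of the
  subdifferential this is uniqueness. The scheme satisfies an energy bound on \<open>g\<^sub>\<alpha> * \<parallel>v\<parallel>\<^sup>2\<close>, \<open>v\<close> being its
  discrete Caputo derivative, so its interpolants are \<open>\<alpha>/2\<close>-Hoelder and solve the inclusion up to an error
  \<open>\<epsilon> = O(k powr (\<alpha>/2))\<close>; comparing two step sizes then gives the Cauchy property with rate \<open>\<alpha>/4\<close>.
  Subgradients are locally bounded by Baire's theorem, so the discrete derivatives converge weakly to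
  the Caputo derivative of the limit.
\<close>

subsection \<open>Coefficients of the scheme\<close>

text \<open>Shape of the comparison inequality: if \<open>f\<close> is merely integrable, so is
  \<open>w\<close>, and nothing makes \<open>w \<bullet> f\<close> integrable; the chain inequality
  for the square of the norm therefore does not survive density in L1. The smoothed norm has a
  gradient of norm at most 1, so its integrand is dominated by \<open>norm f\<close>. This costs a
  factor 1/rho, recovered by squaring and letting rho tend to infinity (not to 0). Rate: the
  inequality bounds a squared distance linearly in the defect, so a defect of order
  \<open>k powr (\<alpha>/2)\<close> leaves \<open>k powr (\<alpha>/4)\<close>. Limit: bounded sets
  of \<open>H\<close> are not compact, so strong convergence has to come from the Cauchy estimate.
  Only then does the weak convergence hypothesis apply, at each fixed time, to base points that
  converge strongly; a uniform bound on the derivatives lets the fractional integrals follow by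
  dominated convergence. Uniqueness: a competing solution satisfies only a distributional identity.
  It is turned into a Volterra equation by testing with smooth approximations of
  \<open>(b - t) powr \<alpha>\<close>, flattened at \<open>b\<close> by an exponential; this
  explains the section on test functions.\<close>

lemma coeff_a_pos: "0 < coeff_a \<alpha> n" if "0 < \<alpha>"
  using that by (auto simp: coeff_a_def intro!: divide_pos_pos powr_less_mono2 Gamma_real_pos)

lemma powr_increment_antimono:
  fixes x :: real
  assumes "0 < \<alpha>" "\<alpha> \<le> 1" "0 \<le> x" "x \<le> y"
  shows "(y + 1) powr \<alpha> - y powr \<alpha> \<le> (x + 1) powr \<alpha> - x powr \<alpha>"
proof -
  let ?f = "\<lambda>y::real. y powr \<alpha> - (y + 1) powr \<alpha>"
  have "?f x \<le> ?f y"
  proof (rule DERIV_nonneg_imp_increasing_open[OF assms(4)])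
    fix z assume z: "x < z" "z < y"
    have "(?f has_real_derivative \<alpha> * z powr (\<alpha> - 1) - \<alpha> * (z + 1) powr (\<alpha> - 1)) (at z)"
      using z assms by (auto intro!: derivative_eq_intros)
    moreover have "(z + 1) powr (\<alpha> - 1) \<le> z powr (\<alpha> - 1)"
      using z assms by (intro powr_mono2') auto
    ultimately show "\<exists>d. (?f has_real_derivative d) (at z) \<and> 0 \<le> d"
      using assms by (intro exI[of _ "\<alpha> * z powr (\<alpha> - 1) - \<alpha> * (z + 1) powr (\<alpha> - 1)"]) auto
  next
    show "continuous_on {x..y} ?f"
      using assms by (auto intro!: continuous_intros continuous_on_powr')
  qed
  then show ?thesis by linarith
qed

lemma coeff_a_antimono:
  assumes "0 < \<alpha>" "\<alpha> < 1" "m \<le> n"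
  shows "coeff_a \<alpha> n \<le> coeff_a \<alpha> m"
  using powr_increment_antimono[of \<alpha> "real m" "real n"] assms
  by (auto simp: coeff_a_def intro!: divide_right_mono less_imp_le[OF Gamma_real_pos])

text \<open>A weighted second difference. Its derivative is nonnegative by AM-GM:
  \<open>l * p + q / l\<close> is at least twice the root of \<open>p * q\<close>, and
  \<open>z * (z + 2) \<le> (z + 1)^2\<close> turns, under the negative exponent
  \<open>\<alpha> - 1\<close>, into \<open>r^2 \<le> p * q\<close>. The free weight \<open>l\<close>
  is what later converts an additive estimate into a multiplicative one.\<close>

lemma powr_second_difference_mono:
  fixes x l :: real
  assumes "0 < \<alpha>" "\<alpha> < 1" "0 \<le> x" "x \<le> y" "0 < l"
  shows "l * x powr \<alpha> + (x + 2) powr \<alpha> / l - 2 * (x + 1) powr \<alpha>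
    \<le> l * y powr \<alpha> + (y + 2) powr \<alpha> / l - 2 * (y + 1) powr \<alpha>"
proof (rule DERIV_nonneg_imp_increasing_open[OF assms(4),
      where f = "\<lambda>x. l * x powr \<alpha> + (x + 2) powr \<alpha> / l - 2 * (x + 1) powr \<alpha>"])
  fix z assume z: "x < z" "z < y"
  let ?d = "\<alpha> * (l * z powr (\<alpha> - 1) + (z + 2) powr (\<alpha> - 1) / l - 2 * (z + 1) powr (\<alpha> - 1))"
  have "((\<lambda>x. l * x powr \<alpha> + (x + 2) powr \<alpha> / l - 2 * (x + 1) powr \<alpha>) has_real_derivative ?d) (at z)"
    using z assms by (auto intro!: derivative_eq_intros simp: field_simps)
  moreover have "0 \<le> ?d"
  proof -
    let ?p = "z powr (\<alpha> - 1)" and ?q = "(z + 2) powr (\<alpha> - 1)" and ?r = "(z + 1) powr (\<alpha> - 1)"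
    have "?r\<^sup>2 = ((z + 1)\<^sup>2) powr (\<alpha> - 1)"
      using z assms by (simp add: power2_eq_square powr_mult)
    also have "\<dots> \<le> (z * (z + 2)) powr (\<alpha> - 1)"
      using z assms by (intro powr_mono2') (auto simp: power2_eq_square algebra_simps intro!: add_pos_pos)
    also have "\<dots> = ?p * ?q"
      using z assms by (simp add: powr_mult)
    finally have "?r\<^sup>2 \<le> ?p * ?q" .
    then have "(2 * ?r)\<^sup>2 \<le> (l * ?p + ?q / l)\<^sup>2"
      using sum_squares_bound[of "l * ?p" "?q / l"] assms by (simp add: power2_sum)
    then have "2 * ?r \<le> l * ?p + ?q / l"
      by (rule power2_le_imp_le) (use assms in auto)
    then show ?thesis using assms by auto
  qed
  ultimately show "\<exists>d. ((\<lambda>x. l * x powr \<alpha> + (x + 2) powr \<alpha> / l - 2 * (x + 1) powr \<alpha>)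
      has_real_derivative d) (at z) \<and> 0 \<le> d" by blast
next
  show "continuous_on {x..y} (\<lambda>x. l * x powr \<alpha> + (x + 2) powr \<alpha> / l - 2 * (x + 1) powr \<alpha>)"
    using assms by (auto intro!: continuous_intros continuous_on_powr')
qed

text \<open>The preceding monotonicity between \<open>n\<close> and \<open>n + 1\<close> reads
  \<open>2 * a (n+1) \<le> l * a n + a (n+2) / l\<close>. The weight
  \<open>l = a (n+1) / a n\<close> makes the first summand equal to \<open>a (n+1)\<close>, which
  leaves log-convexity.\<close>

lemma coeff_a_log_convex:
  assumes "0 < \<alpha>" "\<alpha> < 1"
  shows "(coeff_a \<alpha> (Suc n))\<^sup>2 \<le> coeff_a \<alpha> n * coeff_a \<alpha> (Suc (Suc n))"
proof -
  let ?a = "coeff_a \<alpha>"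
  have pos: "0 < ?a m" for m using coeff_a_pos[OF assms(1)] .
  define l where "l = ?a (Suc n) / ?a n"
  have l: "0 < l" using pos by (simp add: l_def)
  have G: "Gamma (1 + \<alpha>) > 0" using assms by (intro Gamma_real_pos) auto
  have "l * real n powr \<alpha> + (real n + 2) powr \<alpha> / l - 2 * (real n + 1) powr \<alpha>
    \<le> l * (real n + 1) powr \<alpha> + (real n + 1 + 2) powr \<alpha> / l - 2 * (real n + 1 + 1) powr \<alpha>"
    using powr_second_difference_mono[OF assms _ _ l, of "real n" "real n + 1"] by simp
  then have "2 * ((real n + 2) powr \<alpha> - (real n + 1) powr \<alpha>)
    \<le> l * ((real n + 1) powr \<alpha> - real n powr \<alpha>) + ((real n + 3) powr \<alpha> - (real n + 2) powr \<alpha>) / l"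
    by (simp add: algebra_simps diff_divide_distrib)
  from divide_right_mono[OF this less_imp_le[OF G]]
  have "2 * ?a (Suc n) \<le> l * ?a n + ?a (Suc (Suc n)) / l"
    by (simp add: coeff_a_def add_divide_distrib diff_divide_distrib algebra_simps)
  also have "l * ?a n = ?a (Suc n)" using pos[of n] by (simp add: l_def)
  also have "?a (Suc (Suc n)) / l = ?a n * ?a (Suc (Suc n)) / ?a (Suc n)" by (simp add: l_def field_simps)
  finally have "?a (Suc n) \<le> ?a n * ?a (Suc (Suc n)) / ?a (Suc n)" by simp
  then show ?thesis using pos[of "Suc n"] by (simp add: field_simps power2_eq_square)
qed

lemma coeff_a_conv_inv:
  assumes "0 < \<alpha>"
  shows "(\<Sum>i=0..n. coeff_a_inv \<alpha> i * coeff_a \<alpha> (n - i)) = (if n = 0 then 1 else 0)"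
proof -
  have "inverse (Abs_fps (coeff_a \<alpha>)) * Abs_fps (coeff_a \<alpha>) = 1"
    using coeff_a_pos[OF assms, of 0] by (intro inverse_mult_eq_1) auto
  then have "fps_nth (inverse (Abs_fps (coeff_a \<alpha>)) * Abs_fps (coeff_a \<alpha>)) n = fps_nth 1 n" by simp
  then show ?thesis unfolding fps_mult_nth coeff_a_inv_def by simp
qed

lemma coeff_a_inv_0:
  assumes "0 < \<alpha>"
  shows "coeff_a_inv \<alpha> 0 = 1 / coeff_a \<alpha> 0"
  using coeff_a_conv_inv[OF assms, of 0] coeff_a_pos[OF assms, of 0] by (simp add: field_simps)

text \<open>Kaluza's argument: with \<open>r\<^sub>j = a\<^sub>j\<^sub>+\<^sub>1 / a\<^sub>j\<close> nondecreasing, subtract \<open>r\<^sub>n\<close> times the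
  \<open>n\<close>-th convolution identity from the next one.\<close>

lemma coeff_a_inv_nonpos:
  assumes "0 < \<alpha>" "\<alpha> < 1" "1 \<le> n"
  shows "coeff_a_inv \<alpha> n \<le> 0"
  using assms(3)
proof (induction n rule: less_induct)
  case (less m)
  let ?a = "coeff_a \<alpha>" and ?b = "coeff_a_inv \<alpha>"
  have pos: "0 < ?a m" for m using coeff_a_pos[OF assms(1)] .
  define r where "r j = ?a (Suc j) / ?a j" for j
  have "r j \<le> r (Suc j)" for j
    using coeff_a_log_convex[OF assms(1,2), of j] pos by (simp add: r_def field_simps power2_eq_square)
  then have r_mono: "i \<le> j \<Longrightarrow> r i \<le> r j" for i j by (rule lift_Suc_mono_le)
  obtain n where n: "m = Suc n" using less.prems by (cases m) auto
  have "(\<Sum>i=0..Suc n. ?b i * ?a (Suc n - i)) = 0" using coeff_a_conv_inv[OF assms(1), of "Suc n"] by simp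
  then have "?b (Suc n) * ?a 0 = - (\<Sum>i=0..n. ?b i * ?a (Suc n - i))" by simp
  also have "(\<Sum>i=0..n. ?b i * ?a (Suc n - i)) = (\<Sum>i=0..n. ?b i * ?a (n - i) * r (n - i))"
    by (intro sum.cong refl) (use pos in \<open>auto simp: r_def Suc_diff_le less_imp_neq[symmetric]\<close>)
  finally have e: "?b (Suc n) * ?a 0 = - (\<Sum>i=0..n. ?b i * ?a (n - i) * r (n - i))" .
  have "0 \<le> (\<Sum>i=0..n. ?b i * ?a (n - i) * r (n - i))"
  \<comment> \<open>The identity that is subtracted has right-hand side 0 only for
    \<open>n \<ge> 1\<close>; at \<open>n = 0\<close> it is 1 and the claim is a matter of
    signs.\<close>
  proof (cases "n = 0")
    case True
    then show ?thesis using pos coeff_a_inv_0[OF assms(1)] by (auto simp: r_def less_imp_le)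
  next
    case False
    have "0 \<le> (\<Sum>i=0..n. ?b i * ?a (n - i) * (r (n - i) - r n))"
    proof (rule sum_nonneg)
      fix i assume i: "i \<in> {0..n}"
      show "0 \<le> ?b i * ?a (n - i) * (r (n - i) - r n)"
      proof (cases "i = 0")
        case i0: False
        then have "?b i \<le> 0" using less.IH[of i] i n by auto
        moreover have "r (n - i) - r n \<le> 0" using r_mono[of "n - i" n] by simp
        ultimately show ?thesis using pos[of "n - i"]
          by (intro mult_nonpos_nonpos) (auto intro: mult_nonpos_nonneg)
      qed simp
    qed
    also have "\<dots> = (\<Sum>i=0..n. ?b i * ?a (n - i) * r (n - i)) - r n * (\<Sum>i=0..n. ?b i * ?a (n - i))"
      by (simp add: sum_distrib_left sum_subtractf right_diff_distrib mult_ac)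
    finally show ?thesis using coeff_a_conv_inv[OF assms(1), of n] False by simp
  qed
  with e have "?b (Suc n) * ?a 0 \<le> 0" by simp
  then show ?case using pos[of 0] n by (simp add: mult_le_0_iff)
qed

text \<open>In the vanishing convolution sum every \<open>a (n - j)\<close> is replaced by the
  smaller \<open>a n\<close>. The entries with \<open>j \<ge> 1\<close> are nonpositive, so the sum
  can only grow, and it becomes \<open>a n\<close> times the partial sum. These partial sums are the
  weights \<open>coeff_cnn\<close> of the scheme.\<close>

lemma sum_coeff_a_inv_nonneg:
  assumes "0 < \<alpha>" "\<alpha> < 1"
  shows "0 \<le> (\<Sum>j=0..n. coeff_a_inv \<alpha> j)"
proof (cases "n = 0")
  case True
  then show ?thesis using coeff_a_inv_0[OF assms(1)] coeff_a_pos[OF assms(1), of 0] by simp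
next
  case False
  let ?a = "coeff_a \<alpha>" and ?b = "coeff_a_inv \<alpha>"
  have pos: "0 < ?a m" for m using coeff_a_pos[OF assms(1)] .
  have "0 = (\<Sum>j=0..n. ?b j * ?a (n - j))" using coeff_a_conv_inv[OF assms(1), of n] False by simp
  also have "\<dots> \<le> (\<Sum>j=0..n. ?b j * ?a n)"
  proof (rule sum_mono)
    fix j assume "j \<in> {0..n}"
    show "?b j * ?a (n - j) \<le> ?b j * ?a n"
    proof (cases "j = 0")
      case False
      then show ?thesis
        using coeff_a_inv_nonpos[OF assms, of j] coeff_a_antimono[OF assms, of "n - j" n]
        by (intro mult_left_mono_neg) auto
    qed simp
  qed
  also have "\<dots> = (\<Sum>j=0..n. ?b j) * ?a n" by (simp add: sum_distrib_right)
  finally show ?thesis using pos[of n] by (simp add: zero_le_mult_iff)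
qed

text \<open>Testing against a vector reduces the inversion to associativity of the product of
  formal power series.\<close>

lemma sequence_convolution_inverse:
  fixes E F :: "nat \<Rightarrow> 'a::real_inner"
  assumes pq: "Abs_fps p * Abs_fps q = 1"
    and F: "\<And>n. F n = (\<Sum>j=0..n. q j *\<^sub>R E (n - j))"
  shows "E n = (\<Sum>j=0..n. p j *\<^sub>R F (n - j))"
proof -
  have "E n \<bullet> z = (\<Sum>j=0..n. p j *\<^sub>R F (n - j)) \<bullet> z" for z
  proof -
    let ?e = "Abs_fps (\<lambda>n. E n \<bullet> z)"
    have "Abs_fps (\<lambda>n. F n \<bullet> z) = Abs_fps q * ?e"
      by (rule fps_ext) (simp add: F fps_mult_nth inner_sum_left)
    then have "Abs_fps p * Abs_fps (\<lambda>n. F n \<bullet> z) = ?e"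
      using pq by (simp add: mult.assoc[symmetric])
    from arg_cong[OF this, of "\<lambda>f. fps_nth f n"] show ?thesis
      by (simp add: fps_mult_nth inner_sum_left)
  qed
  then show ?thesis by (metis vector_eq_rdot)
qed

lemma fps_coeff_a_inverse:
  assumes "0 < \<alpha>"
  shows "Abs_fps (coeff_a \<alpha>) * Abs_fps (coeff_a_inv \<alpha>) = 1"
    and "Abs_fps (coeff_a_inv \<alpha>) * Abs_fps (coeff_a \<alpha>) = 1"
proof -
  have "Abs_fps (coeff_a_inv \<alpha>) = inverse (Abs_fps (coeff_a \<alpha>))"
    by (rule fps_ext) (simp add: coeff_a_inv_def)
  then show "Abs_fps (coeff_a_inv \<alpha>) * Abs_fps (coeff_a \<alpha>) = 1"
    using coeff_a_pos[OF assms, of 0] by (simp add: inverse_mult_eq_1)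
  then show "Abs_fps (coeff_a \<alpha>) * Abs_fps (coeff_a_inv \<alpha>) = 1" by (simp add: mult.commute)
qed

text \<open>\<open>F\<close> is the discrete Caputo derivative of \<open>W\<close> up to a power of
  the step, and \<open>D\<close> that of \<psi> along \<open>W\<close>. Subtracting the affine
  minorant with slope \<open>p n\<close> makes the resulting \<open>h\<close> minimal at
  \<open>n\<close>; the signs of the inverse coefficients then give
  \<open>D n \<le> p n \<bullet> F n\<close>, and convolution with the positive \<open>a\<close>
  inverts both sides. Subgradients are required only for \<open>n \<ge> 1\<close>, index 0 being
  covered by \<open>F 0 = 0\<close>.\<close>

lemma discrete_chain_inequality:
  fixes W F p :: "nat \<Rightarrow> 'a::real_inner" and \<psi> :: "'a \<Rightarrow> real"
  assumes \<alpha>: "0 < \<alpha>" "\<alpha> < 1"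
    and W: "\<And>n. W n - W 0 = (\<Sum>j=0..n. coeff_a \<alpha> j *\<^sub>R F (n - j))"
    and F0: "F 0 = 0"
    and sub: "\<And>n m. 1 \<le> n \<Longrightarrow> \<psi> (W n) + p n \<bullet> (W m - W n) \<le> \<psi> (W m)"
  shows "\<psi> (W n) - \<psi> (W 0) \<le> (\<Sum>j=0..n. coeff_a \<alpha> j * (p (n - j) \<bullet> F (n - j)))"
proof -
  let ?a = "coeff_a \<alpha>" and ?b = "coeff_a_inv \<alpha>"
  define D where "D n = (\<Sum>j=0..n. ?b j * (\<psi> (W (n - j)) - \<psi> (W 0)))" for n
  have FW: "F n = (\<Sum>j=0..n. ?b j *\<^sub>R (W (n - j) - W 0))" for n
    by (rule sequence_convolution_inverse[where E = F and F = "\<lambda>n. W n - W 0"])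
      (use fps_coeff_a_inverse[OF \<alpha>(1)] W in auto)
  have D: "D n \<le> p n \<bullet> F n" for n
  proof (cases "n = 0")
    case False
    define h where "h m = \<psi> (W m) - p n \<bullet> W m" for m
    have h: "h n \<le> h m" for m
      using sub[of n m] False by (simp add: h_def inner_diff_right)
    obtain n' where n': "n = Suc n'" using False by (cases n) auto
    have "D n - p n \<bullet> F n = (\<Sum>j=0..n. ?b j * (h (n - j) - h 0))"
      unfolding FW D_def inner_sum_right sum_subtractf[symmetric]
      by (intro sum.cong) (auto simp: h_def algebra_simps)
    also have "\<dots> = (\<Sum>j=0..n'. ?b j * (h (n - j) - h 0))" by (simp add: n')
    \<comment> \<open>The reference value is moved from \<open>h 0\<close> to the minimum
      \<open>h n\<close>. The \<open>j = 0\<close> term of the new sum vanishes, so only nonpositive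
      coefficients meet nonnegative differences; the correction carries a nonnegative partial
      sum.\<close>
    also have "\<dots> = (\<Sum>j=0..n'. ?b j * (h (n - j) - h n)) + (\<Sum>j=0..n'. ?b j) * (h n - h 0)"
      by (simp only: sum_distrib_right sum.distrib[symmetric]) (simp add: algebra_simps)
    also have "\<dots> \<le> 0"
    proof -
      have "(\<Sum>j=0..n'. ?b j * (h (n - j) - h n)) \<le> 0"
      proof (rule sum_nonpos)
        fix j
        show "?b j * (h (n - j) - h n) \<le> 0"
          using coeff_a_inv_nonpos[OF \<alpha>, of j] h[of "n - j"] 
          by (cases "j = 0") (auto intro: mult_nonpos_nonneg)
      qed
      moreover have "(\<Sum>j=0..n'. ?b j) * (h n - h 0) \<le> 0"
        using sum_coeff_a_inv_nonneg[OF \<alpha>, of n'] h[of 0] by (intro mult_nonneg_nonpos) auto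
      ultimately show ?thesis by linarith
    qed
    finally show ?thesis by simp
  qed (simp add: D_def F0)
  have "\<psi> (W n) - \<psi> (W 0) = (\<Sum>j=0..n. ?a j *\<^sub>R D (n - j))"
    by (rule sequence_convolution_inverse[where E = "\<lambda>n. \<psi> (W n) - \<psi> (W 0)"])
      (use fps_coeff_a_inverse[OF \<alpha>(1)] in \<open>auto simp: D_def\<close>)
  also have "\<dots> \<le> (\<Sum>j=0..n. ?a j * (p (n - j) \<bullet> F (n - j)))"
    using D less_imp_le[OF coeff_a_pos[OF \<alpha>(1)]] by (auto intro!: sum_mono mult_left_mono)
  finally show ?thesis .
qed

subsection \<open>Convex analysis and the implicit scheme\<close>

text \<open>The form of lower semicontinuity used throughout: for minimizing sequences, for closed
  sublevel sets and for limits of subgradient inequalities.\<close>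

lemma lower_semicontinuous_sequence_le:
  fixes \<phi> :: "'a::metric_space \<Rightarrow> real"
  assumes lsc: "lower_semicontinuous \<phi>" and x: "xs \<longlonglongrightarrow> x"
    and c: "c \<longlonglongrightarrow> l" and le: "\<And>n. \<phi> (xs n) \<le> c n"
  shows "\<phi> x \<le> l"
proof (rule ccontr)
  assume "\<not> \<phi> x \<le> l"
  then obtain d where d: "l < d" "d < \<phi> x" using dense[of l "\<phi> x"] by auto
  have "ereal d < Liminf (at x) (\<lambda>y. ereal (\<phi> y))"
    using lsc d(2) unfolding lower_semicontinuous_def by (meson ereal_less(2) less_ereal.simps(1) less_le_trans)
  from less_LiminfD[OF this] have "\<forall>\<^sub>F y in at x. d < \<phi> y" by simp
  \<comment> \<open>The lower limit ignores the point \<open>x\<close> itself, which the sequence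
    may hit; there the bound holds by the choice of \<open>d\<close>.\<close>
  then have "\<forall>\<^sub>F y in nhds x. d < \<phi> y" using d(2) by (auto simp: eventually_at_filter elim: eventually_mono)
  with x have "\<forall>\<^sub>F n in sequentially. d < \<phi> (xs n)" by (rule eventually_compose_filterlim[rotated])
  moreover have "\<forall>\<^sub>F n in sequentially. c n < d" using order_tendstoD(2)[OF c d(1)] .
  ultimately have "\<forall>\<^sub>F n in sequentially. False"
    by eventually_elim (use le in \<open>meson less_trans not_le\<close>)
  then show False by simp
qed

text \<open>The lower limit controls the difference quotient only near \<open>u\<close>, up to an
  error \<open>e\<close>. Convexity along the segment from \<open>u\<close> to \<open>w\<close>
  carries the estimate at a nearby point to \<open>w\<close>, after which \<open>e\<close> is
  arbitrary.\<close>

lemma frechet_subdiff_convex: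
  fixes \<phi> :: "'a::real_inner \<Rightarrow> real"
  assumes conv: "convex_on UNIV \<phi>"
  shows "\<xi> \<in> frechet_subdiff \<phi> u \<longleftrightarrow> (\<forall>w. \<phi> u + \<xi> \<bullet> (w - u) \<le> \<phi> w)"
proof
  assume R: "\<forall>w. \<phi> u + \<xi> \<bullet> (w - u) \<le> \<phi> w"
  show "\<xi> \<in> frechet_subdiff \<phi> u" unfolding frechet_subdiff_def mem_Collect_eq
  proof (intro Liminf_bounded always_eventually allI)
    fix w
    have "0 \<le> (\<phi> w - \<phi> u - \<xi> \<bullet> (w - u)) / norm (w - u)"
      using R[rule_format, of w] by (intro divide_nonneg_nonneg) auto
    then show "0 \<le> ereal ((\<phi> w - \<phi> u - \<xi> \<bullet> (w - u)) / norm (w - u))" by simp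
  qed
next
  assume L: "\<xi> \<in> frechet_subdiff \<phi> u"
  show "\<forall>w. \<phi> u + \<xi> \<bullet> (w - u) \<le> \<phi> w"
  proof
    fix w
    show "\<phi> u + \<xi> \<bullet> (w - u) \<le> \<phi> w"
    proof (cases "w = u")
      case False
      then have nz: "norm (w - u) > 0" by simp
      let ?g = "\<phi> w - \<phi> u - \<xi> \<bullet> (w - u)"
      have "- (e * norm (w - u)) \<le> ?g" if e: "0 < e" for e
      proof -
        have "ereal (-e) < Liminf (at u) (\<lambda>w. ereal ((\<phi> w - \<phi> u - \<xi> \<bullet> (w - u)) / norm (w - u)))"
          using L e unfolding frechet_subdiff_def
          by (auto intro: less_le_trans[of _ 0])
        from less_LiminfD[OF this]
        obtain d where d: "0 < d" "\<And>y. y \<noteq> u \<Longrightarrow> dist y u < d \<Longrightarrow> -e < (\<phi> y - \<phi> u - \<xi> \<bullet> (y - u)) / norm (y - u)"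
          unfolding eventually_at by auto
        \<comment> \<open>Small enough to place the point of the segment within distance
          \<open>d\<close> of \<open>u\<close>, and at most 1 so that convexity applies.\<close>
        define s where "s = min 1 (d / (2 * norm (w - u)))"
        have s: "0 < s" "s \<le> 1" using d nz by (auto simp: s_def)
        have "s * norm (w - u) \<le> (d / (2 * norm (w - u))) * norm (w - u)"
          by (intro mult_right_mono) (auto simp: s_def)
        also have "\<dots> = d / 2" using nz by simp
        finally have sd: "s * norm (w - u) < d" using d by simp
        define y where "y = (1 - s) *\<^sub>R u + s *\<^sub>R w"
        have y: "y - u = s *\<^sub>R (w - u)" by (simp add: y_def algebra_simps)
        have "y \<noteq> u" using y s False by (metis eq_iff_diff_eq_0 less_irrefl scaleR_eq_0_iff)
        moreover have "dist y u < d" using sd s by (simp add: dist_norm y)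
        ultimately have "-e < (\<phi> y - \<phi> u - \<xi> \<bullet> (y - u)) / norm (y - u)" by (rule d(2))
        also have "\<dots> = (\<phi> y - \<phi> u - s * (\<xi> \<bullet> (w - u))) / (s * norm (w - u))" using s by (simp add: y)
        finally have "- e * (s * norm (w - u)) < \<phi> y - \<phi> u - s * (\<xi> \<bullet> (w - u))"
          using s nz by (simp add: pos_less_divide_eq)
        also have "\<phi> y \<le> (1 - s) * \<phi> u + s * \<phi> w"
          using convex_onD[OF conv, of s u w] s by (simp add: y_def)
        finally have "s * (- (e * norm (w - u))) < s * ?g" by (simp add: algebra_simps)
        then show ?thesis using s by (simp only: mult_less_cancel_left_pos)
      qed
      then have "- e \<le> ?g" if "0 < e" for e
        using that nz by (metis divide_pos_pos nonzero_divide_eq_eq less_irrefl)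
      then have "0 \<le> ?g + e" if "0 < e" for e by (metis add.commute add.right_inverse add_left_mono that)
      then have "0 \<le> ?g" by (rule field_le_epsilon)
      then show ?thesis by simp
    qed simp
  qed
qed

section \<open>Well-posedness and optimality condition of the implicit step\<close>

lemma quadratic_perturbation_unique_minimizer:
  fixes \<phi> :: "'a::{real_inner, banach} \<Rightarrow> real" and m :: 'a
  assumes lsc: "lower_semicontinuous \<phi>" and conv: "convex_on UNIV \<phi>" and bdd: "bdd_below (range \<phi>)"
    and mu: "0 < \<mu>"
  shows "\<exists>!x. \<forall>y. \<mu> / 2 * (norm x)\<^sup>2 - x \<bullet> m + \<phi> x \<le> \<mu> / 2 * (norm y)\<^sup>2 - y \<bullet> m + \<phi> y"
proof -
  let ?q = "\<lambda>x. \<mu> / 2 * (norm x)\<^sup>2 - x \<bullet> m"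
  let ?J = "\<lambda>x. ?q x + \<phi> x"
  obtain B where B: "\<And>x. B \<le> \<phi> x" using bdd by (auto simp: bdd_below_def)
  \<comment> \<open>The parallelogram law computes the midpoint defect of the quadratic part
    exactly, and convexity of \<phi> only adds to it. This uniform convexity makes minimizing
    sequences Cauchy, so no weak compactness enters, and it also gives uniqueness.\<close>
  have mid: "\<mu> / 8 * (norm (x - y))\<^sup>2 \<le> (?J x + ?J y) / 2 - ?J ((1/2) *\<^sub>R (x + y))" for x y
  proof -
    have "\<phi> ((1/2) *\<^sub>R (x + y)) \<le> (\<phi> x + \<phi> y) / 2"
      using convex_onD[OF conv, of "1/2" x y] by (simp add: scaleR_add_right)
    moreover have "(?q x + ?q y) / 2 - ?q ((1/2) *\<^sub>R (x + y)) = \<mu> / 8 * (norm (x - y))\<^sup>2"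
      unfolding power2_norm_eq_inner
      by (simp add: inner_add_left inner_add_right inner_diff_left inner_diff_right inner_commute field_simps)
    ultimately show ?thesis by (simp add: field_simps)
  qed
  \<comment> \<open>Completing the square around \<open>m / \<mu>\<close>.\<close>
  have lower: "B - (norm m)\<^sup>2 / (2 * \<mu>) \<le> ?J x" for x
  proof -
    have "0 \<le> \<mu> / 2 * (norm (x - (1/\<mu>) *\<^sub>R m))\<^sup>2" using mu by simp
    also have "\<dots> = ?q x + (norm m)\<^sup>2 / (2 * \<mu>)"
      unfolding power2_norm_eq_inner using mu
      by (simp add: inner_diff_left inner_diff_right inner_commute field_simps)
    finally show ?thesis using B[of x] by linarith
  qed
  define I where "I = (INF x. ?J x)"
  have bJ: "bdd_below (range ?J)" using lower by (auto simp: bdd_below_def)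
  have I: "I \<le> ?J x" for x unfolding I_def using bJ by (rule cINF_lower) simp
  have "\<exists>x. ?J x < I + 1 / real (Suc n)" for n
  proof (rule ccontr)
    assume "\<nexists>x. ?J x < I + 1 / real (Suc n)"
    then have "I + 1 / real (Suc n) \<le> I" unfolding I_def by (intro cINF_greatest) (auto simp: not_less)
    moreover have "0 < 1 / real (Suc n)" by simp
    ultimately show False by linarith
  qed
  then obtain xs where xs: "\<And>n. ?J (xs n) < I + 1 / real (Suc n)" by metis
  have est: "\<mu> / 8 * (norm (xs i - xs j))\<^sup>2 \<le> 1 / real (Suc n)" if "n \<le> i" "n \<le> j" for i j n
  proof -
    have "\<mu> / 8 * (norm (xs i - xs j))\<^sup>2 \<le> (?J (xs i) + ?J (xs j)) / 2 - I"
      using mid[of "xs i" "xs j"] I[of "(1/2) *\<^sub>R (xs i + xs j)"] by linarith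
    moreover have "1 / real (Suc i) \<le> 1 / real (Suc n)" "1 / real (Suc j) \<le> 1 / real (Suc n)"
      using that by (auto intro!: divide_left_mono)
    ultimately show ?thesis using xs[of i] xs[of j] by argo
  qed
  have "Cauchy xs"
  proof (rule metric_CauchyI)
    fix e :: real assume e: "0 < e"
    then have "0 < \<mu> / 8 * e\<^sup>2" using mu by simp
    then obtain n where n: "1 / real (Suc n) < \<mu> / 8 * e\<^sup>2" using nat_approx_posE by blast
    show "\<exists>M. \<forall>m\<ge>M. \<forall>n\<ge>M. dist (xs m) (xs n) < e"
    proof (intro exI[of _ n] allI impI)
      fix i j assume "n \<le> i" "n \<le> j"
      from est[OF this] n have "(norm (xs i - xs j))\<^sup>2 < e\<^sup>2" using mu
        by (smt (verit) mult_less_cancel_left_pos divide_pos_pos)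
      then show "dist (xs i) (xs j) < e" using e by (simp add: dist_norm power_less_imp_less_base)
    qed
  qed
  then obtain x where x: "xs \<longlonglongrightarrow> x" using Cauchy_convergent_iff convergent_def by blast
  have "\<phi> x \<le> I - ?q x"
  proof (rule lower_semicontinuous_sequence_le[OF lsc x])
    have "(\<lambda>n. I + 1 / real (Suc n) - ?q (xs n)) \<longlonglongrightarrow> I + 0 - ?q x"
      by (intro tendsto_intros x LIMSEQ_Suc[OF lim_1_over_n])
    then show "(\<lambda>n. I + 1 / real (Suc n) - ?q (xs n)) \<longlonglongrightarrow> I - ?q x" by simp
    show "\<phi> (xs n) \<le> I + 1 / real (Suc n) - ?q (xs n)" for n using xs[of n] by linarith
  qed
  then have xmin: "?J x \<le> I" by simp
  show ?thesis
  proof (rule ex1I[of _ x])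
    show "\<forall>y. ?J x \<le> ?J y" using xmin I order_trans by blast
    fix z assume "\<forall>y. ?J z \<le> ?J y"
    then have "?J z \<le> I" using xmin order_trans by blast
    then have "\<mu> / 8 * (norm (z - x))\<^sup>2 \<le> 0"
      using mid[of z x] xmin I[of "(1/2) *\<^sub>R (z + x)"] by argo
    then show "z = x" using mu by (simp add: mult_le_0_iff)
  qed
qed

text \<open>The Euler-Lagrange inclusion without differentiating \<phi>: the minimizer is compared
  with \<open>x + s (w - x)\<close>, convexity makes \<phi> affine in \<open>s\<close> from above,
  and after division by \<open>s\<close> the quadratic remainder is of order
  \<open>s\<close>.\<close>

lemma quadratic_perturbation_minimizer_subgradient:
  fixes \<phi> :: "'a::real_inner \<Rightarrow> real" and m x :: 'a
  assumes conv: "convex_on UNIV \<phi>" and mu: "0 < \<mu>"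
    and min: "\<And>y. \<mu> / 2 * (norm x)\<^sup>2 - x \<bullet> m + \<phi> x \<le> \<mu> / 2 * (norm y)\<^sup>2 - y \<bullet> m + \<phi> y"
  shows "\<phi> x + (m - \<mu> *\<^sub>R x) \<bullet> (w - x) \<le> \<phi> w"
proof -
  let ?g = "\<phi> w - \<phi> x - (m - \<mu> *\<^sub>R x) \<bullet> (w - x)"
  have g: "- (s * (\<mu> / 2 * (norm (w - x))\<^sup>2)) \<le> ?g" if s: "0 < s" "s \<le> 1" for s
  proof -
    define y where "y = (1 - s) *\<^sub>R x + s *\<^sub>R w"
    have y: "y = x + s *\<^sub>R (w - x)" by (simp add: y_def algebra_simps)
    have "\<mu> / 2 * (norm x)\<^sup>2 - x \<bullet> m + \<phi> x \<le> \<mu> / 2 * (norm y)\<^sup>2 - y \<bullet> m + \<phi> y" by (rule min)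
    also have "\<phi> y \<le> (1 - s) * \<phi> x + s * \<phi> w"
      using convex_onD[OF conv, of s x w] s by (simp add: y_def)
    also have "\<mu> / 2 * (norm y)\<^sup>2 - y \<bullet> m =
        \<mu> / 2 * (norm x)\<^sup>2 - x \<bullet> m + s * ((\<mu> *\<^sub>R x - m) \<bullet> (w - x)) + s * (s * (\<mu> / 2 * (norm (w - x))\<^sup>2))"
      unfolding y power2_norm_eq_inner
      by (simp add: inner_add_left inner_add_right inner_diff_left inner_diff_right inner_commute field_simps)
    finally have "s * (- (s * (\<mu> / 2 * (norm (w - x))\<^sup>2))) \<le> s * ?g"
      by (simp add: algebra_simps)
    then show ?thesis using s by (simp only: mult_le_cancel_left_pos)
  qed
  have "((\<lambda>s. - (s * (\<mu> / 2 * (norm (w - x))\<^sup>2))) \<longlongrightarrow> - (0 * (\<mu> / 2 * (norm (w - x))\<^sup>2))) (at_right 0)"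
    by (intro tendsto_intros)
  moreover have "\<forall>\<^sub>F s in at_right 0. - (s * (\<mu> / 2 * (norm (w - x))\<^sup>2)) \<le> ?g"
    unfolding eventually_at_right[OF zero_less_one] using g by (intro exI[of _ 1]) auto
  ultimately have "- (0 * (\<mu> / 2 * (norm (w - x))\<^sup>2)) \<le> ?g"
    by (rule tendsto_upperbound) simp
  then show ?thesis by simp
qed

lemma coeff_cnn_eq: "1 \<le> n \<Longrightarrow> coeff_cnn \<alpha> n = (\<Sum>j=0..n - 1. coeff_a_inv \<alpha> j)"
proof -
  assume "1 \<le> n"
  then have e: "{0..n - 1} = insert 0 {1..<n}" by auto
  show ?thesis unfolding e coeff_cnn_def coeff_c_def by (simp add: sum_negf)
qed

text \<open>By the choice of \<open>coeff_cnn\<close> all weights of the squared distances add up to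
  \<open>coeff_c \<alpha> 0\<close>, so the history enters only through a linear term and a
  constant. This reduces every step of the scheme to the two preceding lemmas.\<close>

lemma scheme_functional_quadratic:
  fixes \<phi> :: "'a::real_inner \<Rightarrow> real" and U :: "nat \<Rightarrow> 'a" and \<alpha> k :: real
  assumes n: "1 \<le> n" and k: "0 < k"
  defines "m \<equiv> (1 / k powr \<alpha>) *\<^sub>R ((\<Sum>j\<in>{1..<n}. coeff_c \<alpha> j *\<^sub>R U (n - j)) + coeff_cnn \<alpha> n *\<^sub>R U 0)"
  shows "\<exists>K. \<forall>u. scheme_functional \<alpha> \<phi> k U n u = (coeff_c \<alpha> 0 / k powr \<alpha>) / 2 * (norm u)\<^sup>2 - u \<bullet> m + \<phi> u + K"
proof (intro exI allI)
  fix u :: 'a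
  let ?c = "coeff_c \<alpha>" and ?cn = "coeff_cnn \<alpha> n"
  let ?K = "1 / (2 * k powr \<alpha>) * ((\<Sum>j\<in>{1..<n}. ?c j * (norm (U (n - j)))\<^sup>2) + ?cn * (norm (U 0))\<^sup>2)"
  have sq: "(norm (u - x))\<^sup>2 = (norm u)\<^sup>2 - 2 * (u \<bullet> x) + (norm x)\<^sup>2" for x
    unfolding power2_norm_eq_inner by (simp add: inner_diff_left inner_diff_right inner_commute)
  have "(\<Sum>j\<in>{1..<n}. ?c j * (norm (u - U (n - j)))\<^sup>2) + ?cn * (norm (u - U 0))\<^sup>2
    = ((\<Sum>j\<in>{1..<n}. ?c j) + ?cn) * (norm u)\<^sup>2 - 2 * (u \<bullet> ((\<Sum>j\<in>{1..<n}. ?c j *\<^sub>R U (n - j)) + ?cn *\<^sub>R U 0))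
      + ((\<Sum>j\<in>{1..<n}. ?c j * (norm (U (n - j)))\<^sup>2) + ?cn * (norm (U 0))\<^sup>2)"
    unfolding sq by (simp add: inner_add_right inner_sum_right sum_distrib_right sum_distrib_left
        sum.distrib sum_subtractf algebra_simps)
  also have "(\<Sum>j\<in>{1..<n}. ?c j) + ?cn = ?c 0" by (simp add: coeff_cnn_def)
  finally have eq: "(\<Sum>j\<in>{1..<n}. ?c j * (norm (u - U (n - j)))\<^sup>2) + ?cn * (norm (u - U 0))\<^sup>2
    = ?c 0 * (norm u)\<^sup>2 - 2 * (u \<bullet> ((\<Sum>j\<in>{1..<n}. ?c j *\<^sub>R U (n - j)) + ?cn *\<^sub>R U 0))
      + ((\<Sum>j\<in>{1..<n}. ?c j * (norm (U (n - j)))\<^sup>2) + ?cn * (norm (U 0))\<^sup>2)" .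
  show "scheme_functional \<alpha> \<phi> k U n u = (?c 0 / k powr \<alpha>) / 2 * (norm u)\<^sup>2 - u \<bullet> m + \<phi> u + ?K"
    unfolding scheme_functional_def m_def inner_scaleR_right eq using k by (simp add: field_simps)
qed

lemma coeff_c_0_pos: "0 < \<alpha> \<Longrightarrow> 0 < coeff_c \<alpha> 0"
  using coeff_a_pos[of \<alpha> 0] by (simp add: coeff_c_def coeff_a_inv_0)

lemma scheme_functional_unique_minimizer:
  fixes \<phi> :: "'a::{real_inner, banach} \<Rightarrow> real"
  assumes "0 < \<alpha>" "lower_semicontinuous \<phi>" "convex_on UNIV \<phi>" "bdd_below (range \<phi>)" "0 < k" "1 \<le> n"
  shows "\<exists>!x. is_arg_min (scheme_functional \<alpha> \<phi> k U n) (\<lambda>_. True) x"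
proof -
  obtain K where K: "\<And>u. scheme_functional \<alpha> \<phi> k U n u = (coeff_c \<alpha> 0 / k powr \<alpha>) / 2 * (norm u)\<^sup>2
     - u \<bullet> ((1 / k powr \<alpha>) *\<^sub>R ((\<Sum>j\<in>{1..<n}. coeff_c \<alpha> j *\<^sub>R U (n - j)) + coeff_cnn \<alpha> n *\<^sub>R U 0)) + \<phi> u + K"
    using scheme_functional_quadratic[OF assms(6,5), of \<alpha> \<phi> U] by blast
  have "0 < coeff_c \<alpha> 0 / k powr \<alpha>" using coeff_c_0_pos assms by simp
  from quadratic_perturbation_unique_minimizer[OF assms(2-4) this]
  show ?thesis unfolding is_arg_min_linorder K by (simp only: add_le_cancel_right simp_thms)
qed

lemma numerical_solution_exists_unique:
  fixes \<phi> :: "'a::{real_inner, banach} \<Rightarrow> real"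
  assumes "0 < \<alpha>" "lower_semicontinuous \<phi>" "convex_on UNIV \<phi>" "bdd_below (range \<phi>)" "0 < k"
  shows "\<exists>!U. numerical_solution \<alpha> \<phi> u0 k U"
proof -
  \<comment> \<open>Step \<open>n\<close> sees only indices below \<open>n\<close>, which is what
    recursive choice along the naturals and the uniqueness induction both rest on.\<close>
  have local: "scheme_functional \<alpha> \<phi> k U n = scheme_functional \<alpha> \<phi> k U' n"
    if "\<And>m. m < n \<Longrightarrow> U m = U' m" "1 \<le> n" for U U' :: "nat \<Rightarrow> 'a" and n
    using that by (auto simp: scheme_functional_def fun_eq_iff intro!: sum.cong)
  let ?P = "\<lambda>U n x. if n = 0 then x = u0 else is_arg_min (scheme_functional \<alpha> \<phi> k U n) (\<lambda>_. True) x"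
  have ns: "numerical_solution \<alpha> \<phi> u0 k U \<longleftrightarrow> (\<forall>n. ?P U n (U n))" for U
    unfolding numerical_solution_def by (auto split: if_splits)
  have "\<exists>U. \<forall>n. ?P U n (U n)"
  proof (rule dependent_wellorder_choice)
    fix r and U U' :: "nat \<Rightarrow> 'a" and n :: nat
    assume "\<And>m. m < n \<Longrightarrow> U m = U' m"
    then show "?P U n r = ?P U' n r" using local[of n U U'] by auto
  next
    fix n :: nat and U :: "nat \<Rightarrow> 'a"
    show "\<exists>r. ?P U n r"
      using scheme_functional_unique_minimizer[OF assms, of n U] by (cases "n = 0") auto
  qed
  then obtain U where U: "numerical_solution \<alpha> \<phi> u0 k U" using ns by blast
  moreover have "U' = U" if U': "numerical_solution \<alpha> \<phi> u0 k U'" for U'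
  proof
    fix n
    show "U' n = U n"
    proof (induction n rule: less_induct)
      case (less n)
      show ?case
      proof (cases "n = 0")
        case False
        then have n: "1 \<le> n" by simp
        then have eq: "scheme_functional \<alpha> \<phi> k U' n = scheme_functional \<alpha> \<phi> k U n"
          by (intro local less) auto
        have "is_arg_min (scheme_functional \<alpha> \<phi> k U' n) (\<lambda>_. True) (U' n)"
          "is_arg_min (scheme_functional \<alpha> \<phi> k U n) (\<lambda>_. True) (U n)"
          using U U' n by (simp_all add: numerical_solution_def)
        then have "is_arg_min (scheme_functional \<alpha> \<phi> k U n) (\<lambda>_. True) (U' n)"
          "is_arg_min (scheme_functional \<alpha> \<phi> k U n) (\<lambda>_. True) (U n)"
          unfolding eq .
        then show ?thesis using scheme_functional_unique_minimizer[OF assms n, of U] by blast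
      qed (use U U' in \<open>auto simp: numerical_solution_def\<close>)
    qed
  qed
  ultimately show ?thesis by blast
qed

text \<open>\<open>V\<close> is the discrete Caputo derivative of the scheme: \<open>U - u0\<close>
  convolved with the inverse coefficients and divided by \<open>k powr \<alpha>\<close>. The
  optimality condition of step \<open>n\<close> says that \<open>- V n\<close> is a subgradient at
  \<open>U n\<close>, so the scheme is the implicit discretization of the flow.\<close>

lemma numerical_solution_subgradients:
  fixes \<phi> :: "'a::{real_inner, banach} \<Rightarrow> real"
  assumes \<alpha>: "0 < \<alpha>" and conv: "convex_on UNIV \<phi>" and k: "0 < k"
    and U: "numerical_solution \<alpha> \<phi> u0 k U"
  obtains V where "V 0 = 0"
    and "\<And>n. U n - u0 = (\<Sum>j=0..n. coeff_a \<alpha> j *\<^sub>R (k powr \<alpha> *\<^sub>R V (n - j)))"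
    and "\<And>n w. 1 \<le> n \<Longrightarrow> \<phi> (U n) - V n \<bullet> (w - U n) \<le> \<phi> w"
proof -
  have U0: "U 0 = u0" using U by (simp add: numerical_solution_def)
  let ?b = "coeff_a_inv \<alpha>"
  define V where "V n = (1 / k powr \<alpha>) *\<^sub>R (\<Sum>j=0..n. ?b j *\<^sub>R (U (n - j) - u0))" for n
  have kV: "k powr \<alpha> *\<^sub>R V n = (\<Sum>j=0..n. ?b j *\<^sub>R (U (n - j) - u0))" for n
    using k by (simp add: V_def)
  show ?thesis
  proof (rule that[of V])
    show "V 0 = 0" by (simp add: V_def U0)
    show "U n - u0 = (\<Sum>j=0..n. coeff_a \<alpha> j *\<^sub>R (k powr \<alpha> *\<^sub>R V (n - j)))" for n
      by (rule sequence_convolution_inverse[where E = "\<lambda>n. U n - u0", OF fps_coeff_a_inverse(1)[OF \<alpha>] kV])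
    fix n :: nat and w assume n: "1 \<le> n"
    define m where "m = (1 / k powr \<alpha>) *\<^sub>R ((\<Sum>j\<in>{1..<n}. coeff_c \<alpha> j *\<^sub>R U (n - j)) + coeff_cnn \<alpha> n *\<^sub>R U 0)"
    let ?mu = "coeff_c \<alpha> 0 / k powr \<alpha>"
    obtain K where K: "\<And>u. scheme_functional \<alpha> \<phi> k U n u = ?mu / 2 * (norm u)\<^sup>2 - u \<bullet> m + \<phi> u + K"
      using scheme_functional_quadratic[OF n k, of \<alpha> \<phi> U] unfolding m_def by blast
    have "is_arg_min (scheme_functional \<alpha> \<phi> k U n) (\<lambda>_. True) (U n)"
      using U n by (simp add: numerical_solution_def)
    then have "?mu / 2 * (norm (U n))\<^sup>2 - U n \<bullet> m + \<phi> (U n) \<le> ?mu / 2 * (norm y)\<^sup>2 - y \<bullet> m + \<phi> y" for y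
      unfolding is_arg_min_linorder K by simp
    moreover have "0 < ?mu" using coeff_c_0_pos \<alpha> k by simp
    ultimately have "\<phi> (U n) + (m - ?mu *\<^sub>R U n) \<bullet> (w - U n) \<le> \<phi> w"
      by (intro quadratic_perturbation_minimizer_subgradient[OF conv])
    moreover have "m - ?mu *\<^sub>R U n = - V n"
    proof -
      have e': "{0..n - 1} = insert 0 {1..<n}" using n by auto
      \<comment> \<open>The \<open>j = n\<close> term is zero because \<open>U 0 = u0\<close>;
        without it the coefficient of \<open>u0\<close> is exactly
        \<open>coeff_cnn \<alpha> n\<close>.\<close>
      have "(\<Sum>j=0..n. ?b j *\<^sub>R (U (n - j) - u0)) = (\<Sum>j=0..n-1. ?b j *\<^sub>R (U (n - j) - u0))"
        using n U0 by (cases n) auto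
      also have "\<dots> = (\<Sum>j=0..n-1. ?b j *\<^sub>R U (n - j)) - (\<Sum>j=0..n-1. ?b j) *\<^sub>R u0"
        by (simp add: scaleR_diff_right sum_subtractf scaleR_sum_left)
      also have "(\<Sum>j=0..n-1. ?b j) = coeff_cnn \<alpha> n" using coeff_cnn_eq[OF n] by simp
      also have "(\<Sum>j=0..n-1. ?b j *\<^sub>R U (n - j)) = coeff_c \<alpha> 0 *\<^sub>R U n - (\<Sum>j\<in>{1..<n}. coeff_c \<alpha> j *\<^sub>R U (n - j))"
        unfolding e' by (simp add: coeff_c_def sum_negf)
      finally have eq: "(\<Sum>j=0..n. ?b j *\<^sub>R (U (n - j) - u0)) =
        coeff_c \<alpha> 0 *\<^sub>R U n - (\<Sum>j\<in>{1..<n}. coeff_c \<alpha> j *\<^sub>R U (n - j)) - coeff_cnn \<alpha> n *\<^sub>R u0" .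
      show ?thesis unfolding V_def m_def U0 eq by (simp add: algebra_simps)
    qed
    ultimately show "\<phi> (U n) - V n \<bullet> (w - U n) \<le> \<phi> w" by simp
  qed
qed

section \<open>Local bounds and closedness for subgradients\<close>

lemma convex_lsc_locally_bounded_above:
  fixes \<phi> :: "'a::banach \<Rightarrow> real"
  assumes lsc: "lower_semicontinuous \<phi>" and conv: "convex_on UNIV \<phi>"
  obtains r M where "0 < r" "\<And>x. dist x v < r \<Longrightarrow> \<phi> x \<le> M"
proof -
  define A where "A n = {x. \<phi> x \<le> real n}" for n
  have clA: "closed (A n)" for n
    unfolding closed_sequential_limits A_def
    using lower_semicontinuous_sequence_le[OF lsc] by (metis (mono_tags) mem_Collect_eq tendsto_const)
  have "(\<Union>n. A n) = UNIV" using real_arch_simple by (auto simp: A_def)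
  have "\<exists>n. interior (A n) \<noteq> {}"
  proof (rule ccontr)
    assume "\<not> (\<exists>n. interior (A n) \<noteq> {})"
    then have "Met_TC.mtopology interior_of \<Union>(range A) = {}"
      by (intro Met_TC.metric_Baire_category_alt) (use clA complete_UNIV in auto)
    then show False using \<open>(\<Union>n. A n) = UNIV\<close> by simp
  qed
  then obtain n x0 where "x0 \<in> interior (A n)" by blast
  then obtain r where r: "0 < r" "ball x0 r \<subseteq> A n" by (auto simp: mem_interior)
  \<comment> \<open>Baire yields a ball around some \<open>x0\<close>, not around \<open>v\<close>.
    With \<open>y\<close> the reflection of \<open>x0\<close> in \<open>v\<close>, every
    \<open>x\<close> near \<open>v\<close> is the midpoint of \<open>y\<close> and a point
    \<open>z\<close> near \<open>x0\<close>, and convexity transports the bound.\<close>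
  define y where "y = 2 *\<^sub>R v - x0"
  show ?thesis
  proof (rule that[of "r / 2" "(\<phi> y + real n) / 2"])
    show "0 < r / 2" using r by simp
    fix x assume x: "dist x v < r / 2"
    define z where "z = 2 *\<^sub>R x - y"
    have "z - x0 = 2 *\<^sub>R (x - v)" by (simp add: z_def y_def scaleR_2 algebra_simps)
    then have "dist z x0 < r" using x by (simp add: dist_norm)
    then have "\<phi> z \<le> real n" using r by (auto simp: A_def dist_commute)
    moreover have "\<phi> x \<le> (\<phi> y + \<phi> z) / 2"
      using convex_onD[OF conv, of "1/2" y z] by (simp add: z_def scaleR_diff_right)
    ultimately show "\<phi> x \<le> (\<phi> y + real n) / 2" by simp
  qed
qed

text \<open>A large subgradient would force a large increase of \<phi> in its own direction, against
  the upper bound near \<open>v\<close> and the global lower bound. The bound is uniform over base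
  points near \<open>v\<close>, as the later compactness argument requires.\<close>

lemma subgradients_locally_bounded:
  fixes \<phi> :: "'a::{real_inner, banach} \<Rightarrow> real"
  assumes lsc: "lower_semicontinuous \<phi>" and conv: "convex_on UNIV \<phi>" and bdd: "bdd_below (range \<phi>)"
  obtains r M where "0 < r"
    "\<And>x \<xi>. dist x v < r \<Longrightarrow> (\<And>w. \<phi> x + \<xi> \<bullet> (w - x) \<le> \<phi> w) \<Longrightarrow> norm \<xi> \<le> M"
proof -
  obtain r M where r: "0 < r" and M: "\<And>x. dist x v < r \<Longrightarrow> \<phi> x \<le> M"
    using convex_lsc_locally_bounded_above[OF lsc conv] by blast
  obtain B where B: "\<And>x. B \<le> \<phi> x" using bdd by (auto simp: bdd_below_def)
  show ?thesis
  proof (rule that[of "r / 2" "4 * (M - B) / r"])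
    fix x \<xi> assume x: "dist x v < r / 2" and s: "\<And>w. \<phi> x + \<xi> \<bullet> (w - x) \<le> \<phi> w"
    show "norm \<xi> \<le> 4 * (M - B) / r"
    proof (cases "\<xi> = 0")
      case True
      have "B \<le> M" using B[of v] M[of v] r by simp
      then show ?thesis using True r by simp
    next
      case False
      \<comment> \<open>From distance \<open>r / 2\<close> a step of length \<open>r / 4\<close>
        stays inside the ball of radius \<open>r\<close>.\<close>
      define w where "w = x + (r / 4) *\<^sub>R (\<xi> /\<^sub>R norm \<xi>)"
      have "dist w x = r / 4" using False r by (simp add: w_def dist_norm)
      then have "dist w v < r" using x r dist_triangle[of w v x] by simp
      then have "\<phi> w \<le> M" by (rule M)
      moreover have "\<xi> \<bullet> (w - x) = r / 4 * norm \<xi>"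
        using False by (simp add: w_def power2_norm_eq_inner[symmetric] power2_eq_square)
      ultimately have "r / 4 * norm \<xi> \<le> M - B" using s[of w] B[of x] by linarith
      then show ?thesis using r by (simp add: field_simps)
    qed
  qed (use r in simp)
qed

text \<open>Strong convergence of the base points pairs with weak convergence of the bounded
  subgradients: the inner product is split at \<open>v\<close>, the norm bound kills one part, and
  the other converges by testing with the fixed vector \<open>w - v\<close>.\<close>

lemma subgradient_weak_limit:
  fixes \<phi> :: "'a::{real_inner, banach} \<Rightarrow> real"
  assumes lsc: "lower_semicontinuous \<phi>"
    and vs: "vs \<longlonglongrightarrow> v" and s: "\<And>n w. \<phi> (vs n) + \<xi>s n \<bullet> (w - vs n) \<le> \<phi> w"
    and M: "\<And>n. norm (\<xi>s n) \<le> M" and weak: "weakly_tendsto \<xi>s \<xi>"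
  shows "\<phi> v + \<xi> \<bullet> (w - v) \<le> \<phi> w"
proof -
  have "(\<lambda>n. \<xi>s n \<bullet> (v - vs n)) \<longlonglongrightarrow> 0"
  proof (rule Lim_null_comparison)
    show "\<forall>\<^sub>F n in sequentially. norm (\<xi>s n \<bullet> (v - vs n)) \<le> M * norm (v - vs n)"
      using M by (intro always_eventually allI) (metis Cauchy_Schwarz_ineq2 mult_right_mono norm_ge_zero order_trans real_norm_def)
    have "(\<lambda>n. M * norm (v - vs n)) \<longlonglongrightarrow> M * norm (v - v)" by (intro tendsto_intros vs)
    then show "(\<lambda>n. M * norm (v - vs n)) \<longlonglongrightarrow> 0" by simp
  qed
  moreover have "(\<lambda>n. \<xi>s n \<bullet> (w - v)) \<longlonglongrightarrow> \<xi> \<bullet> (w - v)" using weak by (simp add: weakly_tendsto_def)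
  ultimately have "(\<lambda>n. \<phi> w - (\<xi>s n \<bullet> (v - vs n) + \<xi>s n \<bullet> (w - v))) \<longlonglongrightarrow> \<phi> w - (0 + \<xi> \<bullet> (w - v))"
    by (intro tendsto_diff tendsto_add tendsto_const)
  then have "\<phi> v \<le> \<phi> w - (0 + \<xi> \<bullet> (w - v))"
  proof (rule lower_semicontinuous_sequence_le[OF lsc vs])
    show "\<phi> (vs n) \<le> \<phi> w - (\<xi>s n \<bullet> (v - vs n) + \<xi>s n \<bullet> (w - v))" for n
      using s[of n w] by (simp add: inner_diff_right)
  qed
  then show ?thesis by simp
qed

subsection \<open>The fractional kernel\<close>

text \<open>The kernel \<open>g\<^sub>\<beta>\<close>, its primitive vanishing on the negative axis, and \<open>g\<^sub>\<beta> * f\<close> for \<open>f\<close> supported in \<open>[0,\<infinity>)\<close>.\<close>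

definition frac_kernel :: "real \<Rightarrow> real \<Rightarrow> real" where
  "frac_kernel \<beta> t = (if 0 < t then t powr (\<beta> - 1) / Gamma \<beta> else 0)"

definition frac_kernel_prim :: "real \<Rightarrow> real \<Rightarrow> real" where
  "frac_kernel_prim \<beta> t = (max 0 t) powr \<beta> / Gamma (1 + \<beta>)"

definition frac_conv :: "real \<Rightarrow> (real \<Rightarrow> 'a::{banach, second_countable_topology}) \<Rightarrow> real \<Rightarrow> 'a" where
  "frac_conv \<beta> f t = (LBINT s. frac_kernel \<beta> (t - s) *\<^sub>R f s)"

lemma frac_kernel_measurable [measurable]: "frac_kernel \<beta> \<in> borel_measurable borel"
  unfolding frac_kernel_def by measurable

lemma frac_kernel_nonneg [simp]: "0 < \<beta> \<Longrightarrow> 0 \<le> frac_kernel \<beta> t"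
  by (simp add: frac_kernel_def Gamma_real_pos less_imp_le)

lemma frac_kernel_nonpos_arg [simp]: "t \<le> 0 \<Longrightarrow> frac_kernel \<beta> t = 0"
  by (simp add: frac_kernel_def)

lemma frac_kernel_antimono: "0 < \<beta> \<Longrightarrow> \<beta> \<le> 1 \<Longrightarrow> 0 < s \<Longrightarrow> s \<le> t \<Longrightarrow> frac_kernel \<beta> t \<le> frac_kernel \<beta> s"
  by (auto simp: frac_kernel_def intro!: divide_right_mono powr_mono2' Gamma_real_nonneg)

lemma frac_kernel_prim_nonneg [simp]: "0 < \<beta> \<Longrightarrow> 0 \<le> frac_kernel_prim \<beta> t"
  by (simp add: frac_kernel_prim_def Gamma_real_pos less_imp_le)

lemma frac_kernel_prim_nonpos_arg [simp]: "t \<le> 0 \<Longrightarrow> 0 < \<beta> \<Longrightarrow> frac_kernel_prim \<beta> t = 0"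
  by (simp add: frac_kernel_prim_def)

lemma frac_kernel_prim_mono: "0 < \<beta> \<Longrightarrow> s \<le> t \<Longrightarrow> frac_kernel_prim \<beta> s \<le> frac_kernel_prim \<beta> t"
  by (auto simp: frac_kernel_prim_def intro!: divide_right_mono powr_mono2 Gamma_real_nonneg)

lemma frac_kernel_prim_continuous: "0 < \<beta> \<Longrightarrow> continuous_on UNIV (frac_kernel_prim \<beta>)"
  unfolding frac_kernel_prim_def
  by (auto intro!: continuous_intros continuous_on_powr' simp: Gamma_real_pos less_imp_neq[symmetric])

lemma has_integral_frac_kernel:
  assumes "0 < \<beta>"
  shows "has_bochner_integral lborel (\<lambda>x. indicator {..q} x * frac_kernel \<beta> x) (frac_kernel_prim \<beta> q)"
proof (cases "0 < q")
  case False
  then have "(\<lambda>x. indicator {..q} x * frac_kernel \<beta> x) = (\<lambda>x. 0)" by (auto simp: indicator_def)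
  then show ?thesis using False assms by (simp add: has_bochner_integral_zero)
next
  case True
  have eq: "(\<lambda>x. indicator {..q} x * frac_kernel \<beta> x) = (\<lambda>x. if x \<in> {0..q} then x powr (\<beta> - 1) / Gamma \<beta> else 0)"
    by (auto simp: frac_kernel_def indicator_def)
  have "\<beta> \<notin> \<int>\<^sub>\<le>\<^sub>0" using assms nonpos_Ints_nonpos[of \<beta>] by auto
  then have G: "Gamma (1 + \<beta>) = \<beta> * Gamma \<beta>" using Gamma_plus1[of \<beta>] by (simp add: add.commute)
  have "((\<lambda>x. x powr (\<beta> - 1) / Gamma \<beta>) has_integral q powr (\<beta> - 1 + 1) / (\<beta> - 1 + 1) / Gamma \<beta>) {0..q}"
    using assms True by (intro has_integral_divide has_integral_powr_from_0) auto
  then have "((\<lambda>x. indicator {..q} x * frac_kernel \<beta> x) has_integral frac_kernel_prim \<beta> q) UNIV"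
    unfolding eq has_integral_restrict_UNIV using assms True G
    by (simp add: frac_kernel_prim_def)
  then have "integral\<^sup>N lborel (\<lambda>x. indicator {..q} x * frac_kernel \<beta> x) = frac_kernel_prim \<beta> q"
    using assms by (intro nn_integral_has_integral_lborel) auto
  then show ?thesis
    using assms by (intro has_bochner_integral_nn_integral) auto
qed

lemma has_integral_frac_kernel_less:
  assumes "0 < \<beta>"
  shows "has_bochner_integral lborel (\<lambda>x. indicator {..<q} x * frac_kernel \<beta> x) (frac_kernel_prim \<beta> q)"
proof -
  have "AE x in lborel. indicator {..q} x * frac_kernel \<beta> x = indicator {..<q} x * frac_kernel \<beta> x"
    using AE_lborel_singleton[of q] by eventually_elim (auto simp: indicator_def)
  then show ?thesis
    using has_integral_frac_kernel[OF assms, of q]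
    by (subst (asm) has_bochner_integral_cong_AE) auto
qed

lemma has_integral_frac_kernel_reflect:
  assumes "0 < \<beta>"
  shows "has_bochner_integral lborel (\<lambda>s. indicator {c..} s * frac_kernel \<beta> (t - s)) (frac_kernel_prim \<beta> (t - c))"
    and "has_bochner_integral lborel (\<lambda>s. indicator {c<..} s * frac_kernel \<beta> (t - s)) (frac_kernel_prim \<beta> (t - c))"
proof -
  have "has_bochner_integral lborel (\<lambda>s. indicator {..t - c} (t + (-1) * s) * frac_kernel \<beta> (t + (-1) * s))
      (frac_kernel_prim \<beta> (t - c) /\<^sub>R \<bar>-1\<bar>)"
    using has_integral_frac_kernel[OF assms, of "t - c"]
    by (subst lborel_has_bochner_integral_real_affine_iff[of "-1" _ _ t, symmetric]) auto
  moreover have "(\<lambda>s. indicator {..t - c} (t + (-1) * s) * frac_kernel \<beta> (t + (-1) * s))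
     = (\<lambda>s. indicator {c..} s * frac_kernel \<beta> (t - s))"
    by (auto simp: indicator_def fun_eq_iff)
  ultimately show "has_bochner_integral lborel (\<lambda>s. indicator {c..} s * frac_kernel \<beta> (t - s)) (frac_kernel_prim \<beta> (t - c))"
    by simp
  have "has_bochner_integral lborel (\<lambda>s. indicator {..<t - c} (t + (-1) * s) * frac_kernel \<beta> (t + (-1) * s))
      (frac_kernel_prim \<beta> (t - c) /\<^sub>R \<bar>-1\<bar>)"
    using has_integral_frac_kernel_less[OF assms, of "t - c"]
    by (subst lborel_has_bochner_integral_real_affine_iff[of "-1" _ _ t, symmetric]) auto
  moreover have "(\<lambda>s. indicator {..<t - c} (t + (-1) * s) * frac_kernel \<beta> (t + (-1) * s))
     = (\<lambda>s. indicator {c<..} s * frac_kernel \<beta> (t - s))"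
    by (auto simp: indicator_def fun_eq_iff)
  ultimately show "has_bochner_integral lborel (\<lambda>s. indicator {c<..} s * frac_kernel \<beta> (t - s)) (frac_kernel_prim \<beta> (t - c))"
    by simp
qed

lemma has_integral_frac_kernel_interval:
  assumes "0 < \<beta>" "c \<le> d"
  shows "has_bochner_integral lborel (\<lambda>s. indicator {c<..d} s * frac_kernel \<beta> (t - s))
    (frac_kernel_prim \<beta> (t - c) - frac_kernel_prim \<beta> (t - d))"
proof -
  have "(\<lambda>s. indicator {c<..d} s * frac_kernel \<beta> (t - s)) =
    (\<lambda>s. indicator {c<..} s * frac_kernel \<beta> (t - s) - indicator {d<..} s * frac_kernel \<beta> (t - s))"
    using assms(2) by (auto simp: indicator_def fun_eq_iff)
  then show ?thesis
    using has_integral_frac_kernel_reflect(2)[OF assms(1), of c t] has_integral_frac_kernel_reflect(2)[OF assms(1), of d t]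
    by (auto intro!: has_bochner_integral_diff)
qed

lemma frac_conv_integrable:
  fixes f :: "real \<Rightarrow> 'a::{banach, second_countable_topology}"
  assumes \<beta>: "0 < \<beta>" and f [measurable]: "f \<in> borel_measurable lborel"
    and M: "\<And>s. norm (f s) \<le> M" and neg: "\<And>s. s < 0 \<Longrightarrow> f s = 0"
  shows "integrable lborel (\<lambda>s. frac_kernel \<beta> (t - s) *\<^sub>R f s)"
    and "norm (frac_conv \<beta> f t) \<le> M * frac_kernel_prim \<beta> t"
proof -
  have B: "has_bochner_integral lborel (\<lambda>s. M * (indicator {0..} s * frac_kernel \<beta> (t - s))) (M * frac_kernel_prim \<beta> t)"
    using has_integral_frac_kernel_reflect(1)[OF \<beta>, of 0 t] by (intro has_bochner_integral_mult_right) simp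
  have le: "norm (frac_kernel \<beta> (t - s) *\<^sub>R f s) \<le> M * (indicator {0..} s * frac_kernel \<beta> (t - s))" for s
    using M[of s] neg[of s] \<beta> by (auto simp: indicator_def mult.commute intro: mult_right_mono)
  show int: "integrable lborel (\<lambda>s. frac_kernel \<beta> (t - s) *\<^sub>R f s)"
  proof (rule Bochner_Integration.integrable_bound)
    show "integrable lborel (\<lambda>s. M * (indicator {0..} s * frac_kernel \<beta> (t - s)))"
      using B by (simp add: has_bochner_integral_iff)
    show "AE s in lborel. norm (frac_kernel \<beta> (t - s) *\<^sub>R f s) \<le> norm (M * (indicator {0..} s * frac_kernel \<beta> (t - s)))"
      using le by (intro AE_I2) (metis order_trans abs_ge_self real_norm_def)
  qed measurable
  have "norm (frac_conv \<beta> f t) \<le> (LBINT s. norm (frac_kernel \<beta> (t - s) *\<^sub>R f s))"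
    unfolding frac_conv_def by (rule integral_norm_bound)
  also have "\<dots> \<le> (LBINT s. M * (indicator {0..} s * frac_kernel \<beta> (t - s)))"
    using B le integrable_norm[OF int] by (intro integral_mono) (simp_all only: has_bochner_integral_iff)
  also have "\<dots> = M * frac_kernel_prim \<beta> t" using B by (simp add: has_bochner_integral_iff)
  finally show "norm (frac_conv \<beta> f t) \<le> M * frac_kernel_prim \<beta> t" .
qed

text \<open>The kernel decreases, so the sign of the difference is known on each side of
  \<open>t\<close> and the absolute value integrates exactly. The result is at most
  \<open>2 * frac_kernel_prim \<beta> (t' - t)\<close>, the source of all Hoelder exponents
  below.\<close>

lemma has_integral_frac_kernel_shift:
  assumes \<beta>: "0 < \<beta>" "\<beta> \<le> 1" and t: "0 \<le> t" "t \<le> t'"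
  shows "has_bochner_integral lborel (\<lambda>s. indicator {0..} s * \<bar>frac_kernel \<beta> (t' - s) - frac_kernel \<beta> (t - s)\<bar>)
    (frac_kernel_prim \<beta> t - frac_kernel_prim \<beta> t' + 2 * frac_kernel_prim \<beta> (t' - t))"
proof -
  have "(\<lambda>s. indicator {0..} s * \<bar>frac_kernel \<beta> (t' - s) - frac_kernel \<beta> (t - s)\<bar>) =
    (\<lambda>s. indicator {0..} s * frac_kernel \<beta> (t - s) - indicator {0..} s * frac_kernel \<beta> (t' - s)
      + 2 * (indicator {t..} s * frac_kernel \<beta> (t' - s)))"
  proof
    fix s
    consider "s < 0" | "0 \<le> s" "s < t" | "0 \<le> s" "t \<le> s" by linarith
    then show "indicator {0..} s * \<bar>frac_kernel \<beta> (t' - s) - frac_kernel \<beta> (t - s)\<bar> =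
      indicator {0..} s * frac_kernel \<beta> (t - s) - indicator {0..} s * frac_kernel \<beta> (t' - s)
      + 2 * (indicator {t..} s * frac_kernel \<beta> (t' - s))"
    proof cases
      case 2
      then have "frac_kernel \<beta> (t' - s) \<le> frac_kernel \<beta> (t - s)"
        using \<beta> t by (intro frac_kernel_antimono) auto
      then show ?thesis using 2 by (simp add: indicator_def)
    qed (use t \<beta> in \<open>auto simp: indicator_def\<close>)
  qed
  moreover have "has_bochner_integral lborel (\<lambda>s. indicator {0..} s * frac_kernel \<beta> (t - s) - indicator {0..} s * frac_kernel \<beta> (t' - s)
      + 2 * (indicator {t..} s * frac_kernel \<beta> (t' - s)))
    (frac_kernel_prim \<beta> (t - 0) - frac_kernel_prim \<beta> (t' - 0) + 2 * frac_kernel_prim \<beta> (t' - t))"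
    by (intro has_bochner_integral_add has_bochner_integral_diff has_bochner_integral_mult_right
        has_integral_frac_kernel_reflect(1) \<beta>)
  ultimately show ?thesis by simp
qed

lemma frac_conv_diff_bound:
  fixes f :: "real \<Rightarrow> 'a::{banach, second_countable_topology}"
  assumes \<beta>: "0 < \<beta>" "\<beta> \<le> 1" and f [measurable]: "f \<in> borel_measurable lborel"
    and M: "\<And>s. norm (f s) \<le> M" and neg: "\<And>s. s < 0 \<Longrightarrow> f s = 0" and t: "0 \<le> t" "t \<le> t'"
  shows "integrable lborel (\<lambda>s. \<bar>frac_kernel \<beta> (t' - s) - frac_kernel \<beta> (t - s)\<bar> * norm (f s))"
    and "norm (frac_conv \<beta> f t' - frac_conv \<beta> f t)
      \<le> (LBINT s. \<bar>frac_kernel \<beta> (t' - s) - frac_kernel \<beta> (t - s)\<bar> * norm (f s))"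
proof -
  let ?D = "\<lambda>s. frac_kernel \<beta> (t' - s) - frac_kernel \<beta> (t - s)"
  note int = frac_conv_integrable(1)[OF \<beta>(1) f M neg]
  have i: "integrable lborel (\<lambda>s. ?D s *\<^sub>R f s)"
    using Bochner_Integration.integrable_diff[OF int[of t'] int[of t]] by (simp add: scaleR_diff_left)
  from integrable_norm[OF this] show "integrable lborel (\<lambda>s. \<bar>?D s\<bar> * norm (f s))" by simp
  have "frac_conv \<beta> f t' - frac_conv \<beta> f t = (LBINT s. ?D s *\<^sub>R f s)"
    unfolding frac_conv_def by (subst Bochner_Integration.integral_diff[symmetric]) (auto intro!: int simp: scaleR_diff_left)
  also have "norm \<dots> \<le> (LBINT s. norm (?D s *\<^sub>R f s))" by (rule integral_norm_bound)
  finally show "norm (frac_conv \<beta> f t' - frac_conv \<beta> f t) \<le> (LBINT s. \<bar>?D s\<bar> * norm (f s))" by simp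
qed

lemma frac_conv_hoelder_bounded:
  fixes f :: "real \<Rightarrow> 'a::{banach, second_countable_topology}"
  assumes \<beta>: "0 < \<beta>" "\<beta> \<le> 1" and f [measurable]: "f \<in> borel_measurable lborel"
    and M: "\<And>s. norm (f s) \<le> M" and neg: "\<And>s. s < 0 \<Longrightarrow> f s = 0" and t: "0 \<le> t" "t \<le> t'"
  shows "norm (frac_conv \<beta> f t' - frac_conv \<beta> f t) \<le> 2 * M * frac_kernel_prim \<beta> (t' - t)"
proof -
  let ?D = "\<lambda>s. \<bar>frac_kernel \<beta> (t' - s) - frac_kernel \<beta> (t - s)\<bar>"
  note S = has_integral_frac_kernel_shift[OF \<beta> t]
  have M0: "0 \<le> M" using M[of 0] norm_ge_zero order_trans by blast
  have "norm (frac_conv \<beta> f t' - frac_conv \<beta> f t) \<le> (LBINT s. ?D s * norm (f s))"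
    by (rule frac_conv_diff_bound(2)[OF \<beta> f M neg t])
  also have "\<dots> \<le> (LBINT s. M * (indicator {0..} s * ?D s))"
  proof (rule integral_mono)
    show "integrable lborel (\<lambda>s. ?D s * norm (f s))" by (rule frac_conv_diff_bound(1)[OF \<beta> f M neg t])
    show "integrable lborel (\<lambda>s. M * (indicator {0..} s * ?D s))"
      using S by (auto simp: has_bochner_integral_iff)
    show "?D s * norm (f s) \<le> M * (indicator {0..} s * ?D s)" for s
      using M[of s] neg[of s] by (auto simp: indicator_def mult.commute intro: mult_right_mono)
  qed
  also have "\<dots> = M * (frac_kernel_prim \<beta> t - frac_kernel_prim \<beta> t' + 2 * frac_kernel_prim \<beta> (t' - t))"
    using S by (auto simp: has_bochner_integral_iff)
  also have "\<dots> \<le> M * (2 * frac_kernel_prim \<beta> (t' - t))"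
    using frac_kernel_prim_mono[OF \<beta>(1) t(2)] M0 by (intro mult_left_mono) auto
  finally show ?thesis by simp
qed

text \<open>AM-GM with the weight \<open>(t' - t) powr (\<beta>/2)\<close> replaces the Cauchy--Schwarz inequality.\<close>

lemma frac_conv_hoelder_energy:
  fixes f :: "real \<Rightarrow> 'a::{banach, second_countable_topology}"
  assumes \<beta>: "0 < \<beta>" "\<beta> \<le> 1" and f [measurable]: "f \<in> borel_measurable lborel"
    and M: "\<And>s. norm (f s) \<le> M" and neg: "\<And>s. s < 0 \<Longrightarrow> f s = 0" and t: "0 \<le> t" "t \<le> t'"
    and E: "frac_conv \<beta> (\<lambda>s. (norm (f s))\<^sup>2) t \<le> E" "frac_conv \<beta> (\<lambda>s. (norm (f s))\<^sup>2) t' \<le> E"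
  shows "norm (frac_conv \<beta> f t' - frac_conv \<beta> f t) \<le> (1 / Gamma (1 + \<beta>) + E) * (t' - t) powr (\<beta> / 2)"
proof (cases "t = t'")
  case False
  define \<delta> where "\<delta> = t' - t"
  have \<delta>: "0 < \<delta>" using False t by (simp add: \<delta>_def)
  define l where "l = \<delta> powr (\<beta> / 2)"
  have l: "0 < l" using \<delta> by (simp add: l_def)
  let ?D = "\<lambda>s. \<bar>frac_kernel \<beta> (t' - s) - frac_kernel \<beta> (t - s)\<bar>"
  let ?g = "\<lambda>t s. frac_kernel \<beta> (t - s) * (norm (f s))\<^sup>2"
  note S = has_integral_frac_kernel_shift[OF \<beta> t]
  have f2: "norm ((norm (f s))\<^sup>2) \<le> M\<^sup>2" for s using M[of s] by (simp add: power_mono)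
  have gi: "integrable lborel (?g t)" for t
    using frac_conv_integrable(1)[where f = "\<lambda>s. (norm (f s))\<^sup>2" and M = "M\<^sup>2", OF \<beta>(1) _ f2] neg by simp
  have "norm (frac_conv \<beta> f t' - frac_conv \<beta> f t) \<le> (LBINT s. ?D s * norm (f s))"
    by (rule frac_conv_diff_bound(2)[OF \<beta> f M neg t])
  also have "\<dots> \<le> (LBINT s. (1 / (2 * l)) * (indicator {0..} s * ?D s) + (l / 2) * (?g t' s + ?g t s))"
  proof (rule integral_mono)
    show "integrable lborel (\<lambda>s. ?D s * norm (f s))" by (rule frac_conv_diff_bound(1)[OF \<beta> f M neg t])
    show "integrable lborel (\<lambda>s. (1 / (2 * l)) * (indicator {0..} s * ?D s) + (l / 2) * (?g t' s + ?g t s))"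
      using S gi by (auto simp: has_bochner_integral_iff)
    show "?D s * norm (f s) \<le> (1 / (2 * l)) * (indicator {0..} s * ?D s) + (l / 2) * (?g t' s + ?g t s)" for s
    proof (cases "s < 0")
      case True
      then show ?thesis using neg l by simp
    next
      case False
      have "0 \<le> (1 / (2 * l)) * (1 - l * norm (f s))\<^sup>2" using l by simp
      then have "norm (f s) \<le> 1 / (2 * l) + (l / 2) * (norm (f s))\<^sup>2"
        using l by (simp add: field_simps power2_eq_square)
      then have "?D s * norm (f s) \<le> ?D s * (1 / (2 * l) + (l / 2) * (norm (f s))\<^sup>2)"
        by (intro mult_left_mono) auto
      also have "\<dots> = (1 / (2 * l)) * ?D s + (l / 2) * (norm (f s))\<^sup>2 * ?D s" by (simp add: algebra_simps)
      \<comment> \<open>In the quadratic term the kernel difference is bounded by the sum of both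
        kernels, which explains why the energy bound is assumed at both times.\<close>
      also have "\<dots> \<le> (1 / (2 * l)) * ?D s + (l / 2) * (norm (f s))\<^sup>2 * (frac_kernel \<beta> (t' - s) + frac_kernel \<beta> (t - s))"
        using l \<beta> by (intro add_left_mono mult_left_mono) (auto simp: abs_if add_increasing)
      finally show ?thesis using False by (simp add: algebra_simps add_divide_distrib)
    qed
  qed
  also have "\<dots> = (1 / (2 * l)) * (frac_kernel_prim \<beta> t - frac_kernel_prim \<beta> t' + 2 * frac_kernel_prim \<beta> (t' - t))
      + (l / 2) * (frac_conv \<beta> (\<lambda>s. (norm (f s))\<^sup>2) t' + frac_conv \<beta> (\<lambda>s. (norm (f s))\<^sup>2) t)"
    using S gi unfolding has_bochner_integral_iff by (simp add: frac_conv_def)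
  also have "\<dots> \<le> (1 / (2 * l)) * (2 * frac_kernel_prim \<beta> \<delta>) + (l / 2) * (E + E)"
    using frac_kernel_prim_mono[OF \<beta>(1) t(2)] l E t
    by (intro add_mono mult_left_mono) (auto simp: \<delta>_def)
  \<comment> \<open>With this weight both AM-GM terms become multiples of \<open>l\<close>, that is
    of the half power of the increment.\<close>
  also have "frac_kernel_prim \<beta> \<delta> = l * l / Gamma (1 + \<beta>)"
    using \<delta> by (simp add: frac_kernel_prim_def l_def powr_add[symmetric])
  also have "(1 / (2 * l)) * (2 * (l * l / Gamma (1 + \<beta>))) + (l / 2) * (E + E) = (1 / Gamma (1 + \<beta>) + E) * l"
    using l by (simp add: field_simps)
  finally show ?thesis by (simp add: l_def \<delta>_def)
qed simp

subsection \<open>Step functions and the chain inequality\<close>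

lemma frac_conv_cong:
  assumes "\<And>s. s < t \<Longrightarrow> f s = h s"
  shows "frac_conv \<beta> f t = frac_conv \<beta> h t"
  unfolding frac_conv_def by (intro Bochner_Integration.integral_cong refl) (metis assms diff_gt_0_iff_gt frac_kernel_nonpos_arg not_le scaleR_zero_left)

lemma frac_conv_tendsto:
  fixes f :: "real \<Rightarrow> 'a::{banach, second_countable_topology}"
  assumes \<beta>: "0 < \<beta>" and fn [measurable]: "\<And>n. fn n \<in> borel_measurable lborel"
    and f [measurable]: "f \<in> borel_measurable lborel"
    and M: "\<And>n s. norm (fn n s) \<le> M" and neg: "\<And>n s. s < 0 \<Longrightarrow> fn n s = 0"
    and lim: "\<And>s. s < t \<Longrightarrow> (\<lambda>n. fn n s) \<longlonglongrightarrow> f s"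
  shows "(\<lambda>n. frac_conv \<beta> (fn n) t) \<longlonglongrightarrow> frac_conv \<beta> f t"
  unfolding frac_conv_def
proof (rule integral_dominated_convergence[where w = "\<lambda>s. M * (indicator {0..} s * frac_kernel \<beta> (t - s))"])
  show "integrable lborel (\<lambda>s. M * (indicator {0..} s * frac_kernel \<beta> (t - s)))"
    using has_integral_frac_kernel_reflect(1)[OF \<beta>, of 0 t] by (auto simp: has_bochner_integral_iff)
  show "AE s in lborel. (\<lambda>n. frac_kernel \<beta> (t - s) *\<^sub>R fn n s) \<longlonglongrightarrow> frac_kernel \<beta> (t - s) *\<^sub>R f s"
  proof (rule AE_I2)
    fix s show "(\<lambda>n. frac_kernel \<beta> (t - s) *\<^sub>R fn n s) \<longlonglongrightarrow> frac_kernel \<beta> (t - s) *\<^sub>R f s"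
      by (cases "s < t") (auto intro!: tendsto_intros lim)
  qed
  show "AE s in lborel. norm (frac_kernel \<beta> (t - s) *\<^sub>R fn n s) \<le> M * (indicator {0..} s * frac_kernel \<beta> (t - s))" for n
    using M[of n] neg[of _ n] \<beta> by (auto simp: indicator_def mult.commute intro!: mult_right_mono AE_I2)
qed measurable

text \<open>The cells are left-open, \<open>((m-1) k, m k]\<close> carrying \<open>V m\<close>, so
  the value at a grid time is that of the implicit step ending there. The cutoff to
  \<open>(0, N k]\<close> keeps the function bounded and supported in positive times.\<close>

definition step_fun :: "real \<Rightarrow> nat \<Rightarrow> (nat \<Rightarrow> 'a) \<Rightarrow> real \<Rightarrow> 'a::zero" where
  "step_fun k N V s = (if 0 < s \<and> s \<le> real N * k then V (nat \<lceil>s / k\<rceil>) else 0)"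

lemma step_fun_measurable [measurable]:
  fixes V :: "nat \<Rightarrow> 'a::{banach, second_countable_topology}"
  shows "step_fun k N V \<in> borel_measurable lborel"
  unfolding step_fun_def by measurable

lemma grid_index_iff:
  assumes "0 < k" "1 \<le> m"
  shows "(real m - 1) * k < s \<and> s \<le> real m * k \<longleftrightarrow> 0 < s \<and> nat \<lceil>s / k\<rceil> = m"
proof -
  have "(real m - 1) * k < s \<and> s \<le> real m * k \<longleftrightarrow> real m - 1 < s / k \<and> s / k \<le> real m"
    using assms by (simp add: field_simps)
  also have "\<dots> \<longleftrightarrow> \<lceil>s / k\<rceil> = int m" by (auto simp: ceiling_eq_iff)
  also have "\<dots> \<longleftrightarrow> 0 < s \<and> nat \<lceil>s / k\<rceil> = m"
    using assms by (auto simp: zero_less_divide_iff zero_less_ceiling)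
      (metis assms(2) ceiling_le_zero divide_pos_pos le_zero_eq nat_0_iff not_le not_one_le_zero of_nat_0_less_iff zero_less_ceiling zero_less_divide_iff order_less_asym less_le_trans zero_less_one of_nat_le_iff)+
  finally show ?thesis .
qed

lemma step_fun_neg: "s < 0 \<Longrightarrow> step_fun k N V s = 0"
  by (simp add: step_fun_def)

lemma step_fun_norm_le:
  fixes V :: "nat \<Rightarrow> 'a::real_normed_vector"
  assumes "0 < k" "\<And>m. 1 \<le> m \<Longrightarrow> m \<le> N \<Longrightarrow> norm (V m) \<le> M" "0 \<le> M"
  shows "norm (step_fun k N V s) \<le> M"
proof (cases "0 < s \<and> s \<le> real N * k")
  case True
  have "0 < s / k" "s / k \<le> real N" using True assms by (auto simp: field_simps)
  then have "1 \<le> nat \<lceil>s / k\<rceil>" "nat \<lceil>s / k\<rceil> \<le> N" by (auto simp: ceiling_le_iff nat_le_iff Suc_le_eq)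
  then show ?thesis using True assms by (simp add: step_fun_def)
qed (use assms in \<open>auto simp: step_fun_def\<close>)

lemma step_fun_bounded:
  fixes V :: "nat \<Rightarrow> 'a::real_normed_vector"
  assumes "0 < k"
  obtains M where "0 \<le> M" "\<And>s. norm (step_fun k N V s) \<le> M"
proof (rule that)
  show "0 \<le> (\<Sum>m\<le>N. norm (V m))" by (simp add: sum_nonneg)
  show "norm (step_fun k N V s) \<le> (\<Sum>m\<le>N. norm (V m))" for s
    by (rule step_fun_norm_le) (use assms in \<open>auto intro!: member_le_sum sum_nonneg\<close>)
qed

text \<open>Origin of the coefficients of the scheme:
  \<open>coeff_a \<alpha> j * k powr \<alpha>\<close> is the mass of the kernel on the cell lying
  \<open>j\<close> steps in the past.\<close>

lemma coeff_a_kernel: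
  assumes "0 < k" "j \<le> n"
  shows "frac_kernel_prim \<alpha> (real n * k - (real (n - j) - 1) * k) - frac_kernel_prim \<alpha> (real n * k - real (n - j) * k)
    = coeff_a \<alpha> j * k powr \<alpha>"
proof -
  have "real n * k - (real (n - j) - 1) * k = (real j + 1) * k" "real n * k - real (n - j) * k = real j * k"
    using assms by (simp_all add: of_nat_diff algebra_simps)
  moreover have "((real j + 1) * k) powr \<alpha> = (real j + 1) powr \<alpha> * k powr \<alpha>"
    "(real j * k) powr \<alpha> = real j powr \<alpha> * k powr \<alpha>"
    using assms by (simp_all add: powr_mult)
  moreover have "max 0 ((real j + 1) * k) = (real j + 1) * k" "max 0 (real j * k) = real j * k"
    using assms by (simp_all add: max_def)
  ultimately show ?thesis
    by (simp only: frac_kernel_prim_def coeff_a_def) (simp add: diff_divide_distrib left_diff_distrib)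
qed

text \<open>On the grid there is no quadrature error: cells match kernel masses, so the discrete
  convolution is the fractional integral of the step function. Discrete inequalities thereby become
  statements about \<open>frac_conv\<close>.\<close>

lemma frac_conv_step_fun:
  fixes V :: "nat \<Rightarrow> 'a::{banach, second_countable_topology}"
  assumes \<alpha>: "0 < \<alpha>" and k: "0 < k" and n: "n \<le> N" and V0: "V 0 = 0"
  shows "frac_conv \<alpha> (step_fun k N V) (real n * k) = (\<Sum>j=0..n. coeff_a \<alpha> j *\<^sub>R (k powr \<alpha> *\<^sub>R V (n - j)))"
proof -
  let ?I = "\<lambda>m. {(real m - 1) * k<..real m * k}"
  let ?g = "\<lambda>s. frac_kernel \<alpha> (real n * k - s)"
  have eq: "?g s *\<^sub>R step_fun k N V s = (\<Sum>m=1..n. (indicator (?I m) s * ?g s) *\<^sub>R V m)" for s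
  proof (cases "0 < s \<and> s < real n * k")
    case True
    define p where "p = nat \<lceil>s / k\<rceil>"
    have "0 < s / k" "s / k \<le> real n" using True k by (auto simp: field_simps)
    then have p: "1 \<le> p" "p \<le> n" by (auto simp: p_def ceiling_le_iff nat_le_iff Suc_le_eq)
    have "(\<Sum>m=1..n. (indicator (?I m) s * ?g s) *\<^sub>R V m) = (\<Sum>m=1..n. if m = p then ?g s *\<^sub>R V m else 0)"
    proof (rule sum.cong[OF refl])
      fix m assume "m \<in> {1..n}"
      then have "s \<in> ?I m \<longleftrightarrow> m = p" using grid_index_iff[OF k, of m s] True by (auto simp: p_def)
      then show "(indicator (?I m) s * ?g s) *\<^sub>R V m = (if m = p then ?g s *\<^sub>R V m else 0)"
        by (simp add: indicator_def)
    qed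
    also have "\<dots> = ?g s *\<^sub>R V p" using p by simp
    also have "real n * k \<le> real N * k" using n k by simp
    then have "V p = step_fun k N V s" using True by (simp add: step_fun_def p_def)
    finally show ?thesis by simp
  next
    case False
    have z: "indicator (?I m) s * ?g s = 0" if "m \<in> {1..n}" for m
    proof (cases "s \<le> 0")
      case True
      have "0 \<le> (real m - 1) * k" using that k by simp
      then show ?thesis using True by (auto simp: indicator_def)
    qed (use False in auto)
    have "(\<Sum>m=1..n. (indicator (?I m) s * ?g s) *\<^sub>R V m) = 0" using z by (intro sum.neutral) simp
    moreover have "?g s *\<^sub>R step_fun k N V s = 0" using False by (auto simp: step_fun_def)
    ultimately show ?thesis by simp
  qed
  have "has_bochner_integral lborel (\<lambda>s. \<Sum>m=1..n. (indicator (?I m) s * ?g s) *\<^sub>R V m)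
     (\<Sum>m=1..n. (frac_kernel_prim \<alpha> (real n * k - (real m - 1) * k) - frac_kernel_prim \<alpha> (real n * k - real m * k)) *\<^sub>R V m)"
    using \<alpha> k by (intro has_bochner_integral_sum has_bochner_integral_scaleR_left impI has_integral_frac_kernel_interval)
       (auto simp: algebra_simps)
  then have "frac_conv \<alpha> (step_fun k N V) (real n * k) =
     (\<Sum>m=1..n. (frac_kernel_prim \<alpha> (real n * k - (real m - 1) * k) - frac_kernel_prim \<alpha> (real n * k - real m * k)) *\<^sub>R V m)"
    unfolding frac_conv_def eq by (rule has_bochner_integral_integral_eq)
  \<comment> \<open>The added \<open>m = 0\<close> term belongs to the cell \<open>(-k, 0]\<close>
    and vanishes by \<open>V 0 = 0\<close>; it aligns the range with the discrete
    convolution.\<close>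
  also have "\<dots> = (\<Sum>m=0..n. (frac_kernel_prim \<alpha> (real n * k - (real m - 1) * k) - frac_kernel_prim \<alpha> (real n * k - real m * k)) *\<^sub>R V m)"
    using V0 by (simp add: sum.atLeast_Suc_atMost)
  also have "\<dots> = (\<Sum>j=0..n. (frac_kernel_prim \<alpha> (real n * k - (real (n - j) - 1) * k) - frac_kernel_prim \<alpha> (real n * k - real (n - j) * k)) *\<^sub>R V (n - j))"
    by (rule sum.reindex_bij_witness[of _ "\<lambda>j. n - j" "\<lambda>j. n - j"]) auto
  also have "\<dots> = (\<Sum>j=0..n. coeff_a \<alpha> j *\<^sub>R (k powr \<alpha> *\<^sub>R V (n - j)))"
    by (intro sum.cong refl) (simp only: coeff_a_kernel[OF k] atLeastAtMost_iff scaleR_scaleR)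
  finally show ?thesis .
qed

text \<open>Between grid points the singular kernel may exceed the grid values. The history up to
  the previous grid point \<open>?t1\<close> only loses weight as time grows, and the current cell
  adds at most \<open>frac_kernel_prim \<alpha> k * e n\<close>, which is a single summand of the
  grid value at \<open>n\<close>. Each part is at most \<open>E\<close>.\<close>

lemma frac_conv_step_fun_le_twice:
  fixes e :: "nat \<Rightarrow> real"
  assumes \<alpha>: "0 < \<alpha>" "\<alpha> < 1" and k: "0 < k" and e0: "e 0 = 0" and e: "\<And>m. 0 \<le> e m"
    and E: "\<And>n. n \<le> N \<Longrightarrow> frac_conv \<alpha> (step_fun k N e) (real n * k) \<le> E"
    and t: "0 \<le> t" "t \<le> real N * k"
  shows "frac_conv \<alpha> (step_fun k N e) t \<le> 2 * E"
proof (cases "t = 0")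
  case True
  then show ?thesis using E[of 0] frac_conv_step_fun[of \<alpha> k 0 N e] \<alpha> k e0 by simp
next
  case False
  define n where "n = nat \<lceil>t / k\<rceil>"
  have "0 < t / k" "t / k \<le> real N" using False t k by (auto simp: field_simps)
  then have n: "1 \<le> n" "n \<le> N" by (auto simp: n_def ceiling_le_iff nat_le_iff Suc_le_eq)
  have tn: "(real n - 1) * k < t" "t \<le> real n * k"
    using grid_index_iff[OF k n(1), of t] False t by (auto simp: n_def)
  let ?t1 = "real (n - 1) * k"
  have t1: "?t1 = (real n - 1) * k" using n by (simp add: of_nat_diff)
  obtain M where M: "\<And>s. norm (step_fun k N e s) \<le> M" using step_fun_bounded[OF k] by metis
  note int = frac_conv_integrable(1)[OF \<alpha>(1) step_fun_measurable M step_fun_neg]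
  note J = has_integral_frac_kernel_interval[OF \<alpha>(1), of "?t1" "real n * k" t]
  have kk: "?t1 \<le> real n * k" using k by (simp add: t1 algebra_simps)
  have "frac_conv \<alpha> (step_fun k N e) t
      \<le> (LBINT s. frac_kernel \<alpha> (?t1 - s) *\<^sub>R step_fun k N e s
          + (indicator {?t1<..real n * k} s * frac_kernel \<alpha> (t - s)) * e n)"
    unfolding frac_conv_def
  proof (rule integral_mono_AE)
    show "integrable lborel (\<lambda>s. frac_kernel \<alpha> (?t1 - s) *\<^sub>R step_fun k N e s
          + (indicator {?t1<..real n * k} s * frac_kernel \<alpha> (t - s)) * e n)"
      using J[OF kk] int[of ?t1] unfolding has_bochner_integral_iff
      by (intro Bochner_Integration.integrable_add integrable_mult_left) auto
    show "AE s in lborel. frac_kernel \<alpha> (t - s) *\<^sub>R step_fun k N e s \<le> frac_kernel \<alpha> (?t1 - s) *\<^sub>R step_fun k N e s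
          + (indicator {?t1<..real n * k} s * frac_kernel \<alpha> (t - s)) * e n"
      using AE_lborel_singleton[of ?t1]
    proof eventually_elim
      case (elim s)
      have s0: "0 \<le> step_fun k N e s" using e by (simp add: step_fun_def)
      consider "s < ?t1" | "?t1 < s" "s \<le> real n * k" | "real n * k < s" using elim by linarith
      then show ?case
      proof cases
        case 1
        have "?t1 < t" using tn t1 by linarith
        with 1 have "frac_kernel \<alpha> (t - s) \<le> frac_kernel \<alpha> (?t1 - s)"
          using \<alpha> by (intro frac_kernel_antimono) linarith+
        then show ?thesis using s0 1 by (auto simp: indicator_def mult_right_mono)
      next
        case 2
        have s: "0 < s \<and> nat \<lceil>s / k\<rceil> = n" using grid_index_iff[OF k n(1), of s] 2 unfolding t1 by blast
        have "real n * k \<le> real N * k" using n k by simp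
        then have "step_fun k N e s = e n" using 2 s by (simp add: step_fun_def)
        then show ?thesis using 2 by (simp add: indicator_def)
      next
        case 3
        then show ?thesis using s0 \<alpha> tn by (auto simp: indicator_def)
      qed
    qed
  qed (rule int)
  also have "\<dots> = frac_conv \<alpha> (step_fun k N e) ?t1 + (frac_kernel_prim \<alpha> (t - ?t1) - frac_kernel_prim \<alpha> (t - real n * k)) * e n"
    using J[OF kk] int[of ?t1] unfolding has_bochner_integral_iff frac_conv_def
    by (subst Bochner_Integration.integral_add) auto
  also have "\<dots> \<le> E + frac_kernel_prim \<alpha> k * e n"
  proof (intro add_mono mult_right_mono)
    show "frac_conv \<alpha> (step_fun k N e) ?t1 \<le> E" using n by (intro E) auto
    have "t - ?t1 \<le> k" unfolding t1 using tn by (simp add: algebra_simps)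
    then have "frac_kernel_prim \<alpha> (t - ?t1) \<le> frac_kernel_prim \<alpha> k"
      using \<alpha> by (intro frac_kernel_prim_mono)
    moreover have "0 \<le> frac_kernel_prim \<alpha> (t - real n * k)" using \<alpha> by simp
    ultimately show "frac_kernel_prim \<alpha> (t - ?t1) - frac_kernel_prim \<alpha> (t - real n * k) \<le> frac_kernel_prim \<alpha> k"
      by linarith
  qed (rule e)
  \<comment> \<open>This is the \<open>j = 0\<close> summand of the discrete convolution at
    \<open>n\<close>; the other summands are nonnegative.\<close>
  also have "frac_kernel_prim \<alpha> k * e n = coeff_a \<alpha> 0 * (k powr \<alpha> * e (n - 0))"
    using k by (simp add: frac_kernel_prim_def coeff_a_def)
  also have "\<dots> \<le> (\<Sum>j=0..n. coeff_a \<alpha> j * (k powr \<alpha> * e (n - j)))"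
    using coeff_a_pos[OF \<alpha>(1)] e
    by (intro member_le_sum[of 0 "{0..n}" "\<lambda>j. coeff_a \<alpha> j * (k powr \<alpha> * e (n - j))"])
      (auto simp: less_imp_le)
  also have "\<dots> = frac_conv \<alpha> (step_fun k N e) (real n * k)"
    using frac_conv_step_fun[OF \<alpha>(1) k n(2), of e] e0 by simp
  also have "\<dots> \<le> E" using n by (intro E)
  finally show ?thesis by simp
qed

section \<open>Smoothed norms and the chain inequality for continuous data\<close>

lemma smoothed_norm_subgradient:
  fixes w z :: "'a::real_inner"
  assumes "0 < \<rho>"
  shows "sqrt (\<rho>\<^sup>2 + (norm w)\<^sup>2) + (w /\<^sub>R sqrt (\<rho>\<^sup>2 + (norm w)\<^sup>2)) \<bullet> (z - w) \<le> sqrt (\<rho>\<^sup>2 + (norm z)\<^sup>2)"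
proof -
  let ?S = "\<lambda>w. sqrt (\<rho>\<^sup>2 + (norm w)\<^sup>2)"
  have S: "0 < ?S w" "(?S w)\<^sup>2 = \<rho>\<^sup>2 + (norm w)\<^sup>2" "0 \<le> ?S w" for w :: 'a
    using assms by (auto intro!: add_pos_nonneg)
  \<comment> \<open>The smoothed norm of \<open>w\<close> is the norm of the pair
    \<open>(\<rho>, w)\<close>, and this is the Cauchy-Schwarz inequality for two such
    pairs.\<close>
  have "\<rho>\<^sup>2 + w \<bullet> z \<le> ?S w * ?S z"
  proof -
    have "w \<bullet> z \<le> norm w * norm z" by (rule norm_cauchy_schwarz)
    then have "\<rho>\<^sup>2 + w \<bullet> z \<le> \<rho>\<^sup>2 + norm w * norm z" by simp
    also have "\<dots> \<le> ?S w * ?S z"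
    proof (rule power2_le_imp_le)
      have "2 * (\<rho> * norm w) * (\<rho> * norm z) \<le> (\<rho> * norm w)\<^sup>2 + (\<rho> * norm z)\<^sup>2" by (rule sum_squares_bound)
      then show "(\<rho>\<^sup>2 + norm w * norm z)\<^sup>2 \<le> (?S w * ?S z)\<^sup>2"
        unfolding power_mult_distrib S by (simp add: algebra_simps power2_eq_square)
      show "0 \<le> ?S w * ?S z" using S by simp
    qed
    finally show ?thesis .
  qed
  then have "(?S w)\<^sup>2 + w \<bullet> (z - w) \<le> ?S w * ?S z"
    unfolding S by (simp add: inner_diff_right power2_norm_eq_inner)
  then have "((?S w)\<^sup>2 + w \<bullet> (z - w)) / ?S w \<le> ?S z"
    using S(1)[of w] by (simp only: pos_divide_le_eq mult.commute)
  also have "((?S w)\<^sup>2 + w \<bullet> (z - w)) / ?S w = ?S w + (w /\<^sub>R ?S w) \<bullet> (z - w)"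
  proof -
    have "(r\<^sup>2 + x) / r = r + inverse r * x" if "0 < r" for r x :: real
      using that by (simp add: field_simps power2_eq_square)
    from this[OF S(1)] show ?thesis by simp
  qed
  finally show ?thesis .
qed

lemma smoothed_norm_gradient_le:
  fixes w :: "'a::real_inner"
  assumes "0 < \<rho>"
  shows "norm (w /\<^sub>R sqrt (\<rho>\<^sup>2 + (norm w)\<^sup>2)) \<le> 1"
proof -
  have "0 < sqrt (\<rho>\<^sup>2 + (norm w)\<^sup>2)" using assms by (auto intro!: add_pos_nonneg)
  moreover have "norm w \<le> sqrt (\<rho>\<^sup>2 + (norm w)\<^sup>2)" by (rule real_le_rsqrt) simp
  ultimately show ?thesis by (simp add: divide_inverse[symmetric] mult.commute)
qed

lemma grid_ceiling_tendsto:
  fixes s t :: real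
  assumes "0 < t" "0 < s"
  shows "(\<lambda>i. real (nat \<lceil>s / (t / real (Suc i))\<rceil>) * (t / real (Suc i))) \<longlonglongrightarrow> s"
proof (rule tendsto_sandwich[of "\<lambda>_. s" _ _ "\<lambda>i. s + t / real (Suc i)"])
  have b: "s \<le> real (nat \<lceil>s / k\<rceil>) * k \<and> real (nat \<lceil>s / k\<rceil>) * k \<le> s + k" if "0 < k" for k
  proof -
    have "0 < s / k" using that \<open>0 < s\<close> by simp
    then have "real (nat \<lceil>s / k\<rceil>) = real_of_int \<lceil>s / k\<rceil>" by (simp add: less_imp_le)
    moreover have "s / k \<le> real_of_int \<lceil>s / k\<rceil>" "real_of_int \<lceil>s / k\<rceil> \<le> s / k + 1" by linarith+
    moreover have "s = s / k * k" using that by simp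
    ultimately show ?thesis using that
      by (metis (no_types, opaque_lifting) distrib_right less_imp_le mult_1 mult_right_mono)
  qed
  show "\<forall>\<^sub>F i in sequentially. s \<le> real (nat \<lceil>s / (t / real (Suc i))\<rceil>) * (t / real (Suc i))"
    "\<forall>\<^sub>F i in sequentially. real (nat \<lceil>s / (t / real (Suc i))\<rceil>) * (t / real (Suc i)) \<le> s + t / real (Suc i)"
    using b[of "t / real (Suc i)" for i] assms by (auto simp del: of_nat_Suc)
  have "(\<lambda>i. s + t * (1 / real (Suc i))) \<longlonglongrightarrow> s + t * 0"
    by (intro tendsto_intros LIMSEQ_Suc[OF lim_1_over_n])
  then show "(\<lambda>i. s + t / real (Suc i)) \<longlonglongrightarrow> s" by simp
qed simp

text \<open>For a fixed \<open>t\<close>, \<open>f\<close> is sampled at the right ends of the cells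
  of finer and finer grids. The discrete chain inequality holds exactly for the step functions, and
  dominated convergence passes to the limit. The cut at 0 is open so that the samples may start with
  0.\<close>

lemma frac_chain_inequality_continuous:
  fixes f :: "real \<Rightarrow> 'a::{real_inner, banach, second_countable_topology}"
  assumes \<alpha>: "0 < \<alpha>" "\<alpha> < 1" and \<rho>: "0 < \<rho>"
    and f: "continuous_on UNIV f" and M: "\<And>s. norm (f s) \<le> M" and t: "0 < t"
  defines "h \<equiv> \<lambda>s. indicator {0<..} s *\<^sub>R f s"
  defines "w \<equiv> frac_conv \<alpha> h"
  shows "sqrt (\<rho>\<^sup>2 + (norm (w t))\<^sup>2)
    \<le> \<rho> + frac_conv \<alpha> (\<lambda>s. (w s /\<^sub>R sqrt (\<rho>\<^sup>2 + (norm (w s))\<^sup>2)) \<bullet> h s) t"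
proof -
  let ?S = "\<lambda>w::'a. sqrt (\<rho>\<^sup>2 + (norm w)\<^sup>2)"
  let ?p = "\<lambda>w::'a. w /\<^sub>R ?S w"
  have [measurable]: "f \<in> borel_measurable borel" using f by (rule borel_measurable_continuous_onI)
  have [measurable]: "h \<in> borel_measurable lborel" unfolding h_def by measurable
  have [measurable]: "w \<in> borel_measurable lborel" unfolding w_def frac_conv_def by measurable
  have M0: "0 \<le> M" using M[of 0] norm_ge_zero order_trans by blast
  \<comment> \<open>The grid depends on \<open>t\<close>, so that \<open>t\<close> is its last point
    and the discrete inequality is evaluated at \<open>t\<close> itself.\<close>
  define k where "k i = t / real (Suc i)" for i
  have k: "0 < k i" "real (Suc i) * k i = t" for i using t by (simp_all add: k_def del: of_nat_Suc)
  have k0: "k \<longlonglongrightarrow> 0" unfolding k_def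
    using tendsto_mult[OF tendsto_const[of t] LIMSEQ_Suc[OF lim_1_over_n]] by simp
  define V where "V i m = (if m = 0 then 0 else f (real m * k i))" for i m
  define v where "v i = step_fun (k i) (Suc i) (V i)" for i
  have [measurable]: "v i \<in> borel_measurable lborel" for i unfolding v_def by measurable
  have vM: "norm (v i s) \<le> M" for i s
    unfolding v_def using k M M0 by (intro step_fun_norm_le) (auto simp: V_def)
  have vneg: "s < 0 \<Longrightarrow> v i s = 0" for i s by (simp add: v_def step_fun_neg)
  define W where "W i n = (\<Sum>j=0..n. coeff_a \<alpha> j *\<^sub>R (k i powr \<alpha> *\<^sub>R V i (n - j)))" for i n
  have W0: "W i 0 = 0" for i by (simp add: W_def V_def)
  have W: "W i n = frac_conv \<alpha> (v i) (real n * k i)" if "n \<le> Suc i" for i n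
    unfolding W_def v_def by (rule frac_conv_step_fun[symmetric]) (use \<alpha> k that in \<open>auto simp: V_def\<close>)
  \<comment> \<open>The gradient is taken at the grid value of \<open>W\<close>, so on a cell this
    is not the product of gradient and data at \<open>s\<close>; the discrepancy is removed by
    \<open>Wl\<close> below.\<close>
  define Q where "Q i m = ?p (W i m) \<bullet> V i m" for i m
  define q where "q i = step_fun (k i) (Suc i) (Q i)" for i
  have [measurable]: "q i \<in> borel_measurable lborel" for i unfolding q_def by measurable
  have QM: "norm (Q i m) \<le> M" for i m
  proof -
    have "norm (Q i m) \<le> norm (?p (W i m)) * norm (V i m)" unfolding Q_def real_norm_def by (rule Cauchy_Schwarz_ineq2)
    also have "\<dots> \<le> 1 * M" using smoothed_norm_gradient_le[OF \<rho>] M M0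
      by (intro mult_mono) (auto simp: V_def)
    finally show ?thesis by simp
  qed
  have discrete: "?S (frac_conv \<alpha> (v i) t) \<le> \<rho> + frac_conv \<alpha> (q i) t" for i
  proof -
    have "?S (W i (Suc i)) - ?S (W i 0) \<le> (\<Sum>j=0..Suc i. coeff_a \<alpha> j * (?p (W i (Suc i - j)) \<bullet> (k i powr \<alpha> *\<^sub>R V i (Suc i - j))))"
    proof (rule discrete_chain_inequality[OF \<alpha>, where \<psi> = ?S])
      show "W i n - W i 0 = (\<Sum>j=0..n. coeff_a \<alpha> j *\<^sub>R (k i powr \<alpha> *\<^sub>R V i (n - j)))" for n
        unfolding W0 by (simp add: W_def)
      show "?S (W i n) + ?p (W i n) \<bullet> (W i m - W i n) \<le> ?S (W i m)" for n m
        by (rule smoothed_norm_subgradient[OF \<rho>])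
    qed (simp add: V_def)
    also have "\<dots> = (\<Sum>j=0..Suc i. coeff_a \<alpha> j *\<^sub>R (k i powr \<alpha> *\<^sub>R Q i (Suc i - j)))"
      by (intro sum.cong refl) (simp add: Q_def)
    also have "\<dots> = frac_conv \<alpha> (q i) (real (Suc i) * k i)"
      unfolding q_def by (rule frac_conv_step_fun[symmetric]) (use \<alpha> k in \<open>auto simp: Q_def V_def\<close>)
    finally show ?thesis using W[of "Suc i" i] k \<rho> by (simp add: W0 del: of_nat_Suc)
  qed
  have inside: "real (nat \<lceil>s / k i\<rceil>) * k i \<le> t" "1 \<le> nat \<lceil>s / k i\<rceil>" "nat \<lceil>s / k i\<rceil> \<le> Suc i"
    "s \<le> real (nat \<lceil>s / k i\<rceil>) * k i" "real (nat \<lceil>s / k i\<rceil>) * k i - s \<le> k i"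
    if s: "0 < s" "s < t" for s i
  proof -
    have "0 < s / k i" "s / k i \<le> real (Suc i)" using s k(1)[of i] k(2)[of i] by (auto simp: field_simps)
    then show b: "1 \<le> nat \<lceil>s / k i\<rceil>" "nat \<lceil>s / k i\<rceil> \<le> Suc i"
      by (auto simp: ceiling_le_iff nat_le_iff Suc_le_eq)
    then have "real (nat \<lceil>s / k i\<rceil>) * k i \<le> real (Suc i) * k i" using k(1)[of i] of_nat_mono[OF b(2)]
      by (intro mult_right_mono) (auto simp del: of_nat_Suc)
    then show "real (nat \<lceil>s / k i\<rceil>) * k i \<le> t" unfolding k(2) .
    have "(real (nat \<lceil>s / k i\<rceil>) - 1) * k i < s \<and> s \<le> real (nat \<lceil>s / k i\<rceil>) * k i"
      using grid_index_iff[OF k(1)[of i] b(1), of s] s by simp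
    then show "s \<le> real (nat \<lceil>s / k i\<rceil>) * k i" "real (nat \<lceil>s / k i\<rceil>) * k i - s \<le> k i"
      by (auto simp: algebra_simps)
  qed
  have fl: "(\<lambda>i. f (real (nat \<lceil>s / k i\<rceil>) * k i)) \<longlonglongrightarrow> f s" if "0 < s" for s
    unfolding k_def by (rule continuous_on_tendsto_compose[OF f grid_ceiling_tendsto[OF t that]]) auto
  have v_eq: "v i s = f (real (nat \<lceil>s / k i\<rceil>) * k i)" if "0 < s" "s < t" for s i
  proof -
    have "nat \<lceil>s / k i\<rceil> \<noteq> 0" using inside(2)[OF that, of i] by linarith
    then show ?thesis using that unfolding v_def step_fun_def V_def k(2)
      by (simp only: less_imp_le simp_thms if_True if_False)
  qed
  have vl: "(\<lambda>i. v i s) \<longlonglongrightarrow> h s" if "s < t" for s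
  proof (cases "0 < s")
    case True
    then show ?thesis using fl[OF True] v_eq[OF True that] by (simp add: h_def)
  qed (simp add: h_def v_def step_fun_def)
  have wl: "(\<lambda>i. frac_conv \<alpha> (v i) r) \<longlonglongrightarrow> w r" if "r \<le> t" for r
    unfolding w_def using that
    by (intro frac_conv_tendsto[where M = M] \<alpha> vM vneg vl) auto
  \<comment> \<open>The fractional integrals of the step functions share one modulus of continuity,
    since the samples share the bound \<open>M\<close>; moving \<open>s\<close> to the end of its
    cell therefore costs an amount that tends to 0.\<close>
  have Wl: "(\<lambda>i. W i (nat \<lceil>s / k i\<rceil>)) \<longlonglongrightarrow> w s" if s: "0 < s" "s < t" for s
  proof -
    have "(\<lambda>i. W i (nat \<lceil>s / k i\<rceil>) - frac_conv \<alpha> (v i) s) \<longlonglongrightarrow> 0"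
    proof (rule Lim_null_comparison)
      show "\<forall>\<^sub>F i in sequentially. norm (W i (nat \<lceil>s / k i\<rceil>) - frac_conv \<alpha> (v i) s) \<le> 2 * M * frac_kernel_prim \<alpha> (k i)"
      proof (intro always_eventually allI)
        fix i
        have "norm (W i (nat \<lceil>s / k i\<rceil>) - frac_conv \<alpha> (v i) s) \<le> 2 * M * frac_kernel_prim \<alpha> (real (nat \<lceil>s / k i\<rceil>) * k i - s)"
          unfolding W[OF inside(3)[OF s]]
          by (rule frac_conv_hoelder_bounded) (use \<alpha> vM vneg s inside[OF s] in auto)
        also have "\<dots> \<le> 2 * M * frac_kernel_prim \<alpha> (k i)"
          using inside[OF s] \<alpha> M0 by (intro mult_left_mono frac_kernel_prim_mono) auto
        finally show "norm (W i (nat \<lceil>s / k i\<rceil>) - frac_conv \<alpha> (v i) s) \<le> 2 * M * frac_kernel_prim \<alpha> (k i)" .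
      qed
      have "(\<lambda>i. frac_kernel_prim \<alpha> (k i)) \<longlonglongrightarrow> frac_kernel_prim \<alpha> 0"
        by (rule continuous_on_tendsto_compose[OF frac_kernel_prim_continuous[OF \<alpha>(1)] k0]) auto
      from tendsto_mult_left[OF this, of "2 * M"]
      show "(\<lambda>i. 2 * M * frac_kernel_prim \<alpha> (k i)) \<longlonglongrightarrow> 0" using \<alpha> by simp
    qed
    from tendsto_add[OF this wl[of s]] s show ?thesis by simp
  qed
  have ql: "(\<lambda>i. q i s) \<longlonglongrightarrow> ?p (w s) \<bullet> h s" if s: "s < t" for s
  proof (cases "0 < s")
    case True
    have "q i s = ?p (W i (nat \<lceil>s / k i\<rceil>)) \<bullet> f (real (nat \<lceil>s / k i\<rceil>) * k i)" for i
    proof -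
      have "nat \<lceil>s / k i\<rceil> \<noteq> 0" using inside(2)[OF True s, of i] by linarith
      then show ?thesis using True s unfolding q_def step_fun_def Q_def V_def k(2)
        by (simp only: less_imp_le simp_thms if_True if_False)
    qed
    moreover have "(\<lambda>i. ?p (W i (nat \<lceil>s / k i\<rceil>)) \<bullet> f (real (nat \<lceil>s / k i\<rceil>) * k i)) \<longlonglongrightarrow> ?p (w s) \<bullet> f s"
      using \<rho> by (intro tendsto_intros fl Wl True s) (auto simp: add_pos_nonneg sum_power2_eq_zero_iff)
    ultimately show ?thesis using True by (simp add: h_def)
  qed (simp add: h_def q_def step_fun_def)
  have "(\<lambda>i. frac_conv \<alpha> (q i) t) \<longlonglongrightarrow> frac_conv \<alpha> (\<lambda>s. ?p (w s) \<bullet> h s) t"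
  proof (rule frac_conv_tendsto[where M = M])
    show "norm (q i s) \<le> M" for i s
      unfolding q_def using k QM M0 by (intro step_fun_norm_le) auto
    show "s < 0 \<Longrightarrow> q i s = 0" for i s by (simp add: q_def step_fun_neg)
  qed (use \<alpha> ql in auto)
  then have B: "(\<lambda>i. \<rho> + frac_conv \<alpha> (q i) t) \<longlonglongrightarrow> \<rho> + frac_conv \<alpha> (\<lambda>s. ?p (w s) \<bullet> h s) t"
    by (intro tendsto_intros)
  have A: "(\<lambda>i. ?S (frac_conv \<alpha> (v i) t)) \<longlonglongrightarrow> ?S (w t)"
    by (intro tendsto_intros wl) simp
  show ?thesis using discrete by (intro LIMSEQ_le[OF A B]) blast
qed

subsection \<open>Fractional integrals of integrable functions\<close>

text \<open>Young's inequality with exponents 1, in the form needed for exchanging integrals; for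
  the norms, translation invariance makes it an equality.\<close>

lemma convolution_L1:
  fixes f :: "real \<Rightarrow> 'a::{banach, second_countable_topology}" and \<kappa> :: "real \<Rightarrow> real"
  assumes k: "integrable lborel \<kappa>" and f: "integrable lborel f"
  shows "integrable (lborel \<Otimes>\<^sub>M lborel) (\<lambda>(t, s). \<kappa> (t - s) *\<^sub>R f s)" (is ?int)
    and "(LBINT t. LBINT s. norm (\<kappa> (t - s) *\<^sub>R f s)) = (LBINT x. norm (\<kappa> x)) * (LBINT s. norm (f s))"
proof -
  note [measurable] = borel_measurable_integrable[OF k] borel_measurable_integrable[OF f]
  have sub: "has_bochner_integral lborel (\<lambda>t. norm (\<kappa> (t - s) *\<^sub>R f s)) ((LBINT x. norm (\<kappa> x)) * norm (f s))" for s
  proof -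
    have "has_bochner_integral lborel (\<lambda>x. norm (\<kappa> x)) (LBINT x. norm (\<kappa> x))"
      using k by (simp add: has_bochner_integral_iff)
    then have "has_bochner_integral lborel (\<lambda>t. norm (\<kappa> (- s + 1 * t))) ((LBINT x. norm (\<kappa> x)) /\<^sub>R \<bar>1\<bar>)"
      by (subst lborel_has_bochner_integral_real_affine_iff[of 1 _ _ "- s", symmetric]) auto
    then have "has_bochner_integral lborel (\<lambda>t. norm (\<kappa> (t - s))) (LBINT x. norm (\<kappa> x))"
      by simp
    from has_bochner_integral_mult_left[OF this, of "norm (f s)"] show ?thesis by simp
  qed
  have swap: "integrable (lborel \<Otimes>\<^sub>M lborel) (\<lambda>(s, t). \<kappa> (t - s) *\<^sub>R f s)"
  proof (rule lborel_pair.Fubini_integrable)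
    show "(\<lambda>(s, t). \<kappa> (t - s) *\<^sub>R f s) \<in> borel_measurable (lborel \<Otimes>\<^sub>M lborel)" by measurable
    show "integrable lborel (\<lambda>s. LBINT t. norm (case (s, t) of (s, t) \<Rightarrow> \<kappa> (t - s) *\<^sub>R f s))"
      unfolding prod.case has_bochner_integral_integral_eq[OF sub] using f by simp
    show "AE s in lborel. integrable lborel (\<lambda>t. case (s, t) of (s, t) \<Rightarrow> \<kappa> (t - s) *\<^sub>R f s)"
    proof (rule AE_I2)
      fix s
      have "integrable lborel (\<lambda>t. norm (\<kappa> (t - s) *\<^sub>R f s))" using sub[of s] by (simp only: has_bochner_integral_iff)
      then show "integrable lborel (\<lambda>t. case (s, t) of (s, t) \<Rightarrow> \<kappa> (t - s) *\<^sub>R f s)"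
        by (subst integrable_norm_iff[symmetric]) auto
    qed
  qed
  then show int: ?int
    using lborel_pair.integrable_product_swap_iff[of "\<lambda>(s, t). \<kappa> (t - s) *\<^sub>R f s"] by (simp add: case_prod_unfold)
  have i': "integrable (lborel \<Otimes>\<^sub>M lborel) (\<lambda>(t, s). norm (\<kappa> (t - s) *\<^sub>R f s))"
    using integrable_norm[OF int] by (simp add: case_prod_unfold)
  have "(LBINT t. LBINT s. norm (\<kappa> (t - s) *\<^sub>R f s)) = (LBINT s. LBINT t. norm (\<kappa> (t - s) *\<^sub>R f s))"
    using lborel_pair.Fubini_integral[OF i'] by simp
  also have "\<dots> = (LBINT s. (LBINT x. norm (\<kappa> x)) * norm (f s))"
    unfolding has_bochner_integral_integral_eq[OF sub] ..
  finally show "(LBINT t. LBINT s. norm (\<kappa> (t - s) *\<^sub>R f s)) = (LBINT x. norm (\<kappa> x)) * (LBINT s. norm (f s))"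
    by simp
qed

lemma frac_conv_L1:
  fixes f :: "real \<Rightarrow> 'a::{banach, second_countable_topology}"
  assumes \<beta>: "0 < \<beta>" and f: "integrable lborel f" and supp: "\<forall>s. s \<notin> {0..b} \<longrightarrow> f s = 0"
  shows "integrable lborel (\<lambda>t. indicator {0..b} t *\<^sub>R frac_conv \<beta> f t)"
    and "(LBINT t. indicator {0..b} t * norm (frac_conv \<beta> f t)) \<le> frac_kernel_prim \<beta> b * (LBINT s. norm (f s))"
    and "AE t in lborel. t \<in> {0..b} \<longrightarrow> integrable lborel (\<lambda>s. frac_kernel \<beta> (t - s) *\<^sub>R f s)"
proof -
  note [measurable] = borel_measurable_integrable[OF f]
  \<comment> \<open>The kernel is not integrable at infinity. For \<open>t \<le> b\<close> and data
    supported in \<open>[0, b]\<close> only arguments up to \<open>b\<close> occur, so truncation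
    changes nothing there.\<close>
  define \<kappa> where "\<kappa> x = indicator {..b} x * frac_kernel \<beta> x" for x
  have k: "integrable lborel \<kappa>" "(LBINT x. norm (\<kappa> x)) = frac_kernel_prim \<beta> b"
    using has_integral_frac_kernel[OF \<beta>, of b] \<beta> unfolding \<kappa>_def has_bochner_integral_iff by simp_all
  note conv = convolution_L1[OF k(1) f]
  have eq: "\<kappa> (t - s) *\<^sub>R f s = frac_kernel \<beta> (t - s) *\<^sub>R f s" if "t \<in> {0..b}" for t s
    using supp that by (cases "s \<in> {0..b}") (auto simp: \<kappa>_def indicator_def)
  have c: "frac_conv \<beta> f t = (LBINT s. \<kappa> (t - s) *\<^sub>R f s)" if "t \<in> {0..b}" for t
    unfolding frac_conv_def eq[OF that] ..
  have "AE t in lborel. integrable lborel (\<lambda>s. \<kappa> (t - s) *\<^sub>R f s)"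
    using lborel_pair.AE_integrable_fst[OF conv(1)] .
  then show "AE t in lborel. t \<in> {0..b} \<longrightarrow> integrable lborel (\<lambda>s. frac_kernel \<beta> (t - s) *\<^sub>R f s)"
  proof eventually_elim
    case (elim t)
    show ?case
    proof
      assume t: "t \<in> {0..b}"
      show "integrable lborel (\<lambda>s. frac_kernel \<beta> (t - s) *\<^sub>R f s)" using elim unfolding eq[OF t] .
    qed
  qed
  have int: "integrable lborel (\<lambda>t. LBINT s. \<kappa> (t - s) *\<^sub>R f s)"
    using lborel_pair.integrable_fst[OF conv(1)] .
  then have "integrable lborel (\<lambda>t. indicator {0..b} t *\<^sub>R (LBINT s. \<kappa> (t - s) *\<^sub>R f s))"
    by (intro integrable_mult_indicator) auto
  moreover have e: "indicator {0..b} t *\<^sub>R (LBINT s. \<kappa> (t - s) *\<^sub>R f s) = indicator {0..b} t *\<^sub>R frac_conv \<beta> f t" for t :: real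
    using c by (auto simp: indicator_def)
  ultimately show i: "integrable lborel (\<lambda>t. indicator {0..b} t *\<^sub>R frac_conv \<beta> f t)" by simp
  have "integrable lborel (\<lambda>t. LBINT s. norm (\<kappa> (t - s) *\<^sub>R f s))"
    using lborel_pair.integrable_fst[of "\<lambda>t s. norm (\<kappa> (t - s) *\<^sub>R f s)"] integrable_norm[OF conv(1)]
    by (simp add: case_prod_unfold)
  then have "(LBINT t. indicator {0..b} t * norm (frac_conv \<beta> f t)) \<le> (LBINT t. LBINT s. norm (\<kappa> (t - s) *\<^sub>R f s))"
  proof (rule integral_mono[rotated])
    show "integrable lborel (\<lambda>t. indicator {0..b} t * norm (frac_conv \<beta> f t))"
      using integrable_norm[OF i] by simp
    show "indicator {0..b} t * norm (frac_conv \<beta> f t) \<le> (LBINT s. norm (\<kappa> (t - s) *\<^sub>R f s))" for t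
      using c[of t] integral_norm_bound[of lborel "\<lambda>s. \<kappa> (t - s) *\<^sub>R f s"]
      by (auto simp: indicator_def)
  qed
  then show "(LBINT t. indicator {0..b} t * norm (frac_conv \<beta> f t)) \<le> frac_kernel_prim \<beta> b * (LBINT s. norm (f s))"
    unfolding conv(2) k(2) .
qed

lemma frac_conv_diff_AE:
  fixes f h :: "real \<Rightarrow> 'a::{banach, second_countable_topology}"
  assumes \<beta>: "0 < \<beta>" and f: "integrable lborel f" and fs: "\<forall>s. s \<notin> {0..b} \<longrightarrow> f s = 0"
    and h: "integrable lborel h" and hs: "\<forall>s. s \<notin> {0..b} \<longrightarrow> h s = 0"
  shows "AE t in lborel. t \<in> {0..b} \<longrightarrow> frac_conv \<beta> (\<lambda>s. f s - h s) t = frac_conv \<beta> f t - frac_conv \<beta> h t"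
  using frac_conv_L1(3)[where b = b, OF \<beta> f fs] frac_conv_L1(3)[where b = b, OF \<beta> h hs]
proof eventually_elim
  case (elim t)
  show ?case unfolding frac_conv_def scaleR_diff_right
    by (intro impI Bochner_Integration.integral_diff) (use elim in blast)+
qed

text \<open>Fractional integration is bounded on L1 of \<open>[0, b]\<close>, and L1 convergence
  gives almost everywhere convergence along a subsequence.\<close>

lemma frac_conv_AE_subseq:
  fixes f :: "real \<Rightarrow> 'a::{banach, second_countable_topology}"
  assumes \<beta>: "0 < \<beta>" and f: "integrable lborel f" and fs: "\<forall>s. s \<notin> {0..b} \<longrightarrow> f s = 0"
    and h: "\<And>n. integrable lborel (h n)" and hs: "\<And>n. \<forall>s. s \<notin> {0..b} \<longrightarrow> h n s = 0"
    and lim: "(\<lambda>n. LBINT s. norm (h n s - f s)) \<longlonglongrightarrow> 0"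
  obtains r :: "nat \<Rightarrow> nat" where "strict_mono r"
    "AE t in lborel. t \<in> {0..b} \<longrightarrow> (\<lambda>n. frac_conv \<beta> (h (r n)) t) \<longlonglongrightarrow> frac_conv \<beta> f t"
proof -
  have d: "integrable lborel (\<lambda>s. h n s - f s)" for n using h f by auto
  have ds: "\<forall>s. s \<notin> {0..b} \<longrightarrow> h n s - f s = 0" for n using hs fs by simp
  let ?u = "\<lambda>n t. indicator {0..b} t *\<^sub>R frac_conv \<beta> (\<lambda>s. h n s - f s) t"
  have "(\<lambda>n. LBINT t. norm (?u n t)) \<longlonglongrightarrow> 0"
  proof (rule tendsto_sandwich[of "\<lambda>_. 0" _ _ "\<lambda>n. frac_kernel_prim \<beta> b * (LBINT s. norm (h n s - f s))"])
    show "\<forall>\<^sub>F n in sequentially. (LBINT t. norm (?u n t)) \<le> frac_kernel_prim \<beta> b * (LBINT s. norm (h n s - f s))"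
      using frac_conv_L1(2)[OF \<beta> d ds] by (intro always_eventually allI) simp
    show "\<forall>\<^sub>F n in sequentially. 0 \<le> (LBINT t. norm (?u n t))"
      by (intro always_eventually allI Bochner_Integration.integral_nonneg norm_ge_zero)
    show "(\<lambda>n. frac_kernel_prim \<beta> b * (LBINT s. norm (h n s - f s))) \<longlonglongrightarrow> 0"
      using tendsto_mult_left[OF lim] by simp
  qed simp
  from tendsto_L1_AE_subseq[OF frac_conv_L1(1)[OF \<beta> d ds] this]
  obtain r :: "nat \<Rightarrow> nat" where r: "strict_mono r" "AE t in lborel. (\<lambda>n. ?u (r n) t) \<longlonglongrightarrow> 0" by blast
  have "AE t in lborel. \<forall>n. t \<in> {0..b} \<longrightarrow> frac_conv \<beta> (\<lambda>s. h n s - f s) t = frac_conv \<beta> (h n) t - frac_conv \<beta> f t"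
    unfolding AE_all_countable using frac_conv_diff_AE[OF \<beta> h hs f fs] by blast
  with r(2) have "AE t in lborel. t \<in> {0..b} \<longrightarrow> (\<lambda>n. frac_conv \<beta> (h (r n)) t) \<longlonglongrightarrow> frac_conv \<beta> f t"
  proof eventually_elim
    case (elim t)
    show ?case
    proof
      assume t: "t \<in> {0..b}"
      then have "(\<lambda>n. frac_conv \<beta> (h (r n)) t - frac_conv \<beta> f t) \<longlonglongrightarrow> 0" using elim by simp
      then show "(\<lambda>n. frac_conv \<beta> (h (r n)) t) \<longlonglongrightarrow> frac_conv \<beta> f t" using LIM_zero_iff by blast
    qed
  qed
  with r(1) that show ?thesis by blast
qed

text \<open>The essential case is an indicator, squeezed between a closed and an open set and
  replaced by a Urysohn function. Boundedness is carried along because the continuous chain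
  inequality asks for it.\<close>

lemma L1_approx_continuous:
  fixes f :: "real \<Rightarrow> 'a::{banach, second_countable_topology}"
  assumes "integrable lborel f" "0 < e"
  shows "\<exists>h. continuous_on UNIV h \<and> (\<exists>M. \<forall>x. norm (h x) \<le> M) \<and> integrable lborel h \<and>
    (LBINT x. norm (f x - h x)) < e"
  using assms
proof (induction arbitrary: e rule: integrable_induct)
  case (base A c)
  \<comment> \<open>The factor 2 accounts for the two gaps \<open>U - A\<close> and
    \<open>A - K\<close>; the \<open>+ 1\<close> covers \<open>c = 0\<close>.\<close>
  define d where "d = e / (2 * (norm c + 1))"
  have d: "0 < d" using base by (simp add: d_def add_nonneg_pos)
  have A: "A \<in> sets lebesgue" using base by simp
  obtain U where U: "open U" "A \<subseteq> U" "emeasure lebesgue (U - A) < ennreal d"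
    using sets_lebesgue_outer_open[OF A d] by metis
  obtain K where K: "closed K" "K \<subseteq> A" "emeasure lebesgue (A - K) < ennreal d"
    using sets_lebesgue_inner_closed[OF A d] by metis
  have [measurable]: "A \<in> sets borel" "U \<in> sets borel" "K \<in> sets borel" using base U K by auto
  have UA: "emeasure lborel (U - A) < ennreal d" and AK: "emeasure lborel (A - K) < ennreal d"
    using U(3) K(3) by simp_all
  have "emeasure lborel U \<le> emeasure lborel A + emeasure lborel (U - A)"
    using U(2) emeasure_subadditive[of A lborel "U - A"] by (simp add: Un_absorb1)
  also have "\<dots> < \<infinity>" using base(2) UA by (metis ennreal_add_less_top ennreal_less_top infinity_ennreal_def less_trans)
  finally have Ufin: "emeasure lborel U < \<infinity>" .
  obtain p :: "real \<Rightarrow> real" where p: "continuous_on UNIV p" "\<And>x. p x \<in> closed_segment 1 0"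
     "\<And>x. x \<in> K \<Longrightarrow> p x = 1" "\<And>x. x \<in> - U \<Longrightarrow> p x = 0"
    by (rule Urysohn[of K "- U" 1 0]) (use U K in auto)
  have p01: "0 \<le> p x" "p x \<le> 1" for x using p(2)[of x] by (auto simp: closed_segment_eq_real_ivl)
  have [measurable]: "p \<in> borel_measurable borel" using p(1) by (rule borel_measurable_continuous_onI)
  have pint: "integrable lborel p"
  proof (rule Bochner_Integration.integrable_bound)
    show "integrable lborel (indicator U :: real \<Rightarrow> real)" using Ufin by (intro integrable_real_indicator) auto
    show "AE x in lborel. norm (p x) \<le> norm (indicator U x :: real)"
      using p01 p(4) by (auto simp: indicator_def intro!: AE_I2)
  qed measurable
  have Di: "has_bochner_integral lborel (indicator (U - A) :: real \<Rightarrow> real) (measure lborel (U - A))"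
    "has_bochner_integral lborel (indicator (A - K) :: real \<Rightarrow> real) (measure lborel (A - K))"
    using UA AK by (auto intro!: has_bochner_integral_real_indicator less_trans[OF _ ennreal_less_top])
  have m: "measure lborel (U - A) < d" "measure lborel (A - K) < d"
    using UA AK d by (auto simp: measure_def intro!: enn2real_less_iff[THEN iffD2] less_trans[OF _ ennreal_less_top])
  have le: "norm (indicator A x *\<^sub>R c - p x *\<^sub>R c) \<le> (indicator (U - A) x + indicator (A - K) x) * norm c" for x
  proof -
    have "\<bar>indicator A x - p x\<bar> \<le> indicator (U - A) x + (indicator (A - K) x :: real)"
      using p01[of x] p(3,4)[of x] U(2) K(2) by (auto simp: indicator_def)
    from mult_right_mono[OF this norm_ge_zero[of c]] show ?thesis
      by (simp add: scaleR_diff_left[symmetric])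
  qed
  have pc: "integrable lborel (\<lambda>x. p x *\<^sub>R c)" using pint by simp
  have Ac: "integrable lborel (\<lambda>x. indicator A x *\<^sub>R c)" using base by simp
  have "(LBINT x. norm (indicator A x *\<^sub>R c - p x *\<^sub>R c)) \<le> (LBINT x. (indicator (U - A) x + indicator (A - K) x) * norm c)"
    using le pc Ac Di by (intro integral_mono integrable_norm Bochner_Integration.integrable_diff integrable_mult_left Bochner_Integration.integrable_add) (auto simp: has_bochner_integral_iff)
  also have "\<dots> = (measure lborel (U - A) + measure lborel (A - K)) * norm c"
    by (intro has_bochner_integral_integral_eq has_bochner_integral_mult_left has_bochner_integral_add Di)
  also have "\<dots> \<le> 2 * d * norm c" using m by (intro mult_right_mono) auto
  also have "\<dots> < e"
  proof -
    have c: "0 < norm c + 1" by (simp add: add_nonneg_pos)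
    have "2 * d * norm c < 2 * d * (norm c + 1)" using d by simp
    also have "\<dots> = e" using c by (simp add: d_def field_simps)
    finally show ?thesis .
  qed
  finally show ?case
    using p(1) pc p01 by (intro exI[of _ "\<lambda>x. p x *\<^sub>R c"] conjI exI[of _ "norm c"])
      (auto intro!: continuous_intros mult_left_le_one_le)
next
  case (add f g)
  obtain hf Mf where hf: "continuous_on UNIV hf" "\<And>x. norm (hf x) \<le> Mf" "integrable lborel hf"
    "(LBINT x. norm (f x - hf x)) < e / 2" using add.IH(1)[of "e / 2"] add.prems by auto
  obtain hg Mg where hg: "continuous_on UNIV hg" "\<And>x. norm (hg x) \<le> Mg" "integrable lborel hg"
    "(LBINT x. norm (g x - hg x)) < e / 2" using add.IH(2)[of "e / 2"] add.prems by auto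
  have "(LBINT x. norm (f x + g x - (hf x + hg x))) \<le> (LBINT x. norm (f x - hf x) + norm (g x - hg x))"
    using add hf hg by (intro integral_mono integrable_norm Bochner_Integration.integrable_add Bochner_Integration.integrable_diff)
      (auto simp: add_diff_add intro: norm_triangle_ineq)
  also have "\<dots> = (LBINT x. norm (f x - hf x)) + (LBINT x. norm (g x - hg x))"
    using add hf hg by (intro Bochner_Integration.integral_add integrable_norm Bochner_Integration.integrable_diff)
  also have "\<dots> < e" using hf(4) hg(4) by simp
  finally show ?case using hf hg
    by (intro exI[of _ "\<lambda>x. hf x + hg x"] conjI exI[of _ "Mf + Mg"])
      (auto intro!: continuous_intros norm_triangle_le add_mono)
next
  case (lim f s)
  have "(\<lambda>i. LBINT x. norm (f x - s i x)) \<longlonglongrightarrow> (LINT x|(lborel :: real measure). (0 :: real))"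
  proof (rule integral_dominated_convergence[where w = "\<lambda>x. 3 * norm (f x)" and f = "\<lambda>x. 0"
        and s = "\<lambda>i x. norm (f x - s i x)"])
    show "AE x in lborel. (\<lambda>i. norm (f x - s i x)) \<longlonglongrightarrow> 0"
    proof (rule AE_I2)
      fix x :: real
      have "(\<lambda>i. norm (f x - s i x)) \<longlonglongrightarrow> norm (f x - f x)" using lim.hyps by (intro tendsto_intros) auto
      then show "(\<lambda>i. norm (f x - s i x)) \<longlonglongrightarrow> 0" by simp
    qed
    show "AE x in lborel. norm (norm (f x - s i x)) \<le> 3 * norm (f x)" for i
    proof (rule AE_I2)
      fix x :: real
      have "norm (f x - s i x) \<le> norm (f x) + norm (s i x)" by (rule norm_triangle_ineq4)
      then show "norm (norm (f x - s i x)) \<le> 3 * norm (f x)" using lim.hyps(3)[of x i] by simp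
    qed
  qed (use lim.hyps in \<open>auto intro!: borel_measurable_integrable\<close>)
  then have "(\<lambda>i. LBINT x. norm (f x - s i x)) \<longlonglongrightarrow> 0" by simp
  then have "\<forall>\<^sub>F i in sequentially. (LBINT x. norm (f x - s i x)) < e / 2"
    using lim.prems by (intro order_tendstoD(2)) auto
  then obtain i where i: "(LBINT x. norm (f x - s i x)) < e / 2"
    using eventually_happens trivial_limit_sequentially by blast
  obtain h M where h: "continuous_on UNIV h" "\<And>x. norm (h x) \<le> M" "integrable lborel h"
    "(LBINT x. norm (s i x - h x)) < e / 2" using lim.IH[of "e / 2" i] lim.prems by auto
  have "(LBINT x. norm (f x - h x)) \<le> (LBINT x. norm (f x - s i x) + norm (s i x - h x))"
    using lim.hyps h by (intro integral_mono integrable_norm Bochner_Integration.integrable_add Bochner_Integration.integrable_diff)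
      (auto intro: norm_triangle_sub order_trans[OF _ norm_triangle_ineq])
  also have "\<dots> = (LBINT x. norm (f x - s i x)) + (LBINT x. norm (s i x - h x))"
    using lim.hyps h by (intro Bochner_Integration.integral_add integrable_norm Bochner_Integration.integrable_diff)
  also have "\<dots> < e" using i h(4) by simp
  finally show ?case using h by blast
qed

text \<open>Density argument. Two subsequences are extracted: one along which the fractional
  integrals of the approximations converge almost everywhere, so that the gradients converge, and
  then one along which the right-hand sides do.\<close>

lemma frac_chain_inequality_L1:
  fixes f :: "real \<Rightarrow> 'a::{real_inner, banach, second_countable_topology}"
  assumes \<alpha>: "0 < \<alpha>" "\<alpha> < 1" and \<rho>: "0 < \<rho>"
    and f: "integrable lborel f" and supp: "\<forall>s. s \<notin> {0..b} \<longrightarrow> f s = 0"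
  defines "w \<equiv> frac_conv \<alpha> f"
  shows "AE t in lborel. t \<in> {0..b} \<longrightarrow> sqrt (\<rho>\<^sup>2 + (norm (w t))\<^sup>2)
    \<le> \<rho> + frac_conv \<alpha> (\<lambda>s. (w s /\<^sub>R sqrt (\<rho>\<^sup>2 + (norm (w s))\<^sup>2)) \<bullet> f s) t"
proof -
  let ?S = "\<lambda>w::'a. sqrt (\<rho>\<^sup>2 + (norm w)\<^sup>2)"
  let ?p = "\<lambda>w::'a. w /\<^sub>R ?S w"
  have pcont: "(\<lambda>n. ?p (x n)) \<longlonglongrightarrow> ?p y" if "x \<longlonglongrightarrow> y" for x and y :: 'a
    using \<rho> by (intro tendsto_intros that) (auto simp: sum_power2_eq_zero_iff)
  have p1: "\<bar>?p x \<bullet> y\<bar> \<le> norm y" for x y :: 'a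
    using Cauchy_Schwarz_ineq2[of "?p x" y] smoothed_norm_gradient_le[OF \<rho>, of x]
    by (meson mult_left_le_one_le norm_ge_zero order_trans)
  note fm [measurable] = borel_measurable_integrable[OF f]
  have [measurable]: "w \<in> borel_measurable lborel" unfolding w_def frac_conv_def by measurable
  have "\<forall>n. \<exists>h. continuous_on UNIV h \<and> (\<exists>M. \<forall>x. norm (h x) \<le> M) \<and> integrable lborel h \<and>
      (LBINT x. norm (f x - h x)) < 1 / real (Suc n)"
    by (intro allI L1_approx_continuous f) simp
  then obtain h where hc: "\<And>n. continuous_on UNIV (h n)" and hM: "\<And>n. \<exists>M. \<forall>x. norm (h n x) \<le> M"
    and hi: "\<And>n. integrable lborel (h n)" and hl: "\<And>n. (LBINT x. norm (f x - h n x)) < 1 / real (Suc n)"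
    by metis
  have hm [measurable]: "h n \<in> borel_measurable lborel" for n using hi by auto
  \<comment> \<open>Up to time \<open>b\<close> this agrees with the positive-time cut of the
    continuous \<open>h n\<close>, and the fractional integral at \<open>t\<close> depends only on
    earlier times; hence the continuous case applies to it.\<close>
  define fn where "fn n s = indicator {0<..b} s *\<^sub>R h n s" for n s
  have fni: "integrable lborel (fn n)" for n unfolding fn_def using hi by (intro integrable_mult_indicator) auto
  have fns: "\<forall>s. s \<notin> {0..b} \<longrightarrow> fn n s = 0" for n by (simp add: fn_def)
  have fn_lim: "(\<lambda>n. LBINT s. norm (fn n s - f s)) \<longlonglongrightarrow> 0"
  proof (rule tendsto_sandwich[of "\<lambda>_. 0" _ _ "\<lambda>n. 1 / real (Suc n)"])
    show "\<forall>\<^sub>F n in sequentially. (LBINT s. norm (fn n s - f s)) \<le> 1 / real (Suc n)"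
    proof (intro always_eventually allI)
      fix n
      have "(LBINT s. norm (fn n s - f s)) \<le> (LBINT s. norm (f s - h n s))"
      proof (rule integral_mono_AE)
        show "integrable lborel (\<lambda>s. norm (fn n s - f s))" "integrable lborel (\<lambda>s. norm (f s - h n s))"
          using fni hi f by auto
        show "AE s in lborel. norm (fn n s - f s) \<le> norm (f s - h n s)"
          using AE_lborel_singleton[of 0]
        proof eventually_elim
          case (elim s)
          show ?case
          proof (cases "s \<in> {0..b}")
            case True
            then show ?thesis using elim by (simp add: fn_def norm_minus_commute)
          qed (use supp fns in auto)
        qed
      qed
      with hl[of n] show "(LBINT s. norm (fn n s - f s)) \<le> 1 / real (Suc n)" by linarith
    qed
    show "\<forall>\<^sub>F n in sequentially. 0 \<le> (LBINT s. norm (fn n s - f s))"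
      by (intro always_eventually allI Bochner_Integration.integral_nonneg norm_ge_zero)
    show "(\<lambda>n. 1 / real (Suc n)) \<longlonglongrightarrow> 0" by (rule LIMSEQ_Suc[OF lim_1_over_n])
  qed simp
  obtain r where r: "strict_mono r"
    "AE t in lborel. t \<in> {0..b} \<longrightarrow> (\<lambda>n. frac_conv \<alpha> (fn (r n)) t) \<longlonglongrightarrow> frac_conv \<alpha> f t"
    using frac_conv_AE_subseq[OF \<alpha>(1) f supp fni fns fn_lim] by blast
  define g where "g n = fn (r n)" for n
  have gi: "integrable lborel (g n)" and gs: "\<forall>s. s \<notin> {0..b} \<longrightarrow> g n s = 0" for n
    using fni fns by (auto simp: g_def)
  have gm [measurable]: "g n \<in> borel_measurable lborel" for n using gi by auto
  have g_lim: "(\<lambda>n. LBINT s. norm (g n s - f s)) \<longlonglongrightarrow> 0"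
    using LIMSEQ_subseq_LIMSEQ[OF fn_lim r(1)] by (simp add: g_def o_def)
  define wn where "wn n = frac_conv \<alpha> (g n)" for n
  have [measurable]: "wn n \<in> borel_measurable lborel" for n unfolding wn_def frac_conv_def by measurable
  have wn_lim: "AE t in lborel. t \<in> {0..b} \<longrightarrow> (\<lambda>n. wn n t) \<longlonglongrightarrow> w t"
    using r(2) by (simp add: wn_def g_def w_def)
  define q where "q s = ?p (w s) \<bullet> f s" for s
  define qn where "qn n s = ?p (wn n s) \<bullet> g n s" for n s
  have [measurable]: "q \<in> borel_measurable lborel" "qn n \<in> borel_measurable lborel" for n
    unfolding q_def qn_def by measurable
  have qi: "integrable lborel q"
    by (rule Bochner_Integration.integrable_bound[OF f]) (use p1 in \<open>auto simp: q_def\<close>)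
  have qni: "integrable lborel (qn n)" for n
    by (rule Bochner_Integration.integrable_bound[OF gi[of n]]) (use p1 in \<open>auto simp: qn_def\<close>)
  have qs: "\<forall>s. s \<notin> {0..b} \<longrightarrow> q s = 0" "\<forall>s. s \<notin> {0..b} \<longrightarrow> qn n s = 0" for n
    using supp gs by (auto simp: q_def qn_def)
  have q_lim: "(\<lambda>n. LBINT s. norm (qn n s - q s)) \<longlonglongrightarrow> 0"
  proof -
    \<comment> \<open>The error splits into the gradient at \<open>wn\<close> against
      \<open>g n - f\<close>, small in L1 because gradients have norm at most 1, and the difference
      of gradients against the fixed \<open>f\<close>, dominated by
      \<open>2 * norm f\<close>.\<close>
    let ?d = "\<lambda>n s. \<bar>(?p (wn n s) - ?p (w s)) \<bullet> f s\<bar>"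
    have dle: "?d n s \<le> 2 * norm (f s)" for n s
      using p1[of "wn n s" "f s"] p1[of "w s" "f s"] unfolding inner_diff_left by linarith
    have di: "integrable lborel (?d n)" for n
      by (rule Bochner_Integration.integrable_bound[of _ "\<lambda>s. 2 * norm (f s)"])
        (use f dle in \<open>auto intro!: AE_I2\<close>)
    have "(\<lambda>n. LBINT s. ?d n s) \<longlonglongrightarrow> (LINT s|(lborel :: real measure). (0 :: real))"
    proof (rule integral_dominated_convergence[where w = "\<lambda>s. 2 * norm (f s)" and f = "\<lambda>s. 0" and s = ?d])
      show "AE s in lborel. (\<lambda>n. ?d n s) \<longlonglongrightarrow> 0"
        using wn_lim
      proof eventually_elim
        case (elim s)
        show ?case
        proof (cases "s \<in> {0..b}")
          case True
          then have "(\<lambda>n. ?d n s) \<longlonglongrightarrow> \<bar>(?p (w s) - ?p (w s)) \<bullet> f s\<bar>"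
            using elim by (intro tendsto_rabs tendsto_inner tendsto_diff tendsto_const pcont) auto
          then show ?thesis by simp
        qed (use supp in simp)
      qed
      show "AE s in lborel. norm (?d n s) \<le> 2 * norm (f s)" for n using dle by (auto intro!: AE_I2)
      show "integrable lborel (\<lambda>s. 2 * norm (f s))" using f by simp
    qed measurable
    then have "(\<lambda>n. (LBINT s. norm (g n s - f s)) + (LBINT s. ?d n s)) \<longlonglongrightarrow> 0 + 0"
      by (intro tendsto_add g_lim) simp
    then have u: "(\<lambda>n. (LBINT s. norm (g n s - f s)) + (LBINT s. ?d n s)) \<longlonglongrightarrow> 0" by simp
    show ?thesis
    proof (rule tendsto_sandwich[OF _ _ tendsto_const u])
      show "\<forall>\<^sub>F n in sequentially. 0 \<le> (LBINT s. norm (qn n s - q s))"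
        by (intro always_eventually allI Bochner_Integration.integral_nonneg norm_ge_zero)
      show "\<forall>\<^sub>F n in sequentially. (LBINT s. norm (qn n s - q s)) \<le> (LBINT s. norm (g n s - f s)) + (LBINT s. ?d n s)"
      proof (intro always_eventually allI)
        fix n
        have gf: "integrable lborel (\<lambda>s. norm (g n s - f s))" using gi f by auto
        have "(LBINT s. norm (qn n s - q s)) \<le> (LBINT s. norm (g n s - f s) + ?d n s)"
        proof (rule integral_mono)
          show "integrable lborel (\<lambda>s. norm (qn n s - q s))" using qni qi by auto
          show "integrable lborel (\<lambda>s. norm (g n s - f s) + ?d n s)" using gf di by (intro Bochner_Integration.integrable_add)
          fix s
          have "qn n s - q s = ?p (wn n s) \<bullet> (g n s - f s) + (?p (wn n s) - ?p (w s)) \<bullet> f s"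
            by (simp only: qn_def q_def inner_diff_left inner_diff_right)
          then show "norm (qn n s - q s) \<le> norm (g n s - f s) + ?d n s"
            using p1[of "wn n s" "g n s - f s"] unfolding real_norm_def by linarith
        qed
        also have "\<dots> = (LBINT s. norm (g n s - f s)) + (LBINT s. ?d n s)"
          using gf di by (intro Bochner_Integration.integral_add)
        finally show "(LBINT s. norm (qn n s - q s)) \<le> (LBINT s. norm (g n s - f s)) + (LBINT s. ?d n s)" .
      qed
    qed
  qed
  obtain r' where r': "strict_mono r'"
    "AE t in lborel. t \<in> {0..b} \<longrightarrow> (\<lambda>n. frac_conv \<alpha> (qn (r' n)) t) \<longlonglongrightarrow> frac_conv \<alpha> q t"
    using frac_conv_AE_subseq[OF \<alpha>(1) qi qs(1) qni qs(2) q_lim] by blast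
  have chain: "?S (wn n t) \<le> \<rho> + frac_conv \<alpha> (qn n) t" if t: "0 < t" "t \<le> b" for n t
  proof -
    obtain M where M: "\<And>x. norm (h (r n) x) \<le> M" using hM by blast
    let ?h = "\<lambda>s. indicator {0<..} s *\<^sub>R h (r n) s"
    have e: "?h s = g n s" if "s < t" for s
      using that t by (auto simp: g_def fn_def indicator_def)
    have we: "frac_conv \<alpha> ?h s = wn n s" if "s \<le> t" for s
      unfolding wn_def using that by (intro frac_conv_cong e) simp
    have "?S (frac_conv \<alpha> ?h t) \<le> \<rho> + frac_conv \<alpha> (\<lambda>s. ?p (frac_conv \<alpha> ?h s) \<bullet> ?h s) t"
      by (rule frac_chain_inequality_continuous[OF \<alpha> \<rho> hc M t(1)])
    also have "frac_conv \<alpha> (\<lambda>s. ?p (frac_conv \<alpha> ?h s) \<bullet> ?h s) t = frac_conv \<alpha> (qn n) t"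
      by (rule frac_conv_cong) (simp only: e we less_imp_le qn_def)
    finally show ?thesis using we[of t] by simp
  qed
  from wn_lim r'(2) AE_lborel_singleton[of 0]
  show ?thesis
  proof eventually_elim
    case (elim t)
    show ?case
    proof
      assume t: "t \<in> {0..b}"
      have "(\<lambda>n. ?S (wn (r' n) t)) \<longlonglongrightarrow> ?S (w t)"
        using elim(1) t LIMSEQ_subseq_LIMSEQ[OF _ r'(1), of "\<lambda>n. wn n t" "w t"]
        by (intro tendsto_intros) (simp add: o_def)
      moreover have "(\<lambda>n. \<rho> + frac_conv \<alpha> (qn (r' n)) t) \<longlonglongrightarrow> \<rho> + frac_conv \<alpha> q t"
        using elim(2) t by (intro tendsto_add tendsto_const) blast
      ultimately have "?S (w t) \<le> \<rho> + frac_conv \<alpha> q t"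
        by (rule LIMSEQ_le) (use chain elim(3) t in auto)
      then show "?S (w t) \<le> \<rho> + frac_conv \<alpha> (\<lambda>s. ?p (w s) \<bullet> f s) t" unfolding q_def[abs_def] .
    qed
  qed
qed

text \<open>With \<open>G\<close> the fractional integral of \<open>norm f\<close>, the smoothed
  chain inequality gives
  \<open>sqrt (\<rho>^2 + |w|^2) \<le> \<rho> + \<epsilon> G / \<rho>\<close>. Squaring cancels
  \<open>\<rho>^2\<close> and leaves
  \<open>|w|^2 \<le> 2 \<epsilon> G + (\<epsilon> G / \<rho>)^2\<close>; the last term disappears as
  \<rho> tends to infinity.\<close>

lemma frac_conv_energy_comparison:
  fixes f :: "real \<Rightarrow> 'a::{real_inner, banach, second_countable_topology}"
  assumes \<alpha>: "0 < \<alpha>" "\<alpha> < 1" and f: "integrable lborel f" and supp: "\<forall>s. s \<notin> {0..b} \<longrightarrow> f s = 0"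
    and \<epsilon>: "0 \<le> \<epsilon>"
    and le: "AE s in lborel. s \<in> {0..b} \<longrightarrow> frac_conv \<alpha> f s \<bullet> f s \<le> \<epsilon> * norm (f s)"
  shows "AE t in lborel. t \<in> {0..b} \<longrightarrow>
    (norm (frac_conv \<alpha> f t))\<^sup>2 \<le> 2 * \<epsilon> * frac_conv \<alpha> (\<lambda>s. norm (f s)) t"
proof -
  let ?S = "\<lambda>\<rho>. \<lambda>w::'a. sqrt (\<rho>\<^sup>2 + (norm w)\<^sup>2)"
  let ?w = "frac_conv \<alpha> f"
  let ?G = "frac_conv \<alpha> (\<lambda>s. norm (f s))"
  note [measurable] = borel_measurable_integrable[OF f]
  have [measurable]: "?w \<in> borel_measurable lborel" unfolding frac_conv_def by measurable
  have nf: "integrable lborel (\<lambda>s. norm (f s))" "\<forall>s. s \<notin> {0..b} \<longrightarrow> norm (f s) = 0" using f supp by auto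
  have G0: "0 \<le> ?G t" for t
    unfolding frac_conv_def using \<alpha> by (intro Bochner_Integration.integral_nonneg) simp
  have "AE t in lborel. t \<in> {0..b} \<longrightarrow> ?S \<rho> (?w t) \<le> \<rho> + \<epsilon> / \<rho> * ?G t" if \<rho>: "0 < \<rho>" for \<rho>
  proof -
    define q where "q s = (?w s /\<^sub>R ?S \<rho> (?w s)) \<bullet> f s" for s
    have [measurable]: "q \<in> borel_measurable lborel" unfolding q_def by measurable
    have qn: "norm (q s) \<le> norm (f s)" for s
      unfolding q_def real_norm_def
      using Cauchy_Schwarz_ineq2[of "?w s /\<^sub>R ?S \<rho> (?w s)" "f s"] smoothed_norm_gradient_le[OF \<rho>, of "?w s"]
      by (meson mult_left_le_one_le norm_ge_zero order_trans)
    have qi: "integrable lborel q" by (rule Bochner_Integration.integrable_bound[OF f]) (use qn in auto)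
    have qs: "\<forall>s. s \<notin> {0..b} \<longrightarrow> q s = 0" using supp by (auto simp: q_def)
    have qle: "AE s in lborel. q s \<le> \<epsilon> / \<rho> * norm (f s)"
      using le
    proof eventually_elim
      case (elim s)
      show ?case
      proof (cases "s \<in> {0..b}")
        case True
        have S: "\<rho> \<le> ?S \<rho> (?w s)" by (rule real_le_rsqrt) simp
        have "q s = inverse (?S \<rho> (?w s)) * (?w s \<bullet> f s)" by (simp add: q_def)
        also have "\<dots> \<le> inverse (?S \<rho> (?w s)) * (\<epsilon> * norm (f s))"
          using elim True S \<rho> by (intro mult_left_mono) auto
        also have "\<dots> \<le> inverse \<rho> * (\<epsilon> * norm (f s))"
          using S \<rho> \<epsilon> by (intro mult_right_mono le_imp_inverse_le) auto
        finally show ?thesis by (simp add: divide_inverse mult_ac)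
      qed (use supp qs in auto)
    qed
    from frac_chain_inequality_L1[OF \<alpha> \<rho> f supp] frac_conv_L1(3)[OF \<alpha>(1) qi qs] frac_conv_L1(3)[OF \<alpha>(1) nf]
    show ?thesis
    proof eventually_elim
      case (elim t)
      show ?case
      proof
        assume t: "t \<in> {0..b}"
        have "?S \<rho> (?w t) \<le> \<rho> + frac_conv \<alpha> q t" using elim(1) t by (simp only: q_def[abs_def] simp_thms)
        also have "frac_conv \<alpha> q t \<le> (LBINT s. \<epsilon> / \<rho> * (frac_kernel \<alpha> (t - s) *\<^sub>R norm (f s)))"
          unfolding frac_conv_def
        proof (rule integral_mono_AE)
          show "integrable lborel (\<lambda>s. frac_kernel \<alpha> (t - s) *\<^sub>R q s)" using elim(2) t by blast
          show "integrable lborel (\<lambda>s. \<epsilon> / \<rho> * (frac_kernel \<alpha> (t - s) *\<^sub>R norm (f s)))"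
            using elim(3) t by (intro integrable_mult_right) blast
          show "AE s in lborel. frac_kernel \<alpha> (t - s) *\<^sub>R q s \<le> \<epsilon> / \<rho> * (frac_kernel \<alpha> (t - s) *\<^sub>R norm (f s))"
            using qle
          proof eventually_elim
            case (elim s)
            from mult_left_mono[OF elim, of "frac_kernel \<alpha> (t - s)"] \<alpha> show ?case by (simp add: mult_ac)
          qed
        qed
        also have "\<dots> = \<epsilon> / \<rho> * ?G t" unfolding frac_conv_def by (rule integral_mult_right_zero)
        finally show "?S \<rho> (?w t) \<le> \<rho> + \<epsilon> / \<rho> * ?G t" by simp
      qed
    qed
  qed
  \<comment> \<open>The exceptional null set depends on \<rho>; integer values allow a single null
    set for the whole limit.\<close>
  then have "AE t in lborel. \<forall>n. t \<in> {0..b} \<longrightarrow> ?S (real (Suc n)) (?w t) \<le> real (Suc n) + \<epsilon> / real (Suc n) * ?G t"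
    unfolding AE_all_countable by auto
  then show ?thesis
  proof eventually_elim
    case (elim t)
    show ?case
    proof
      assume t: "t \<in> {0..b}"
      have "(norm (?w t))\<^sup>2 \<le> 2 * \<epsilon> * ?G t + (\<epsilon> * ?G t * (1 / real (Suc n)))\<^sup>2" for n
      proof -
        let ?r = "real (Suc n)"
        have "?r\<^sup>2 + (norm (?w t))\<^sup>2 = (?S ?r (?w t))\<^sup>2" by simp
        also have "\<dots> \<le> (?r + \<epsilon> / ?r * ?G t)\<^sup>2"
          using elim t by (intro power_mono) auto
        also have "\<dots> = ?r\<^sup>2 + 2 * \<epsilon> * ?G t + (\<epsilon> * ?G t * (1 / ?r))\<^sup>2"
        proof -
          have "(r + \<epsilon> / r * G)\<^sup>2 = r\<^sup>2 + 2 * \<epsilon> * G + (\<epsilon> * G * (1 / r))\<^sup>2" if "0 < r" for r G :: real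
            using that by (simp add: power2_eq_square field_simps)
          then show ?thesis by (simp del: of_nat_Suc)
        qed
        finally show ?thesis by simp
      qed
      moreover have "(\<lambda>n. 2 * \<epsilon> * ?G t + (\<epsilon> * ?G t * (1 / real (Suc n)))\<^sup>2) \<longlonglongrightarrow> 2 * \<epsilon> * ?G t + (\<epsilon> * ?G t * 0)\<^sup>2"
        by (intro tendsto_intros LIMSEQ_Suc[OF lim_1_over_n])
      ultimately have "(norm (?w t))\<^sup>2 \<le> 2 * \<epsilon> * ?G t + (\<epsilon> * ?G t * 0)\<^sup>2"
        by (intro LIMSEQ_le_const) auto
      then show "(norm (?w t))\<^sup>2 \<le> 2 * \<epsilon> * ?G t" by simp
    qed
  qed
qed

subsection \<open>Test functions\<close>

text \<open>A smooth regularization of the truncated power \<open>(b - t)^r\<close>: the exponential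
  is flat to infinite order at \<open>b\<close>, and as \<open>e\<close> tends to 0 the power is
  recovered for \<open>t < b\<close>. Differentiation lowers \<open>r\<close> by 1 or 2 and keeps
  \<open>e\<close> and \<open>b\<close>, so the span of the family is closed under it.\<close>

definition flat_powr :: "real \<Rightarrow> real \<Rightarrow> real \<Rightarrow> real \<Rightarrow> real" where
  "flat_powr r e b t = (if t < b then (b - t) powr r * exp (- e / (b - t)) else 0)"

lemma flat_powr_DERIV:
  assumes "0 < e"
  shows "(flat_powr r e b has_real_derivative (- r) * flat_powr (r - 1) e b t + (- e) * flat_powr (r - 2) e b t) (at t)"
proof -
  consider "t < b" | "t > b" | "t = b" by linarith
  then show ?thesis
  proof cases
    case 1
    have "((\<lambda>t. (b - t) powr r * exp (- e / (b - t))) has_real_derivative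
       (- r) * ((b - t) powr (r - 1) * exp (- e / (b - t))) + (- e) * ((b - t) powr (r - 2) * exp (- e / (b - t)))) (at t)"
    proof -
      have p: "(b - t) powr (r - 2) = (b - t) powr r / (b - t)\<^sup>2"
        using 1 by (simp add: powr_diff powr_numeral)
      show ?thesis unfolding p
        using 1 by (auto intro!: derivative_eq_intros simp: field_simps power2_eq_square)
    qed
    then show ?thesis
      by (rule has_field_derivative_transform_within_open[where S = "{..<b}", THEN DERIV_cong])
        (use 1 in \<open>auto simp: flat_powr_def\<close>)
  next
    case 2
    have "((\<lambda>t. 0) has_real_derivative 0) (at t)" by simp
    then have "(flat_powr r e b has_real_derivative 0) (at t)"
      by (rule has_field_derivative_transform_within_open[where S = "{b<..}"]) (use 2 in \<open>auto simp: flat_powr_def\<close>)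
    then show ?thesis using 2 by (simp add: flat_powr_def)
  next
    case 3
    \<comment> \<open>At the junction the exponential beats every power, whatever the sign of
      \<open>r\<close>.\<close>
    have lim: "((\<lambda>x. x powr (r - 1) * exp (- e / x)) \<longlongrightarrow> 0) (at_right 0)" using assms by real_asymp
    have "((\<lambda>h. (flat_powr r e b (b + h) - flat_powr r e b b) / h) \<longlongrightarrow> 0) (at 0)"
    proof (rule filterlim_split_at)
      have "((\<lambda>h. (flat_powr r e b (b + h) - flat_powr r e b b) / h) \<longlongrightarrow> 0) (at_right 0)
         \<longleftrightarrow> ((\<lambda>h::real. 0) \<longlongrightarrow> (0::real)) (at_right 0)"
        by (rule tendsto_cong) (auto simp: eventually_at_right_field flat_powr_def intro!: exI[of _ 1])
      then show "((\<lambda>h. (flat_powr r e b (b + h) - flat_powr r e b b) / h) \<longlongrightarrow> 0) (at_right 0)" by simp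
      have "((\<lambda>h. (flat_powr r e b (b + - h) - flat_powr r e b b) / - h) \<longlongrightarrow> 0) (at_right 0)
         \<longleftrightarrow> ((\<lambda>x. - (x powr (r - 1) * exp (- e / x))) \<longlongrightarrow> 0) (at_right 0)"
        by (rule tendsto_cong)
          (auto simp: eventually_at_right_field flat_powr_def powr_diff intro!: exI[of _ 1])
      then have "((\<lambda>h. (flat_powr r e b (b + - h) - flat_powr r e b b) / - h) \<longlongrightarrow> 0) (at_right 0)"
        using tendsto_minus[OF lim] by simp
      then show "((\<lambda>h. (flat_powr r e b (b + h) - flat_powr r e b b) / h) \<longlongrightarrow> 0) (at_left 0)"
        by (subst filterlim_at_left_to_right) simp
    qed
    then have "(flat_powr r e b has_real_derivative 0) (at b)" by (simp add: DERIV_def)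
    then show ?thesis using 3 by (simp add: flat_powr_def)
  qed
qed

text \<open>A class of functions closed under differentiation consists of smooth functions.\<close>

inductive smooth_class :: "(real \<Rightarrow> real) \<Rightarrow> bool" where
  flat: "0 < e \<Longrightarrow> smooth_class (flat_powr r e b)"
| reflect: "smooth_class f \<Longrightarrow> smooth_class (\<lambda>t. f (- t))"
| scale: "smooth_class f \<Longrightarrow> smooth_class (\<lambda>t. c * f t)"
| add: "smooth_class f \<Longrightarrow> smooth_class g \<Longrightarrow> smooth_class (\<lambda>t. f t + g t)"
| mult: "smooth_class f \<Longrightarrow> smooth_class g \<Longrightarrow> smooth_class (\<lambda>t. f t * g t)"
| primitive: "smooth_class f \<Longrightarrow> (\<And>t. (F has_real_derivative f t) (at t)) \<Longrightarrow> smooth_class F"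

lemma smooth_class_DERIV:
  assumes "smooth_class f"
  shows "\<exists>f'. smooth_class f' \<and> (\<forall>t. (f has_real_derivative f' t) (at t))"
  using assms
proof induction
  case (flat e r b)
  then show ?case
    by (intro exI[of _ "\<lambda>t. (- r) * flat_powr (r - 1) e b t + (- e) * flat_powr (r - 2) e b t"] conjI allI
        smooth_class.add smooth_class.scale smooth_class.flat flat_powr_DERIV)
next
  case (reflect f)
  then obtain f' where f': "smooth_class f'" "\<And>t. (f has_real_derivative f' t) (at t)" by blast
  show ?case
  proof (intro exI[of _ "\<lambda>t. (- 1) * f' (- t)"] conjI allI smooth_class.scale smooth_class.reflect f'(1))
    fix t show "((\<lambda>t. f (- t)) has_real_derivative (- 1) * f' (- t)) (at t)"
      by (rule DERIV_cong[OF DERIV_chain2[OF f'(2)]]) (auto intro!: derivative_eq_intros)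
  qed
next
  case (scale f c)
  then obtain f' where f': "smooth_class f'" "\<And>t. (f has_real_derivative f' t) (at t)" by blast
  show ?case
    by (intro exI[of _ "\<lambda>t. c * f' t"] conjI allI smooth_class.scale f' DERIV_cmult)
next
  case (add f g)
  then obtain f' g' where "smooth_class f'" "\<And>t. (f has_real_derivative f' t) (at t)"
    "smooth_class g'" "\<And>t. (g has_real_derivative g' t) (at t)" by blast
  then show ?case
    by (intro exI[of _ "\<lambda>t. f' t + g' t"] conjI allI smooth_class.add DERIV_add)
next
  case (mult f g)
  then obtain f' g' where d: "smooth_class f'" "\<And>t. (f has_real_derivative f' t) (at t)"
    "smooth_class g'" "\<And>t. (g has_real_derivative g' t) (at t)" by blast
  show ?case
    by (intro exI[of _ "\<lambda>t. f' t * g t + g' t * f t"] conjI allI smooth_class.add smooth_class.mult d mult.hyps DERIV_mult)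
next
  case (primitive f F)
  then show ?case by blast
qed

lemma smooth_class_deriv: "smooth_class f \<Longrightarrow> smooth_class (deriv f)"
proof -
  assume "smooth_class f"
  then obtain f' where f': "smooth_class f'" "\<And>t. (f has_real_derivative f' t) (at t)"
    using smooth_class_DERIV by blast
  then have "deriv f = f'" using DERIV_imp_deriv by blast
  then show ?thesis using f' by simp
qed

lemma smooth_class_differentiable:
  assumes "smooth_class f"
  shows "(deriv ^^ n) f differentiable (at x)"
proof -
  have "smooth_class ((deriv ^^ n) f)" by (induction n) (use assms smooth_class_deriv in auto)
  then show ?thesis using smooth_class_DERIV real_differentiable_def by blast
qed

text \<open>A test function must vanish far to the left although only \<open>[0, b]\<close> matters.
  The cutoff is constant on the half-line of nonnegative times, so it leaves derivatives there
  untouched up to the factor \<open>c\<close>, which is not normalized and cancels in the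
  application.\<close>

lemma smooth_cutoff:
  obtains \<eta> :: "real \<Rightarrow> real" and c where "smooth_class \<eta>" "0 < c"
    "\<And>t. t \<le> -1 \<Longrightarrow> \<eta> t = 0" "\<And>t. 0 \<le> t \<Longrightarrow> \<eta> t = c" "\<And>t. 0 \<le> t \<Longrightarrow> (\<eta> has_real_derivative 0) (at t)"
proof -
  \<comment> \<open>The standard bump \<open>exp (1/t) * exp (-1/(1+t))\<close> on
    \<open>(-1, 0)\<close>; the cutoff is its primitive.\<close>
  define k where "k t = flat_powr 0 1 0 t * flat_powr 0 1 1 (- t)" for t
  have k: "smooth_class k" unfolding k_def by (intro smooth_class.intros) auto
  have k0: "k t = 0" if "t \<le> -1 \<or> 0 \<le> t" for t using that by (auto simp: k_def flat_powr_def)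
  have kp: "0 < k t" if "-1 < t" "t < 0" for t using that by (auto simp: k_def flat_powr_def)
  have kc: "isCont k t" for t
    using smooth_class_DERIV[OF k] DERIV_isCont by blast
  obtain F where "\<forall>x. -\<infinity> < ereal x \<longrightarrow> ereal x < \<infinity> \<longrightarrow> (F has_vector_derivative k x) (at x)"
    using einterval_antiderivative[of "-\<infinity>" \<infinity> k] kc by auto
  then have F: "(F has_real_derivative k x) (at x)" for x by (simp add: has_real_derivative_iff_has_vector_derivative)
  define \<eta> where "\<eta> t = F t - F (- 1)" for t
  have D: "(\<eta> has_real_derivative k x) (at x)" for x
    unfolding \<eta>_def by (rule DERIV_cong[OF DERIV_diff[OF F DERIV_const]]) simp
  have Fc: "continuous_on A \<eta>" for A using D DERIV_isCont continuous_at_imp_continuous_on by blast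
  show ?thesis
  proof (rule that[of \<eta> "\<eta> 0"])
    show "smooth_class \<eta>" using smooth_class.primitive[OF k D] .
    have "\<eta> (-1) < \<eta> 0"
      by (rule DERIV_pos_imp_increasing_open) (use D kp Fc in auto)
    then show "0 < \<eta> 0" by (simp add: \<eta>_def)
    show "\<eta> t = 0" if "t \<le> -1" for t
    proof (cases "t = -1")
      case False
      have "\<eta> (-1) = \<eta> t"
        by (rule DERIV_isconst_end) (use False that Fc D k0 in \<open>auto intro!: DERIV_cong[OF D]\<close>)
      then show ?thesis by (simp add: \<eta>_def)
    qed (simp add: \<eta>_def)
    show "\<eta> t = \<eta> 0" if "0 \<le> t" for t
    proof (cases "t = 0")
      case False
      show "\<eta> t = \<eta> 0"
        by (rule DERIV_isconst_end) (use False that Fc D k0 in \<open>auto intro!: DERIV_cong[OF D]\<close>)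
    qed simp
    show "(\<eta> has_real_derivative 0) (at t)" if "0 \<le> t" for t using D[of t] k0[of t] that by simp
  qed
qed

text \<open>Euler's Beta integral as a semigroup identity: the kernels of orders
  \<open>\<alpha>\<close> and \<open>1 - \<alpha>\<close> convolve to the kernel of order 1, the
  Heaviside function. All inversions between derivative and integral come down to it.\<close>

lemma has_integral_frac_kernel_beta:
  assumes \<alpha>: "0 < \<alpha>" "\<alpha> < 1"
  shows "has_bochner_integral lborel (\<lambda>s. frac_kernel \<alpha> (x - s) * frac_kernel (1 - \<alpha>) s) (indicator {0<..} x)"
proof (cases "0 < x")
  case False
  have "(\<lambda>s. frac_kernel \<alpha> (x - s) * frac_kernel (1 - \<alpha>) s) = (\<lambda>s. 0)"
  proof
    fix s show "frac_kernel \<alpha> (x - s) * frac_kernel (1 - \<alpha>) s = 0"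
      using False by (cases "0 < s") auto
  qed
  then show ?thesis using False by (simp add: has_bochner_integral_zero)
next
  case x: True
  let ?G = "Gamma \<alpha> * Gamma (1 - \<alpha>)"
  have G: "0 < ?G" using \<alpha> by (intro mult_pos_pos Gamma_real_pos) auto
  have B: "((\<lambda>t. t powr (1 - \<alpha> - 1) * (1 - t) powr (\<alpha> - 1)) has_integral ?G) {0..1}"
    using has_integral_Beta_real[of "1 - \<alpha>" \<alpha>] \<alpha> by (simp add: Beta_def mult.commute)
  define F where "F t = (if t \<in> {0..1} then t powr (1 - \<alpha> - 1) * (1 - t) powr (\<alpha> - 1) else 0)" for t :: real
  have [measurable]: "F \<in> borel_measurable borel" unfolding F_def by measurable
  have "(F has_integral ?G) UNIV" unfolding F_def has_integral_restrict_UNIV using B .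
  moreover have Fnn: "0 \<le> F t" for t by (simp add: F_def)
  ultimately have "integral\<^sup>N lborel F = ?G"
    by (intro nn_integral_has_integral_lborel) auto
  then have F: "has_bochner_integral lborel F ?G"
    using G Fnn by (intro has_bochner_integral_nn_integral) auto
  \<comment> \<open>Under \<open>s = x t\<close> the powers of \<open>x\<close> combine to
    \<open>1 / x\<close>, which the Jacobian cancels; the value is therefore independent of
    \<open>x\<close>.\<close>
  have eq: "frac_kernel \<alpha> (x - (0 + x * t)) * frac_kernel (1 - \<alpha>) (0 + x * t) = F t / (x * ?G)" for t
  proof (cases "0 < t \<and> t < 1")
    case True
    have "x - x * t = x * (1 - t)" by (simp add: algebra_simps)
    moreover have "0 < x * (1 - t)" "0 < x * t" using True x by auto
    ultimately have "frac_kernel \<alpha> (x - (0 + x * t)) * frac_kernel (1 - \<alpha>) (0 + x * t)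
       = (x * (1 - t)) powr (\<alpha> - 1) * (x * t) powr (1 - \<alpha> - 1) / ?G"
      by (simp add: frac_kernel_def)
    also have "(x * (1 - t)) powr (\<alpha> - 1) * (x * t) powr (1 - \<alpha> - 1) = (x powr (\<alpha> - 1) * x powr (1 - \<alpha> - 1)) * F t"
      using True x by (simp add: powr_mult F_def)
    also have "x powr (\<alpha> - 1) * x powr (1 - \<alpha> - 1) = 1 / x"
      using x by (simp add: powr_add[symmetric] powr_minus_divide powr_diff)
    finally show ?thesis by simp
  next
    case False
    have F0: "F t = 0" using False by (auto simp: F_def)
    have "x * t \<le> 0 \<or> x - x * t \<le> 0"
    proof (cases "t \<le> 0")
      case True
      then show ?thesis using x by (simp add: mult_le_0_iff)
    next
      case False
      then have "1 \<le> t" using \<open>\<not> (0 < t \<and> t < 1)\<close> by simp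
      then have "x * 1 \<le> x * t" using x by (intro mult_left_mono) auto
      then show ?thesis by simp
    qed
    then show ?thesis using F0 by auto
  qed
  have "has_bochner_integral lborel (\<lambda>t. F t / (x * ?G)) (?G / (x * ?G))"
    using F by (rule has_bochner_integral_divide_zero)
  then have "has_bochner_integral lborel (\<lambda>t. frac_kernel \<alpha> (x - (0 + x * t)) * frac_kernel (1 - \<alpha>) (0 + x * t)) (1 /\<^sub>R \<bar>x\<bar>)"
    unfolding eq using x G by (simp add: field_simps split: if_splits)
  then show ?thesis using x
    by (subst lborel_has_bochner_integral_real_affine_iff[of x _ _ 0]) auto
qed

text \<open>Strong solutions are formulated over Lebesgue measure, while Fubini and the affine
  substitutions are carried out on \<open>lborel\<close>; a Borel representative bridges the
  two.\<close>

lemma lebesgue_integrable_borel_version: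
  fixes f :: "'b::euclidean_space \<Rightarrow> 'a::{banach, second_countable_topology}"
  assumes "integrable lebesgue f"
  obtains g where "integrable lborel g" "AE x in lborel. f x = g x"
proof -
  have "\<exists>g. g \<in> borel_measurable lborel \<and> (AE x in lborel. f x = g x)"
    using assms
  proof (induction rule: integrable_induct)
    case (base A c)
    obtain S N N' where A: "A = S \<union> N" "N \<subseteq> N'" "N' \<in> null_sets lborel" "S \<in> sets lborel"
      by (rule completionE[OF base(1)[unfolded sets_completion]])
    have "AE x in lborel. indicator A x *\<^sub>R c = indicator S x *\<^sub>R c"
      using AE_not_in[OF A(3)] by eventually_elim (use A(1,2) in \<open>auto simp: indicator_def\<close>)
    then show ?case using A(4) by (intro exI[of _ "\<lambda>x. indicator S x *\<^sub>R c"] conjI) (auto intro!: borel_measurable_scaleR)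
  next
    case (add f g)
    then obtain f' g' where [measurable]: "f' \<in> borel_measurable lborel" "g' \<in> borel_measurable lborel"
      and e: "AE x in lborel. f x = f' x" "AE x in lborel. g x = g' x" by blast
    have "AE x in lborel. f x + g x = f' x + g' x" using e by eventually_elim simp
    then show ?case by (intro exI[of _ "\<lambda>x. f' x + g' x"] conjI) auto
  next
    case (lim f s)
    then obtain g where [measurable]: "\<And>i. g i \<in> borel_measurable lborel" and e: "\<And>i. AE x in lborel. s i x = g i x"
      by metis
    have "AE x in lborel. \<forall>i. s i x = g i x" unfolding AE_all_countable using e by blast
    then have "AE x in lborel. f x = Topological_Spaces.lim (\<lambda>i. g i x)"
    proof eventually_elim
      case (elim x)
      then have "(\<lambda>i. g i x) \<longlonglongrightarrow> f x" using lim.hyps(2)[of x] by simp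
      then show ?case by (simp add: limI)
    qed
    then show ?case by (intro exI[of _ "\<lambda>x. Topological_Spaces.lim (\<lambda>i. g i x)"] conjI) measurable
  qed
  then obtain g where g: "g \<in> borel_measurable lborel" "AE x in lborel. f x = g x" by blast
  have "integrable lebesgue g"
    by (rule integrable_cong_AE_imp[OF assms]) (use g in \<open>auto simp: AE_completion measurable_completion\<close>)
  then have "integrable lborel g" using g by (simp add: integrable_completion)
  then show ?thesis using that g by blast
qed

text \<open>Half-lines form a generator stable under intersection, so the sets of integral 0 exhaust
  the Borel sets; the total integral handles complements.\<close>

lemma AE_zero_if_integrals_atMost_zero:
  fixes d :: "real \<Rightarrow> 'a::{banach, second_countable_topology}"
  assumes d: "integrable lborel d" and z: "\<And>b. (LINT t:{..b}|lborel. d t) = 0"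
    and total: "(LBINT t. d t) = 0"
  shows "AE t in lborel. d t = 0"
proof (rule sigma_finite_measure.density_zero[OF sigma_finite_lborel d])
  fix A :: "real set" assume "A \<in> sets lborel"
  then have "A \<in> sigma_sets UNIV (range (\<lambda>a. {..a}))"
    by (simp add: borel_eq_atMost sets_measure_of)
  note A = this
  have I: "Int_stable (range (\<lambda>a::real. {..a}))" by (auto simp: Int_stable_def)
  have "range (\<lambda>a::real. {..a}) \<subseteq> Pow UNIV" by simp
  from I this A show "(LINT t:A|lborel. d t) = 0"
  proof (induction rule: sigma_sets_induct_disjoint)
    case (basic A)
    then show ?case using z by auto
  next
    case empty
    show ?case by (simp add: set_lebesgue_integral_def)
  next
    case (compl A)
    then have A: "A \<in> sets lborel" by (simp add: borel_eq_atMost sets_measure_of)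
    have "(LBINT t. d t) = (LBINT t. indicator A t *\<^sub>R d t + indicator (UNIV - A) t *\<^sub>R d t)"
      by (intro Bochner_Integration.integral_cong) (auto simp: indicator_def)
    also have "\<dots> = (LINT t:A|lborel. d t) + (LINT t:UNIV - A|lborel. d t)"
      unfolding set_lebesgue_integral_def using A d
      by (intro Bochner_Integration.integral_add integrable_mult_indicator) auto
    finally show ?case using compl total by simp
  next
    case (union A)
    then have A: "A i \<in> sets lborel" for i by (simp add: borel_eq_atMost sets_measure_of image_subset_iff subset_iff)
    have "(LINT t:(\<Union>i. A i)|lborel. d t) = (\<Sum>i. LINT t:A i|lborel. d t)"
    proof (rule lebesgue_integral_countable_add)
      show "set_integrable lborel (\<Union>i. A i) d"
        unfolding set_integrable_def using A d by (intro integrable_mult_indicator) auto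
      show "A i \<inter> A j = {}" if "i \<noteq> j" for i j using union(1) that by (auto simp: disjoint_family_on_def)
    qed (rule A)
    then show ?case using union by simp
  qed
qed

subsection \<open>Caputo derivatives and Volterra equations\<close>

lemma test_function_facts:
  assumes "\<psi> \<in> test_functions T"
  shows "\<exists>L b. b < T \<and> (\<forall>t. (\<psi> has_real_derivative deriv \<psi> t) (at t)) \<and> continuous_on UNIV (deriv \<psi>) \<and>
    (\<forall>t. t \<notin> {L..b} \<longrightarrow> \<psi> t = 0) \<and> (\<forall>t. t \<notin> {L..b} \<longrightarrow> deriv \<psi> t = 0)"
proof -
  let ?K = "closure {t. \<psi> t \<noteq> 0}"
  have diff: "\<And>n x. (deriv ^^ n) \<psi> differentiable (at x)" and K: "compact ?K" "?K \<subseteq> {..<T}"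
    using assms by (auto simp: test_functions_def)
  have D: "(\<psi> has_real_derivative deriv \<psi> t) (at t)" for t
    using diff[of 0 t] by (metis DERIV_imp_deriv funpow_0 real_differentiable_def)
  have c: "continuous_on UNIV (deriv \<psi>)"
    using diff[of 1] by (auto intro!: continuous_at_imp_continuous_on differentiable_imp_continuous_within)
  obtain L b where Lb: "b < T" "?K \<subseteq> {L..b}"
  proof (cases "?K = {}")
    case True
    then show ?thesis using that[of "T - 1" 0] by simp
  next
    case False
    obtain b where b: "b \<in> ?K" "\<And>x. x \<in> ?K \<Longrightarrow> x \<le> b" using compact_attains_sup[OF K(1) False] by blast
    obtain L where L: "\<And>x. x \<in> ?K \<Longrightarrow> L \<le> x" using compact_attains_inf[OF K(1) False] by blast
    have "?K \<subseteq> {L..b}" using b(2) L by auto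
    moreover have "b < T" using b(1) K(2) by blast
    ultimately show ?thesis using that by blast
  qed
  have z: "\<psi> t = 0" if "t \<notin> {L..b}" for t using that Lb(2) closure_subset[of "{t. \<psi> t \<noteq> 0}"] by auto
  have "deriv \<psi> t = 0" if "t \<notin> {L..b}" for t
  proof -
    have "(\<psi> has_real_derivative 0) (at t)"
    proof (rule has_field_derivative_transform_within_open[of "\<lambda>_. 0" 0 t "- {L..b}"])
      show "open (- {L..b})" by (intro open_Compl) simp
    qed (use that z in auto)
    then show ?thesis by (rule DERIV_imp_deriv)
  qed
  with D c Lb(1) z show ?thesis by (intro exI[of _ L] exI[of _ b]) simp
qed

text \<open>Makes the distributional pairing classical: the derivative falls on the test function,
  and what remains is a right-sided fractional integral of order
  \<open>1 - \<alpha>\<close>.\<close>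

lemma g_neg_shift:
  assumes D: "\<And>t. (\<psi> has_real_derivative \<psi>' t) (at t)" and [measurable]: "\<psi>' \<in> borel_measurable borel"
  shows "g_neg \<alpha> (\<lambda>s. \<psi> (t + s)) = - (LBINT s. \<psi>' (t + s) * frac_kernel (1 - \<alpha>) s)"
proof -
  have "deriv (\<lambda>s. \<psi> (t + s)) = (\<lambda>s. \<psi>' (t + s))"
  proof
    fix s
    have "((\<lambda>s. \<psi> (t + s)) has_real_derivative \<psi>' (t + s) * 1) (at s)"
      by (rule DERIV_chain2[OF D]) (auto intro!: derivative_eq_intros)
    then show "deriv (\<lambda>s. \<psi> (t + s)) s = \<psi>' (t + s)" by (simp add: DERIV_imp_deriv)
  qed
  then have "g_neg \<alpha> (\<lambda>s. \<psi> (t + s)) = - (1 / Gamma (1 - \<alpha>) * (LINT s|lebesgue. \<psi>' (t + s) * (heaviside s * s powr (- \<alpha>))))"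
    by (simp add: g_neg_def distr_deriv_def regular_distr_def)
  also have "(LINT s|lebesgue. \<psi>' (t + s) * (heaviside s * s powr (- \<alpha>))) = (LBINT s. \<psi>' (t + s) * (heaviside s * s powr (- \<alpha>)))"
    by (rule integral_completion) (simp add: heaviside_def)
  also have "1 / Gamma (1 - \<alpha>) * \<dots> = (LBINT s. 1 / Gamma (1 - \<alpha>) * (\<psi>' (t + s) * (heaviside s * s powr (- \<alpha>))))"
    by (rule integral_mult_right_zero[symmetric])
  also have "\<dots> = (LBINT s. \<psi>' (t + s) * frac_kernel (1 - \<alpha>) s)"
  proof (rule Bochner_Integration.integral_cong[OF refl])
    fix s :: real
    \<comment> \<open>At \<open>s = 0\<close> the Heaviside factor is 1, but \<open>0 powr\<close>
      anything is 0, in agreement with the kernel.\<close>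
    show "1 / Gamma (1 - \<alpha>) * (\<psi>' (t + s) * (heaviside s * s powr (- \<alpha>))) = \<psi>' (t + s) * frac_kernel (1 - \<alpha>) s"
      by (cases "s = 0") (simp_all add: heaviside_def frac_kernel_def)
  qed
  finally show ?thesis .
qed

text \<open>The inversion formula on the side of the test function. After Fubini the two kernels
  merge by the Beta identity into an indicator, and the integral of the derivative from
  \<open>s\<close> to infinity is \<open>- \<psi> s\<close>.\<close>

lemma test_function_double_fractional_integral:
  assumes \<alpha>: "0 < \<alpha>" "\<alpha> < 1"
    and D: "\<And>t. (\<psi> has_real_derivative \<psi>' t) (at t)" and c: "continuous_on UNIV \<psi>'"
    and z: "\<And>t. t \<notin> {L..b} \<Longrightarrow> \<psi> t = 0" and z': "\<And>t. t \<notin> {L..b} \<Longrightarrow> \<psi>' t = 0"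
  shows "(LBINT t. (LBINT x. \<psi>' (t + x) * frac_kernel (1 - \<alpha>) x) * frac_kernel \<alpha> (t - s)) = - \<psi> s"
proof -
  have [measurable]: "\<psi>' \<in> borel_measurable borel" using c by (rule borel_measurable_continuous_onI)
  let ?H = "\<lambda>\<tau> t. \<psi>' \<tau> * (frac_kernel (1 - \<alpha>) (\<tau> - t) * frac_kernel \<alpha> (t - s))"
  have B: "has_bochner_integral lborel (\<lambda>t. frac_kernel (1 - \<alpha>) (\<tau> - t) * frac_kernel \<alpha> (t - s)) (indicator {0<..} (\<tau> - s))" for \<tau>
  proof -
    have "has_bochner_integral lborel (\<lambda>y. frac_kernel (1 - \<alpha>) (\<tau> - s - y) * frac_kernel \<alpha> y) (indicator {0<..} (\<tau> - s))"
      using has_integral_frac_kernel_beta[of "1 - \<alpha>" "\<tau> - s"] \<alpha> by simp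
    then show ?thesis
      by (subst lborel_has_bochner_integral_real_affine_iff[of 1 _ _ s]) (simp_all add: algebra_simps)
  qed
  have intp: "integrable lborel (\<lambda>\<tau>. \<psi>' \<tau> * indicator {L..b} \<tau>)"
    using borel_integrable_atLeastAtMost'[of L b \<psi>'] continuous_on_subset[OF c]
    by (simp add: set_integrable_def mult.commute)
  have int\<psi>: "integrable lborel (\<lambda>\<tau>. norm (\<psi>' \<tau>) * indicator {0<..} (\<tau> - s))"
  proof (rule Bochner_Integration.integrable_bound[OF intp])
    show "AE \<tau> in lborel. norm (norm (\<psi>' \<tau>) * indicator {0<..} (\<tau> - s)) \<le> norm (\<psi>' \<tau> * indicator {L..b} \<tau>)"
      using z' by (intro AE_I2) (auto simp: indicator_def)
  qed measurable
  have H: "integrable (lborel \<Otimes>\<^sub>M lborel) (\<lambda>(\<tau>, t). ?H \<tau> t)"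
  proof (rule lborel_pair.Fubini_integrable)
    show "(\<lambda>(\<tau>, t). ?H \<tau> t) \<in> borel_measurable (lborel \<Otimes>\<^sub>M lborel)" by measurable
    have "(LBINT t. norm (case (\<tau>, t) of (\<tau>, t) \<Rightarrow> ?H \<tau> t)) = norm (\<psi>' \<tau>) * indicator {0<..} (\<tau> - s)" for \<tau>
    proof -
      have "(\<lambda>t. norm (case (\<tau>, t) of (\<tau>, t) \<Rightarrow> ?H \<tau> t)) = (\<lambda>t. norm (\<psi>' \<tau>) * (frac_kernel (1 - \<alpha>) (\<tau> - t) * frac_kernel \<alpha> (t - s)))"
        using \<alpha> by (auto simp: abs_mult fun_eq_iff)
      then show ?thesis
        using has_bochner_integral_integral_eq[OF has_bochner_integral_mult_right[OF B[of \<tau>], of "norm (\<psi>' \<tau>)"]] by (simp only:)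
    qed
    then show "integrable lborel (\<lambda>\<tau>. LBINT t. norm (case (\<tau>, t) of (\<tau>, t) \<Rightarrow> ?H \<tau> t))"
      using int\<psi> by (simp only:)
    show "AE \<tau> in lborel. integrable lborel (\<lambda>t. case (\<tau>, t) of (\<tau>, t) \<Rightarrow> ?H \<tau> t)"
      using has_bochner_integral_mult_right[OF B] by (intro AE_I2) (simp add: has_bochner_integral_iff)
  qed
  have "(LBINT t. (LBINT x. \<psi>' (t + x) * frac_kernel (1 - \<alpha>) x) * frac_kernel \<alpha> (t - s)) = (LBINT t. LBINT \<tau>. ?H \<tau> t)"
  proof (rule Bochner_Integration.integral_cong[OF refl])
    fix t :: real
    have "(LBINT x. \<psi>' (t + x) * frac_kernel (1 - \<alpha>) x) = (LBINT \<tau>. \<psi>' \<tau> * frac_kernel (1 - \<alpha>) (\<tau> - t))"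
      by (subst lborel_integral_real_affine[of 1 _ t]) simp_all
    then have "(LBINT x. \<psi>' (t + x) * frac_kernel (1 - \<alpha>) x) * frac_kernel \<alpha> (t - s)
        = (LBINT \<tau>. \<psi>' \<tau> * frac_kernel (1 - \<alpha>) (\<tau> - t) * frac_kernel \<alpha> (t - s))"
      by (simp only: integral_mult_left_zero)
    then show "(LBINT x. \<psi>' (t + x) * frac_kernel (1 - \<alpha>) x) * frac_kernel \<alpha> (t - s) = (LBINT \<tau>. ?H \<tau> t)"
      by (simp only: mult.assoc)
  qed
  also have "\<dots> = (LBINT \<tau>. LBINT t. ?H \<tau> t)"
    using lborel_pair.Fubini_integral[OF H] by simp
  also have "\<dots> = (LBINT \<tau>. \<psi>' \<tau> * indicator {0<..} (\<tau> - s))"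
    using has_bochner_integral_integral_eq[OF has_bochner_integral_mult_right[OF B]] by (simp only:)
  \<comment> \<open>The right end lies beyond the support and strictly beyond \<open>s\<close>, so
    the fundamental theorem applies and the boundary value there is 0.\<close>
  also have "\<dots> = (LBINT \<tau>. \<psi>' \<tau> * indicator {s..max s b + 1} \<tau>)"
  proof (rule integral_cong_AE)
    show "AE \<tau> in lborel. \<psi>' \<tau> * indicator {0<..} (\<tau> - s) = \<psi>' \<tau> * indicator {s..max s b + 1} \<tau>"
      using AE_lborel_singleton[of s]
    proof eventually_elim
      case (elim \<tau>)
      then show ?case using z'[of \<tau>] by (cases "\<tau> \<in> {L..b}") (auto simp: indicator_def)
    qed
  qed measurable
  also have "\<dots> = \<psi> (max s b + 1) - \<psi> s"
    by (rule integral_FTC_Icc_real) (use D c in \<open>auto intro: continuous_on_interior\<close>)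
  also have "\<psi> (max s b + 1) = 0" by (rule z) auto
  finally show ?thesis by simp
qed

text \<open>The fractional integral is moved onto the test function by Fubini, where the inversion
  formula returns the test function paired with \<open>v\<close>.\<close>

lemma frac_conv_has_caputo_derivative:
  fixes v :: "real \<Rightarrow> 'a::{banach, second_countable_topology}"
  assumes \<alpha>: "0 < \<alpha>" "\<alpha> < 1" and v: "integrable lborel v" and supp: "\<forall>s. s \<notin> {0..T} \<longrightarrow> v s = 0"
    and u: "\<And>t. 0 \<le> t \<Longrightarrow> t < T \<Longrightarrow> u t = u0 + frac_conv \<alpha> v t"
  shows "has_caputo_derivative \<alpha> T u0 u v"
  unfolding has_caputo_derivative_def
proof (intro conjI ballI)
  note [measurable] = borel_measurable_integrable[OF v]
  have vl: "integrable lebesgue v" using v by (simp add: integrable_completion)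
  then show "L1_loc T v" unfolding L1_loc_def set_integrable_def by (intro allI impI integrable_mult_indicator) auto
  fix \<psi> assume \<psi>: "\<psi> \<in> test_functions T"
  obtain L b where b: "b < T" and D: "\<forall>t. (\<psi> has_real_derivative deriv \<psi> t) (at t)" and c: "continuous_on UNIV (deriv \<psi>)"
    and z: "\<forall>t. t \<notin> {L..b} \<longrightarrow> \<psi> t = 0" and z': "\<forall>t. t \<notin> {L..b} \<longrightarrow> deriv \<psi> t = 0"
    using test_function_facts[OF \<psi>] by (elim exE conjE)
  note D = D[rule_format] and z = z[rule_format] and z' = z'[rule_format]
  have [measurable]: "deriv \<psi> \<in> borel_measurable borel" using c by (rule borel_measurable_continuous_onI)
  have [measurable]: "\<psi> \<in> borel_measurable borel"
    by (intro borel_measurable_continuous_onI continuous_at_imp_continuous_on ballI DERIV_isCont[OF D])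
  define R where "R t = (LBINT x. deriv \<psi> (t + x) * frac_kernel (1 - \<alpha>) x)" for t
  have [measurable]: "R \<in> borel_measurable borel" unfolding R_def by measurable
  have R0: "R t = 0" if "T \<le> t" for t
  proof -
    have "deriv \<psi> (t + x) * frac_kernel (1 - \<alpha>) x = 0" for x
      using z'[of "t + x"] that b by (cases "0 < x") auto
    then show ?thesis unfolding R_def by (simp only: Bochner_Integration.integral_zero)
  qed
  obtain M where M: "\<And>t. \<bar>deriv \<psi> t\<bar> \<le> M" "0 \<le> M"
  proof -
    have "bounded (deriv \<psi> ` {L..b})"
      by (intro compact_imp_bounded compact_continuous_image continuous_on_subset[OF c]) auto
    then obtain M where "\<forall>x\<in>deriv \<psi> ` {L..b}. norm x \<le> M" unfolding bounded_iff by blast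
    then have M: "\<And>t. t \<in> {L..b} \<Longrightarrow> \<bar>deriv \<psi> t\<bar> \<le> M" by simp
    have "\<bar>deriv \<psi> t\<bar> \<le> max M 0" for t
      using M[of t] z'[of t] by (cases "t \<in> {L..b}") auto
    then show ?thesis using that[of "max M 0"] by auto
  qed
  \<comment> \<open>Both factors are truncated to make the double integrand integrable:
    \<open>\<kappa>\<close> is an integrable kernel and \<open>\<rho>\<close> a bounded weight. For
    times in \<open>[0, T]\<close> neither truncation is felt, since \<open>R\<close> vanishes from
    \<open>T\<close> on.\<close>
  define \<kappa> where "\<kappa> x = indicator {..T} x * frac_kernel \<alpha> x" for x
  have [measurable]: "\<kappa> \<in> borel_measurable borel" unfolding \<kappa>_def by measurable
  define \<rho> where "\<rho> t = indicator {0..<T} t * R t" for t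
  have [measurable]: "\<rho> \<in> borel_measurable borel" unfolding \<rho>_def by measurable
  define C where "C = M * frac_kernel_prim (1 - \<alpha>) T"
  have \<rho>C: "\<bar>\<rho> t\<bar> \<le> C" for t
  proof (cases "t \<in> {0..<T}")
    case True
    have P: "has_bochner_integral lborel (\<lambda>x. M * (indicator {..T} x * frac_kernel (1 - \<alpha>) x)) C"
      unfolding C_def using has_integral_frac_kernel[of "1 - \<alpha>" T] \<alpha> by (intro has_bochner_integral_mult_right) simp
    have le: "norm (deriv \<psi> (t + x) * frac_kernel (1 - \<alpha>) x) \<le> M * (indicator {..T} x * frac_kernel (1 - \<alpha>) x)" for x
      using z'[of "t + x"] M(1)[of "t + x"] M(2) True b \<alpha>
      by (cases "x \<le> T") (auto simp: abs_mult intro!: mult_right_mono)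
    have gi: "integrable lborel (\<lambda>x. M * (indicator {..T} x * frac_kernel (1 - \<alpha>) x))"
      using P unfolding has_bochner_integral_iff ..
    have fi: "integrable lborel (\<lambda>x. deriv \<psi> (t + x) * frac_kernel (1 - \<alpha>) x)"
    proof (rule Bochner_Integration.integrable_bound[OF gi])
      show "AE x in lborel. norm (deriv \<psi> (t + x) * frac_kernel (1 - \<alpha>) x) \<le> norm (M * (indicator {..T} x * frac_kernel (1 - \<alpha>) x))"
        unfolding real_norm_def[of "M * _"] by (intro AE_I2 order_trans[OF le abs_ge_self])
    qed measurable
    have "norm (R t) \<le> C"
      unfolding R_def has_bochner_integral_integral_eq[OF P, symmetric]
      by (rule Bochner_Integration.integral_norm_bound_integral[OF fi gi le])
    then show ?thesis using True by (simp add: \<rho>_def)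
  qed (use M \<alpha> in \<open>simp add: \<rho>_def C_def\<close>)
  have k: "integrable lborel \<kappa>" using has_integral_frac_kernel[OF \<alpha>(1), of T] unfolding \<kappa>_def by (simp add: has_bochner_integral_iff)
  have H: "integrable (lborel \<Otimes>\<^sub>M lborel) (\<lambda>(t, s). (\<rho> t * \<kappa> (t - s)) *\<^sub>R v s)"
  proof (rule Bochner_Integration.integrable_bound)
    show "integrable (lborel \<Otimes>\<^sub>M lborel) (\<lambda>p. C * norm (case p of (t, s) \<Rightarrow> \<kappa> (t - s) *\<^sub>R v s))"
      using convolution_L1(1)[OF k v] by (intro integrable_mult_right integrable_norm)
    show "AE p in lborel \<Otimes>\<^sub>M lborel. norm (case p of (t, s) \<Rightarrow> (\<rho> t * \<kappa> (t - s)) *\<^sub>R v s) \<le> norm (C * norm (case p of (t, s) \<Rightarrow> \<kappa> (t - s) *\<^sub>R v s))"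
    proof (intro AE_I2)
      fix p :: "real \<times> real"
      obtain t s where p: "p = (t, s)" by (cases p)
      have "\<bar>\<rho> t\<bar> * (\<bar>\<kappa> (t - s)\<bar> * norm (v s)) \<le> \<bar>C\<bar> * (\<bar>\<kappa> (t - s)\<bar> * norm (v s))"
        using order_trans[OF \<rho>C abs_ge_self] by (intro mult_right_mono) auto
      then show "norm (case p of (t, s) \<Rightarrow> (\<rho> t * \<kappa> (t - s)) *\<^sub>R v s) \<le> norm (C * norm (case p of (t, s) \<Rightarrow> \<kappa> (t - s) *\<^sub>R v s))"
        by (simp add: p abs_mult mult.assoc)
    qed
  qed measurable
  have inner1: "(LBINT s. (\<rho> t * \<kappa> (t - s)) *\<^sub>R v s) = \<rho> t *\<^sub>R frac_conv \<alpha> v t" for t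
  proof (cases "t \<in> {0..<T}")
    case True
    have "(\<rho> t * \<kappa> (t - s)) *\<^sub>R v s = \<rho> t *\<^sub>R (frac_kernel \<alpha> (t - s) *\<^sub>R v s)" for s
      using True supp by (cases "s \<in> {0..T}") (auto simp: \<kappa>_def indicator_def)
    then show ?thesis unfolding frac_conv_def by (simp only: integral_scaleR_right)
  qed (simp add: \<rho>_def)
  have inner2: "(LBINT t. (\<rho> t * \<kappa> (t - s)) *\<^sub>R v s) = - (\<psi> s *\<^sub>R v s)" for s
  proof (cases "s \<in> {0..T}")
    case True
    have e: "\<rho> t * \<kappa> (t - s) = R t * frac_kernel \<alpha> (t - s)" for t
    proof -
      consider "t \<le> s" | "s < t" "t < T" | "T \<le> t" by linarith
      then show ?thesis by cases (use True R0 in \<open>auto simp: \<rho>_def \<kappa>_def\<close>)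
    qed
    have ki: "integrable lborel (\<lambda>t. C * \<kappa> (t - s))"
      using lborel_integrable_real_affine[OF k, of 1 "- s"] by (intro integrable_mult_right) simp
    have "integrable lborel (\<lambda>t. \<rho> t * \<kappa> (t - s))"
    proof (rule Bochner_Integration.integrable_bound[OF ki])
      show "AE t in lborel. norm (\<rho> t * \<kappa> (t - s)) \<le> norm (C * \<kappa> (t - s))"
        unfolding real_norm_def abs_mult by (intro AE_I2 mult_right_mono order_trans[OF \<rho>C abs_ge_self] abs_ge_zero)
    qed measurable
    then have "(LBINT t. (\<rho> t * \<kappa> (t - s)) *\<^sub>R v s) = (LBINT t. \<rho> t * \<kappa> (t - s)) *\<^sub>R v s"
      by (rule integral_scaleR_left)
    also have "(LBINT t. \<rho> t * \<kappa> (t - s)) = (LBINT t. R t * frac_kernel \<alpha> (t - s))" unfolding e ..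
    also have "(LBINT t. R t * frac_kernel \<alpha> (t - s)) = - \<psi> s"
      unfolding R_def by (rule test_function_double_fractional_integral[OF \<alpha> D c z z'])
    finally show ?thesis by simp
  qed (use supp in simp)
  have "caputo \<alpha> T u0 u \<psi> = (LINT t|lebesgue. - (\<rho> t *\<^sub>R frac_conv \<alpha> v t))"
    unfolding caputo_def distr_conv_def set_lebesgue_integral_def g_neg_shift[where \<alpha> = \<alpha>, OF D \<open>deriv \<psi> \<in> borel_measurable borel\<close>] R_def[symmetric]
  proof (rule Bochner_Integration.integral_cong[OF refl])
    fix t :: real
    show "indicator {..<T} t *\<^sub>R - R t *\<^sub>R heaviside t *\<^sub>R (u t - u0) = - (\<rho> t *\<^sub>R frac_conv \<alpha> v t)"
      using u[of t] by (auto simp: indicator_def heaviside_def \<rho>_def)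
  qed
  also have "\<dots> = (LBINT t. - (\<rho> t *\<^sub>R frac_conv \<alpha> v t))"
    by (rule integral_completion) (unfold frac_conv_def, measurable)
  also have "\<dots> = - (LBINT t. LBINT s. (\<rho> t * \<kappa> (t - s)) *\<^sub>R v s)"
    unfolding inner1 by simp
  also have "(LBINT t. LBINT s. (\<rho> t * \<kappa> (t - s)) *\<^sub>R v s) = (LBINT s. LBINT t. (\<rho> t * \<kappa> (t - s)) *\<^sub>R v s)"
    using lborel_pair.Fubini_integral[OF H] by simp
  also have "- \<dots> = (LBINT s. \<psi> s *\<^sub>R v s)"
    unfolding inner2 by simp
  also have "\<dots> = (LINT s|lebesgue. \<psi> s *\<^sub>R v s)"
    by (rule integral_completion[symmetric]) measurable
  also have "\<dots> = (LINT t:{0..<T}|lebesgue. \<psi> t *\<^sub>R v t)"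
    unfolding set_lebesgue_integral_def
    by (rule Bochner_Integration.integral_cong) (use supp z b in \<open>auto simp: indicator_def\<close>)
  finally show "caputo \<alpha> T u0 u \<psi> = (LINT t:{0..<T}|lebesgue. \<psi> t *\<^sub>R v t)" .
qed

section \<open>From the distributional derivative back to the Volterra equation\<close>

lemma flat_powr_derivative_bound:
  assumes "0 < e" "0 < \<alpha>"
  shows "\<bar>(- \<alpha>) * flat_powr (\<alpha> - 1) e b t + (- e) * flat_powr (\<alpha> - 2) e b t\<bar> \<le> (\<alpha> + 1) * Gamma \<alpha> * frac_kernel \<alpha> (b - t)"
proof (cases "t < b")
  case True
  define x where "x = b - t"
  have x: "0 < x" using True by (simp add: x_def)
  have G: "0 < Gamma \<alpha>" using assms by (intro Gamma_real_pos)
  \<comment> \<open>The boundedness of \<open>y * exp (- y)\<close> absorbs the extra factor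
    \<open>e / x\<close>, so the majorant is independent of \<open>e\<close> and serves in dominated
    convergence as \<open>e\<close> tends to 0.\<close>
  have "e / x * exp (- (e / x)) \<le> 1"
  proof -
    have "e / x \<le> exp (e / x)" using exp_ge_add_one_self[of "e / x"] by linarith
    from mult_right_mono[OF this, of "exp (- (e / x))"] show ?thesis by (simp add: exp_minus_inverse)
  qed
  then have "x powr (\<alpha> - 1) * (e / x * exp (- (e / x))) \<le> x powr (\<alpha> - 1) * 1" by (intro mult_left_mono) auto
  moreover have "e * (x powr (\<alpha> - 2) * exp (- e / x)) = x powr (\<alpha> - 1) * (e / x * exp (- (e / x)))"
  proof -
    have "x powr (\<alpha> - 1) = x powr (\<alpha> - 2) * x" using x powr_mult_base[of x "\<alpha> - 2"] by (simp add: mult.commute)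
    then show ?thesis using x by simp
  qed
  moreover have "\<alpha> * (x powr (\<alpha> - 1) * exp (- e / x)) \<le> \<alpha> * (x powr (\<alpha> - 1) * 1)"
    using assms x by (intro mult_left_mono) auto
  moreover have "0 \<le> \<alpha> * (x powr (\<alpha> - 1) * exp (- e / x))" "0 \<le> e * (x powr (\<alpha> - 2) * exp (- e / x))"
    using assms by auto
  moreover have "(\<alpha> + 1) * Gamma \<alpha> * frac_kernel \<alpha> x = \<alpha> * x powr (\<alpha> - 1) + x powr (\<alpha> - 1)"
    using x G by (simp add: frac_kernel_def field_simps)
  ultimately show ?thesis using True unfolding flat_powr_def x_def[symmetric] by simp
qed (use assms in \<open>simp add: flat_powr_def\<close>)

lemma flat_powr_tendsto:
  assumes "t < b"
  shows "(\<lambda>j. flat_powr r (1 / real (Suc j)) b t) \<longlonglongrightarrow> (b - t) powr r"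
proof -
  have "(\<lambda>j. (b - t) powr r * exp (- (1 / real (Suc j)) / (b - t))) \<longlonglongrightarrow> (b - t) powr r * exp (- 0 / (b - t))"
    using assms by (intro tendsto_intros LIMSEQ_Suc[OF lim_1_over_n]) auto
  then show ?thesis using assms by (simp add: flat_powr_def)
qed

lemma flat_powr_derivative_tendsto:
  assumes "0 < \<alpha>"
  shows "(\<lambda>j. (- \<alpha>) * flat_powr (\<alpha> - 1) (1 / real (Suc j)) b t + (- (1 / real (Suc j))) * flat_powr (\<alpha> - 2) (1 / real (Suc j)) b t)
    \<longlonglongrightarrow> - (Gamma (1 + \<alpha>) * frac_kernel \<alpha> (b - t))"
proof (cases "t < b")
  case True
  have "\<alpha> \<notin> \<int>\<^sub>\<le>\<^sub>0" using assms nonpos_Ints_nonpos[of \<alpha>] by auto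
  then have G: "Gamma (1 + \<alpha>) = \<alpha> * Gamma \<alpha>" using Gamma_plus1[of \<alpha>] by (simp add: add.commute)
  have "(\<lambda>j. (- \<alpha>) * flat_powr (\<alpha> - 1) (1 / real (Suc j)) b t + (- (1 / real (Suc j))) * flat_powr (\<alpha> - 2) (1 / real (Suc j)) b t)
    \<longlonglongrightarrow> (- \<alpha>) * (b - t) powr (\<alpha> - 1) + (- 0) * (b - t) powr (\<alpha> - 2)"
    by (intro tendsto_intros flat_powr_tendsto True LIMSEQ_Suc[OF lim_1_over_n])
  moreover have "Gamma \<alpha> \<noteq> 0" using Gamma_real_pos[OF assms] by simp
  ultimately show ?thesis using True by (simp add: G frac_kernel_def)
qed (simp add: flat_powr_def)

text \<open>Test functions tending to a multiple of \<open>(b - t) powr \<alpha>\<close> on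
  \<open>[0, b)\<close> are inserted into the definition. By the Beta identity their right-sided
  fractional derivative tends to a constant times the indicator of \<open>t < b\<close>, which
  leaves the Volterra equation integrated over \<open>[0, b]\<close>. The kernel that remains is the
  continuous primitive.\<close>

lemma caputo_derivative_imp_integrated:
  fixes u v :: "real \<Rightarrow> 'a::{banach, second_countable_topology}"
  assumes \<alpha>: "0 < \<alpha>" "\<alpha> < 1" and u: "L1_loc T u" and cap: "has_caputo_derivative \<alpha> T u0 u v"
    and b: "0 < b" "b < T"
  shows "(LINT t|lebesgue. indicator {0..<b} t *\<^sub>R (u t - u0))
    = (LINT t|lebesgue. frac_kernel_prim \<alpha> (b - t) *\<^sub>R (indicator {0..b} t *\<^sub>R v t))"
proof -
  obtain \<eta> :: "real \<Rightarrow> real" and c where \<eta>: "smooth_class \<eta>" "0 < c"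
    "\<And>t. t \<le> -1 \<Longrightarrow> \<eta> t = 0" "\<And>t. 0 \<le> t \<Longrightarrow> \<eta> t = c" "\<And>t. 0 \<le> t \<Longrightarrow> (\<eta> has_real_derivative 0) (at t)"
    using smooth_cutoff by metis
  define e where "e j = 1 / real (Suc j)" for j
  have e: "0 < e j" for j by (simp add: e_def)
  define \<psi> where "\<psi> j t = flat_powr \<alpha> (e j) b t * \<eta> t" for j t
  define d where "d j t = (- \<alpha>) * flat_powr (\<alpha> - 1) (e j) b t + (- e j) * flat_powr (\<alpha> - 2) (e j) b t" for j t
  have G: "0 < Gamma (1 + \<alpha>)" "0 < Gamma \<alpha>" using \<alpha> by (auto intro: Gamma_real_pos)
  have sm: "smooth_class (\<psi> j)" for j unfolding \<psi>_def by (rule smooth_class.mult[OF smooth_class.flat[OF e] \<eta>(1)])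
  have test: "\<psi> j \<in> test_functions T" for j
  proof -
    have "{t. \<psi> j t \<noteq> 0} \<subseteq> {-1..b}"
    proof
      fix t assume t: "t \<in> {t. \<psi> j t \<noteq> 0}"
      have "\<not> t \<le> -1" using t \<eta>(3)[of t] by (auto simp: \<psi>_def)
      moreover have "t < b" using t by (auto simp: \<psi>_def flat_powr_def split: if_splits)
      ultimately show "t \<in> {-1..b}" by simp
    qed
    then have "closure {t. \<psi> j t \<noteq> 0} \<subseteq> {-1..b}" "bounded {t. \<psi> j t \<noteq> 0}"
      by (simp_all add: closure_minimal bounded_subset[OF bounded_closed_interval])
    moreover have "{-1..b} \<subseteq> {..<T}" using b by auto
    ultimately show ?thesis using smooth_class_differentiable[OF sm] unfolding test_functions_def compact_closure by blast
  qed
  have D: "(\<psi> j has_real_derivative deriv (\<psi> j) t) (at t)" for j t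
    using smooth_class_DERIV[OF sm] by (metis DERIV_imp_deriv)
  have [measurable]: "deriv (\<psi> j) \<in> borel_measurable borel" for j
  proof -
    have "\<And>t. isCont (deriv (\<psi> j)) t" using smooth_class_DERIV[OF smooth_class_deriv[OF sm]] DERIV_isCont by blast
    then show ?thesis by (intro borel_measurable_continuous_onI continuous_at_imp_continuous_on) blast
  qed
  \<comment> \<open>For nonnegative times the cutoff is the constant \<open>c\<close>; its
    transition on \<open>[-1, 0]\<close> is invisible because \<open>u - u0\<close> is cut off
    there.\<close>
  have dpos: "deriv (\<psi> j) t = c * d j t" if "0 \<le> t" for j t
  proof -
    have "(\<psi> j has_real_derivative d j t * \<eta> t + 0 * flat_powr \<alpha> (e j) b t) (at t)"
      unfolding \<psi>_def d_def by (intro DERIV_mult flat_powr_DERIV e \<eta>(5) that)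
    then show ?thesis using \<eta>(4)[OF that] by (simp add: DERIV_imp_deriv mult.commute)
  qed
  define A where "A j t = (LBINT s. deriv (\<psi> j) (t + s) * frac_kernel (1 - \<alpha>) s)" for j t
  have [measurable]: "A j \<in> borel_measurable borel" for j unfolding A_def by measurable
  let ?C = "c * ((\<alpha> + 1) * Gamma \<alpha>)"
  have C0: "0 \<le> ?C" using \<eta>(2) \<alpha> G by simp
  have beta: "has_bochner_integral lborel (\<lambda>s. K * (frac_kernel \<alpha> (b - t - s) * frac_kernel (1 - \<alpha>) s)) (K * indicator {0<..} (b - t))" for K t
    using has_integral_frac_kernel_beta[OF \<alpha>, of "b - t"] by (rule has_bochner_integral_mult_right)
  have le: "norm (deriv (\<psi> j) (t + s) * frac_kernel (1 - \<alpha>) s) \<le> ?C * (frac_kernel \<alpha> (b - t - s) * frac_kernel (1 - \<alpha>) s)"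
    if "0 \<le> t" for j t s
  proof (cases "0 < s")
    case True
    have "\<bar>deriv (\<psi> j) (t + s)\<bar> \<le> c * ((\<alpha> + 1) * Gamma \<alpha> * frac_kernel \<alpha> (b - (t + s)))"
      using dpos[of "t + s" j] that True \<eta>(2) flat_powr_derivative_bound[OF e \<alpha>(1), of j b "t + s"]
      by (simp add: abs_mult d_def)
    from mult_right_mono[OF this, of "frac_kernel (1 - \<alpha>) s"] show ?thesis
      using \<alpha> by (simp add: abs_mult algebra_simps)
  qed simp
  have Aint: "integrable lborel (\<lambda>s. ?C * (frac_kernel \<alpha> (b - t - s) * frac_kernel (1 - \<alpha>) s))" for t
    using beta[of ?C t] by (simp only: has_bochner_integral_iff)
  have Abound: "\<bar>A j t\<bar> \<le> ?C * indicator {..<b} t" if t: "0 \<le> t" for j t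
  proof -
    have i: "integrable lborel (\<lambda>s. deriv (\<psi> j) (t + s) * frac_kernel (1 - \<alpha>) s)"
    proof (rule Bochner_Integration.integrable_bound[OF Aint[of t]])
      show "AE s in lborel. norm (deriv (\<psi> j) (t + s) * frac_kernel (1 - \<alpha>) s) \<le> norm (?C * (frac_kernel \<alpha> (b - t - s) * frac_kernel (1 - \<alpha>) s))"
        unfolding real_norm_def[of "?C * _"] by (intro AE_I2 order_trans[OF le[OF t] abs_ge_self])
    qed measurable
    have "norm (A j t) \<le> (LBINT s. ?C * (frac_kernel \<alpha> (b - t - s) * frac_kernel (1 - \<alpha>) s))"
      unfolding A_def by (rule Bochner_Integration.integral_norm_bound_integral[OF i Aint le[OF t]])
    also have "\<dots> = ?C * indicator {0<..} (b - t)" by (rule has_bochner_integral_integral_eq[OF beta])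
    finally show ?thesis by (simp add: indicator_def)
  qed
  \<comment> \<open>Pointwise the derivative tends to \<open>- c * Gamma (1 + \<alpha>)\<close>
    times the kernel of order \<open>\<alpha>\<close>, and the Beta identity evaluates the limit
    integral.\<close>
  have Alim: "(\<lambda>j. A j t) \<longlonglongrightarrow> - (c * Gamma (1 + \<alpha>)) * indicator {..<b} t" if t: "0 \<le> t" for t
  proof -
    have "(\<lambda>j. A j t) \<longlonglongrightarrow> (LBINT s. (- (c * Gamma (1 + \<alpha>))) * (frac_kernel \<alpha> (b - t - s) * frac_kernel (1 - \<alpha>) s))"
      unfolding A_def
    proof (rule integral_dominated_convergence[OF _ _ Aint[of t]])
      show "AE s in lborel. (\<lambda>j. deriv (\<psi> j) (t + s) * frac_kernel (1 - \<alpha>) s) \<longlonglongrightarrow> (- (c * Gamma (1 + \<alpha>))) * (frac_kernel \<alpha> (b - t - s) * frac_kernel (1 - \<alpha>) s)"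
      proof (rule AE_I2)
        fix s
        show "(\<lambda>j. deriv (\<psi> j) (t + s) * frac_kernel (1 - \<alpha>) s) \<longlonglongrightarrow> (- (c * Gamma (1 + \<alpha>))) * (frac_kernel \<alpha> (b - t - s) * frac_kernel (1 - \<alpha>) s)"
        proof (cases "0 < s")
          case True
          have "(\<lambda>j. d j (t + s)) \<longlonglongrightarrow> - (Gamma (1 + \<alpha>) * frac_kernel \<alpha> (b - (t + s)))"
            unfolding d_def e_def by (rule flat_powr_derivative_tendsto[OF \<alpha>(1)])
          then have "(\<lambda>j. c * d j (t + s) * frac_kernel (1 - \<alpha>) s) \<longlonglongrightarrow> c * (- (Gamma (1 + \<alpha>) * frac_kernel \<alpha> (b - (t + s)))) * frac_kernel (1 - \<alpha>) s"
            by (intro tendsto_intros)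
          then show ?thesis using True t by (simp add: dpos algebra_simps)
        qed simp
      qed
      show "AE s in lborel. norm (deriv (\<psi> j) (t + s) * frac_kernel (1 - \<alpha>) s) \<le> ?C * (frac_kernel \<alpha> (b - t - s) * frac_kernel (1 - \<alpha>) s)" for j
        by (intro AE_I2 le[OF t])
    qed measurable
    also have "(LBINT s. (- (c * Gamma (1 + \<alpha>))) * (frac_kernel \<alpha> (b - t - s) * frac_kernel (1 - \<alpha>) s)) = - (c * Gamma (1 + \<alpha>)) * indicator {0<..} (b - t)"
      by (rule has_bochner_integral_integral_eq[OF beta])
    finally show ?thesis by (simp add: indicator_def)
  qed
  define h where "h t = indicator {0..b} t *\<^sub>R (u t - u0)" for t
  define k where "k t = indicator {0..b} t *\<^sub>R v t" for t
  have hi: "integrable lebesgue h"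
  proof -
    have "integrable lebesgue (\<lambda>t. indicator {0..b} t *\<^sub>R u t)" using u b by (simp add: L1_loc_def set_integrable_def)
    moreover have "integrable lebesgue (\<lambda>t. indicator {0..b} t *\<^sub>R u0)" by (subst integrable_completion) (auto intro!: integrable_scaleR_left integrable_real_indicator simp: emeasure_lborel_Icc_eq)
    ultimately show ?thesis unfolding h_def scaleR_diff_right by (rule Bochner_Integration.integrable_diff)
  qed
  have ki: "integrable lebesgue k"
    unfolding k_def using cap b by (simp add: has_caputo_derivative_def L1_loc_def set_integrable_def)
  have Am: "A j \<in> borel_measurable lebesgue" for j by (simp add: measurable_completion)
  have eqj: "(LINT t|lebesgue. (- A j t) *\<^sub>R h t) = (LINT t|lebesgue. \<psi> j t *\<^sub>R k t)" for j
  proof -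
    have "caputo \<alpha> T u0 u (\<psi> j) = (LINT t|lebesgue. (- A j t) *\<^sub>R h t)"
      unfolding caputo_def distr_conv_def set_lebesgue_integral_def
        g_neg_shift[where \<alpha> = \<alpha>, OF D \<open>deriv (\<psi> j) \<in> borel_measurable borel\<close>] A_def[symmetric]
    proof (rule Bochner_Integration.integral_cong[OF refl])
      fix t :: real
      have "A j t = 0" if "b < t" using Abound[of t j] that b by simp
      then show "indicator {..<T} t *\<^sub>R - A j t *\<^sub>R heaviside t *\<^sub>R (u t - u0) = (- A j t) *\<^sub>R h t"
        using b by (auto simp: indicator_def heaviside_def h_def)
    qed
    moreover have "(LINT t:{0..<T}|lebesgue. \<psi> j t *\<^sub>R v t) = (LINT t|lebesgue. \<psi> j t *\<^sub>R k t)"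
      unfolding set_lebesgue_integral_def
    proof (rule Bochner_Integration.integral_cong[OF refl])
      fix t :: real
      have "\<psi> j t = 0" if "b < t" using that by (simp add: \<psi>_def flat_powr_def)
      then show "indicator {0..<T} t *\<^sub>R \<psi> j t *\<^sub>R v t = \<psi> j t *\<^sub>R k t"
        using b by (auto simp: indicator_def k_def)
    qed
    ultimately show ?thesis using cap test[of j] by (simp add: has_caputo_derivative_def)
  qed
  have L: "(\<lambda>j. LINT t|lebesgue. (- A j t) *\<^sub>R h t) \<longlonglongrightarrow> (LINT t|lebesgue. (c * Gamma (1 + \<alpha>)) *\<^sub>R (indicator {0..<b} t *\<^sub>R (u t - u0)))"
  proof (rule integral_dominated_convergence[where w = "\<lambda>t. ?C * norm (h t)"])
    have "(\<lambda>t. (c * Gamma (1 + \<alpha>)) *\<^sub>R (indicator {0..<b} t *\<^sub>R (u t - u0))) = (\<lambda>t. (c * Gamma (1 + \<alpha>)) *\<^sub>R (indicator {0..<b} t *\<^sub>R h t))"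
      by (auto simp: h_def indicator_def fun_eq_iff)
    moreover have "(\<lambda>t. (c * Gamma (1 + \<alpha>)) *\<^sub>R (indicator {0..<b} t *\<^sub>R h t)) \<in> borel_measurable lebesgue"
      by (intro borel_measurable_scaleR borel_measurable_const borel_measurable_indicator borel_measurable_integrable[OF hi]) simp
    ultimately show "(\<lambda>t. (c * Gamma (1 + \<alpha>)) *\<^sub>R (indicator {0..<b} t *\<^sub>R (u t - u0))) \<in> borel_measurable lebesgue" by simp
    show "(\<lambda>t. (- A j t) *\<^sub>R h t) \<in> borel_measurable lebesgue" for j
      by (intro borel_measurable_scaleR borel_measurable_uminus Am borel_measurable_integrable[OF hi])
    show "integrable lebesgue (\<lambda>t. ?C * norm (h t))" using hi by (intro integrable_mult_right integrable_norm)
    show "AE t in lebesgue. (\<lambda>j. (- A j t) *\<^sub>R h t) \<longlonglongrightarrow> (c * Gamma (1 + \<alpha>)) *\<^sub>R (indicator {0..<b} t *\<^sub>R (u t - u0))"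
    proof (rule AE_I2)
      fix t
      show "(\<lambda>j. (- A j t) *\<^sub>R h t) \<longlonglongrightarrow> (c * Gamma (1 + \<alpha>)) *\<^sub>R (indicator {0..<b} t *\<^sub>R (u t - u0))"
      proof (cases "t \<in> {0..b}")
        case True
        then have "(\<lambda>j. (- A j t) *\<^sub>R h t) \<longlonglongrightarrow> (- (- (c * Gamma (1 + \<alpha>)) * indicator {..<b} t)) *\<^sub>R h t"
          by (intro tendsto_intros Alim) simp
        then show ?thesis using True by (auto simp: h_def indicator_def split: if_splits)
      qed (auto simp: h_def indicator_def)
    qed
    show "AE t in lebesgue. norm ((- A j t) *\<^sub>R h t) \<le> ?C * norm (h t)" for j
    proof (rule AE_I2)
      fix t
      show "norm ((- A j t) *\<^sub>R h t) \<le> ?C * norm (h t)"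
      proof (cases "t \<in> {0..b}")
        case True
        have "\<bar>A j t\<bar> \<le> ?C * 1"
          using True by (intro order_trans[OF Abound mult_left_mono[OF _ C0]]) (auto simp: indicator_def)
        then show ?thesis by (simp add: mult_right_mono)
      qed (simp add: h_def)
    qed
  qed
  have R: "(\<lambda>j. LINT t|lebesgue. \<psi> j t *\<^sub>R k t) \<longlonglongrightarrow> (LINT t|lebesgue. (c * Gamma (1 + \<alpha>)) *\<^sub>R (frac_kernel_prim \<alpha> (b - t) *\<^sub>R k t))"
  proof (rule integral_dominated_convergence[where w = "\<lambda>t. (c * b powr \<alpha>) * norm (k t)"])
    have [measurable]: "frac_kernel_prim \<alpha> \<in> borel_measurable borel"
      by (rule borel_measurable_continuous_onI[OF frac_kernel_prim_continuous[OF \<alpha>(1)]])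
    have "(\<lambda>t. frac_kernel_prim \<alpha> (b - t)) \<in> borel_measurable lebesgue" by (simp add: measurable_completion)
    then show "(\<lambda>t. (c * Gamma (1 + \<alpha>)) *\<^sub>R (frac_kernel_prim \<alpha> (b - t) *\<^sub>R k t)) \<in> borel_measurable lebesgue"
      by (intro borel_measurable_scaleR borel_measurable_const borel_measurable_integrable[OF ki])
    have "\<psi> j \<in> borel_measurable borel" for j
      by (intro borel_measurable_continuous_onI continuous_at_imp_continuous_on ballI DERIV_isCont[OF D])
    then have "\<psi> j \<in> borel_measurable lebesgue" for j by (simp add: measurable_completion)
    then show "(\<lambda>t. \<psi> j t *\<^sub>R k t) \<in> borel_measurable lebesgue" for j
      by (intro borel_measurable_scaleR borel_measurable_integrable[OF ki])
    show "integrable lebesgue (\<lambda>t. (c * b powr \<alpha>) * norm (k t))" using ki by (intro integrable_mult_right integrable_norm)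
    show "AE t in lebesgue. (\<lambda>j. \<psi> j t *\<^sub>R k t) \<longlonglongrightarrow> (c * Gamma (1 + \<alpha>)) *\<^sub>R (frac_kernel_prim \<alpha> (b - t) *\<^sub>R k t)"
    proof (rule AE_I2)
      fix t
      consider "t \<notin> {0..b}" | "0 \<le> t" "t < b" | "t = b" by force
      then show "(\<lambda>j. \<psi> j t *\<^sub>R k t) \<longlonglongrightarrow> (c * Gamma (1 + \<alpha>)) *\<^sub>R (frac_kernel_prim \<alpha> (b - t) *\<^sub>R k t)"
      proof cases
        case 2
        have "(\<lambda>j. (flat_powr \<alpha> (e j) b t * c) *\<^sub>R k t) \<longlonglongrightarrow> ((b - t) powr \<alpha> * c) *\<^sub>R k t"
          unfolding e_def by (intro tendsto_intros flat_powr_tendsto 2)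
        then show ?thesis using 2 G \<eta>(4)[of t] by (simp add: \<psi>_def frac_kernel_prim_def mult_ac)
      qed (use \<alpha> in \<open>auto simp: k_def \<psi>_def flat_powr_def\<close>)
    qed
    show "AE t in lebesgue. norm (\<psi> j t *\<^sub>R k t) \<le> (c * b powr \<alpha>) * norm (k t)" for j
    proof (rule AE_I2)
      fix t
      show "norm (\<psi> j t *\<^sub>R k t) \<le> (c * b powr \<alpha>) * norm (k t)"
      proof (cases "t \<in> {0..b}")
        case True
        have "(b - t) powr \<alpha> * exp (- e j / (b - t)) \<le> b powr \<alpha> * 1" if "t < b"
          using True that e[of j] \<alpha> by (intro mult_mono powr_mono2) auto
        then have "flat_powr \<alpha> (e j) b t \<le> b powr \<alpha>" "0 \<le> flat_powr \<alpha> (e j) b t"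
          by (auto simp: flat_powr_def)
        then have "\<bar>\<psi> j t\<bar> \<le> c * b powr \<alpha>"
          using True \<eta>(2) \<eta>(4)[of t] by (simp add: \<psi>_def abs_mult mult.commute)
        then show ?thesis by (simp add: mult_right_mono)
      qed (simp add: k_def)
    qed
  qed
  \<comment> \<open>Both limits carry the same positive factor, so neither the cutoff constant nor
    the Gamma value survives.\<close>
  have "(c * Gamma (1 + \<alpha>)) *\<^sub>R (LINT t|lebesgue. indicator {0..<b} t *\<^sub>R (u t - u0)) = (c * Gamma (1 + \<alpha>)) *\<^sub>R (LINT t|lebesgue. frac_kernel_prim \<alpha> (b - t) *\<^sub>R k t)"
    using LIMSEQ_unique[OF L R[folded eqj]] by (simp only: integral_scaleR_right)
  then show ?thesis using \<eta>(2) G by (simp add: k_def)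
qed


text \<open>The integrated equation at every end point \<open>c \<le> B\<close> says that
  \<open>u - u0\<close> and the fractional integral of \<open>v\<close> have the same primitive;
  hence they agree almost everywhere. Restricting to \<open>[0, B]\<close> with \<open>B < T\<close>
  turns local into global integrability.\<close>

lemma caputo_derivative_imp_volterra:
  fixes u v :: "real \<Rightarrow> 'a::{banach, second_countable_topology}"
  assumes \<alpha>: "0 < \<alpha>" "\<alpha> < 1" and u: "L1_loc T u" and cap: "has_caputo_derivative \<alpha> T u0 u v"
    and B: "0 < B" "B < T"
  obtains f where "integrable lborel f" "\<forall>s. s \<notin> {0..B} \<longrightarrow> f s = 0"
    "AE s in lborel. s \<in> {0..B} \<longrightarrow> f s = v s" "AE t in lborel. t \<in> {0..B} \<longrightarrow> u t - u0 = frac_conv \<alpha> f t"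
proof -
  define h where "h t = indicator {0..B} t *\<^sub>R (u t - u0)" for t
  define k where "k t = indicator {0..B} t *\<^sub>R v t" for t
  have hi: "integrable lebesgue h"
  proof -
    have "integrable lebesgue (\<lambda>t. indicator {0..B} t *\<^sub>R u t)" using u B by (simp add: L1_loc_def set_integrable_def)
    moreover have "integrable lebesgue (\<lambda>t. indicator {0..B} t *\<^sub>R u0)" by (subst integrable_completion) (auto intro!: integrable_scaleR_left integrable_real_indicator simp: emeasure_lborel_Icc_eq)
    ultimately show ?thesis unfolding h_def scaleR_diff_right by (rule Bochner_Integration.integrable_diff)
  qed
  have ki: "integrable lebesgue k"
    unfolding k_def using cap B by (simp add: has_caputo_derivative_def L1_loc_def set_integrable_def)
  obtain H0 where H0: "integrable lborel H0" "AE x in lborel. h x = H0 x" by (rule lebesgue_integrable_borel_version[OF hi])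
  obtain F0 where F0: "integrable lborel F0" "AE x in lborel. k x = F0 x" by (rule lebesgue_integrable_borel_version[OF ki])
  define H where "H t = indicator {0..B} t *\<^sub>R H0 t" for t
  define f where "f t = indicator {0..B} t *\<^sub>R F0 t" for t
  have Hi: "integrable lborel H" unfolding H_def using H0 by (intro integrable_mult_indicator) auto
  have fi: "integrable lborel f" unfolding f_def using F0 by (intro integrable_mult_indicator) auto
  have fs: "\<forall>s. s \<notin> {0..B} \<longrightarrow> f s = 0" by (simp add: f_def)
  note [measurable] = borel_measurable_integrable[OF Hi] borel_measurable_integrable[OF fi]
  have hH: "AE t in lborel. h t = H t" using H0(2) by eventually_elim (auto simp: H_def h_def indicator_def)
  have kf: "AE t in lborel. k t = f t" using F0(2) by eventually_elim (auto simp: f_def k_def indicator_def)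
  define w where "w t = indicator {0..B} t *\<^sub>R frac_conv \<alpha> f t" for t
  have wi: "integrable lborel w" unfolding w_def by (rule frac_conv_L1(1)[OF \<alpha>(1) fi fs])
  have [measurable]: "frac_kernel_prim \<alpha> \<in> borel_measurable borel"
    by (rule borel_measurable_continuous_onI[OF frac_kernel_prim_continuous[OF \<alpha>(1)]])
  have claim1: "(LBINT t. indicator {..c} t *\<^sub>R H t) = (LBINT s. frac_kernel_prim \<alpha> (c - s) *\<^sub>R f s)"
    if c: "0 < c" "c \<le> B" for c
  proof -
    have Hm: "(\<lambda>t. indicator {..c} t *\<^sub>R H t) \<in> borel_measurable lborel" by measurable
    have fm: "(\<lambda>t. frac_kernel_prim \<alpha> (c - t) *\<^sub>R f t) \<in> borel_measurable lborel" by measurable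
    have "(LBINT t. indicator {..c} t *\<^sub>R H t) = (LINT t|lebesgue. indicator {..c} t *\<^sub>R H t)"
      by (rule integral_completion[OF Hm, symmetric])
    also have "\<dots> = (LINT t|lebesgue. indicator {0..<c} t *\<^sub>R h t)"
    proof (rule integral_cong_AE)
      show "(\<lambda>t. indicator {..c} t *\<^sub>R H t) \<in> borel_measurable lebesgue" using Hm by (rule measurable_completion)
      show "(\<lambda>t. indicator {0..<c} t *\<^sub>R h t) \<in> borel_measurable lebesgue"
        by (intro borel_measurable_scaleR borel_measurable_indicator borel_measurable_integrable[OF hi]) simp
      have "AE t in lborel. indicator {..c} t *\<^sub>R H t = indicator {0..<c} t *\<^sub>R h t"
        using hH AE_lborel_singleton[of c] by eventually_elim (auto simp: indicator_def h_def)
      then show "AE t in lebesgue. indicator {..c} t *\<^sub>R H t = indicator {0..<c} t *\<^sub>R h t" by (rule AE_completion)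
    qed
    also have "\<dots> = (LINT t|lebesgue. indicator {0..<c} t *\<^sub>R (u t - u0))"
      by (rule Bochner_Integration.integral_cong[OF refl]) (use c in \<open>auto simp: indicator_def h_def\<close>)
    also have "\<dots> = (LINT t|lebesgue. frac_kernel_prim \<alpha> (c - t) *\<^sub>R (indicator {0..c} t *\<^sub>R v t))"
      using c B by (intro caputo_derivative_imp_integrated[OF \<alpha> u cap]) auto
    also have "\<dots> = (LINT t|lebesgue. frac_kernel_prim \<alpha> (c - t) *\<^sub>R k t)"
    proof (rule Bochner_Integration.integral_cong[OF refl])
      fix t
      show "frac_kernel_prim \<alpha> (c - t) *\<^sub>R (indicator {0..c} t *\<^sub>R v t) = frac_kernel_prim \<alpha> (c - t) *\<^sub>R k t"
        using c \<alpha> by (cases "t \<le> c") (auto simp: indicator_def k_def)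
    qed
    also have "\<dots> = (LINT t|lebesgue. frac_kernel_prim \<alpha> (c - t) *\<^sub>R f t)"
    proof (rule integral_cong_AE)
      have "(\<lambda>t. frac_kernel_prim \<alpha> (c - t)) \<in> borel_measurable lebesgue" by (rule measurable_completion) measurable
      then show "(\<lambda>t. frac_kernel_prim \<alpha> (c - t) *\<^sub>R k t) \<in> borel_measurable lebesgue"
        by (intro borel_measurable_scaleR borel_measurable_integrable[OF ki])
      show "(\<lambda>t. frac_kernel_prim \<alpha> (c - t) *\<^sub>R f t) \<in> borel_measurable lebesgue" using fm by (rule measurable_completion)
      have "AE t in lborel. frac_kernel_prim \<alpha> (c - t) *\<^sub>R k t = frac_kernel_prim \<alpha> (c - t) *\<^sub>R f t"
        using kf by eventually_elim simp
      then show "AE t in lebesgue. frac_kernel_prim \<alpha> (c - t) *\<^sub>R k t = frac_kernel_prim \<alpha> (c - t) *\<^sub>R f t" by (rule AE_completion)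
    qed
    also have "\<dots> = (LBINT s. frac_kernel_prim \<alpha> (c - s) *\<^sub>R f s)" by (rule integral_completion[OF fm])
    finally show ?thesis .
  qed
  define \<kappa> where "\<kappa> x = indicator {..B} x * frac_kernel \<alpha> x" for x
  have [measurable]: "\<kappa> \<in> borel_measurable borel" unfolding \<kappa>_def by measurable
  have \<kappa>i: "integrable lborel \<kappa>" using has_integral_frac_kernel[OF \<alpha>(1), of B] unfolding \<kappa>_def has_bochner_integral_iff ..
  \<comment> \<open>By Fubini, integrating the fractional integral up to \<open>c\<close> replaces
    the kernel by its primitive, the same expression as in \<open>claim1\<close>.\<close>
  have claim2: "(LBINT t. indicator {..c} t *\<^sub>R w t) = (LBINT s. frac_kernel_prim \<alpha> (c - s) *\<^sub>R f s)"
    if c: "0 < c" "c \<le> B" for c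
  proof -
    have P: "integrable (lborel \<Otimes>\<^sub>M lborel) (\<lambda>(t, s). (indicator {0..c} t * \<kappa> (t - s)) *\<^sub>R f s)"
    proof (rule Bochner_Integration.integrable_bound[OF convolution_L1(1)[OF \<kappa>i fi]])
      show "AE p in lborel \<Otimes>\<^sub>M lborel. norm (case p of (t, s) \<Rightarrow> (indicator {0..c} t * \<kappa> (t - s)) *\<^sub>R f s) \<le> norm (case p of (t, s) \<Rightarrow> \<kappa> (t - s) *\<^sub>R f s)"
        by (intro AE_I2) (auto simp: indicator_def split: prod.splits)
    qed measurable
    have inner: "(LBINT t. (indicator {0..c} t * \<kappa> (t - s)) *\<^sub>R f s) = frac_kernel_prim \<alpha> (c - s) *\<^sub>R f s" for s
    proof (cases "s \<in> {0..B}")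
      case True
      have "has_bochner_integral lborel (\<lambda>t. indicator {..c - s} (- s + 1 * t) * frac_kernel \<alpha> (- s + 1 * t)) (frac_kernel_prim \<alpha> (c - s) /\<^sub>R \<bar>1\<bar>)"
        using has_integral_frac_kernel[OF \<alpha>(1), of "c - s"]
        by (subst lborel_has_bochner_integral_real_affine_iff[of 1 _ _ "- s", symmetric]) auto
      moreover have "(\<lambda>t. indicator {..c - s} (- s + 1 * t) * frac_kernel \<alpha> (- s + 1 * t)) = (\<lambda>t. indicator {0..c} t * \<kappa> (t - s))"
      proof
        fix t
        consider "t \<le> s" | "s < t" "t \<le> c" | "c < t" by linarith
        then show "indicator {..c - s} (- s + 1 * t) * frac_kernel \<alpha> (- s + 1 * t) = indicator {0..c} t * \<kappa> (t - s)"
          by cases (use True c in \<open>auto simp: \<kappa>_def indicator_def\<close>)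
      qed
      ultimately have "has_bochner_integral lborel (\<lambda>t. indicator {0..c} t * \<kappa> (t - s)) (frac_kernel_prim \<alpha> (c - s))" by simp
      from has_bochner_integral_scaleR_left[OF this, of "f s"] show ?thesis by (intro has_bochner_integral_integral_eq) auto
    qed (use fs in simp)
    have "indicator {..c} t *\<^sub>R w t = (LBINT s. (indicator {0..c} t * \<kappa> (t - s)) *\<^sub>R f s)" for t
    proof (cases "t \<in> {0..c}")
      case True
      have e: "(indicator {0..c} t * \<kappa> (t - s)) *\<^sub>R f s = frac_kernel \<alpha> (t - s) *\<^sub>R f s" for s
        using True c fs by (cases "s \<in> {0..B}") (auto simp: \<kappa>_def)
      show ?thesis unfolding e using True c by (simp add: w_def frac_conv_def)
    qed (auto simp: w_def indicator_def)
    then have "(LBINT t. indicator {..c} t *\<^sub>R w t) = (LBINT t. LBINT s. (indicator {0..c} t * \<kappa> (t - s)) *\<^sub>R f s)"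
      by (simp only:)
    also have "\<dots> = (LBINT s. LBINT t. (indicator {0..c} t * \<kappa> (t - s)) *\<^sub>R f s)"
      using lborel_pair.Fubini_integral[OF P] by simp
    also have "\<dots> = (LBINT s. frac_kernel_prim \<alpha> (c - s) *\<^sub>R f s)" unfolding inner ..
    finally show ?thesis .
  qed
  define d where "d t = H t - w t" for t
  have di: "integrable lborel d" unfolding d_def using Hi wi by (rule Bochner_Integration.integrable_diff)
  have dz: "(LBINT t. indicator {..c} t *\<^sub>R d t) = 0" if c: "0 < c" "c \<le> B" for c
  proof -
    have "integrable lborel (\<lambda>t. indicator {..c} t *\<^sub>R H t)" "integrable lborel (\<lambda>t. indicator {..c} t *\<^sub>R w t)"
      using Hi wi by (auto intro!: integrable_mult_indicator)
    then show ?thesis unfolding d_def scaleR_diff_right using claim1[OF c] claim2[OF c] by simp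
  qed
  have dB: "indicator {..c} t *\<^sub>R d t = d t" if "B \<le> c" for c t
    using that by (cases "t \<le> c") (auto simp: d_def H_def w_def)
  have "AE t in lborel. d t = 0"
  proof (rule AE_zero_if_integrals_atMost_zero[OF di])
    show tot: "(LBINT t. d t) = 0" using dz[of B] B dB[of B] by simp
    fix c :: real
    consider "c \<le> 0" | "0 < c" "c \<le> B" | "B < c" by linarith
    then show "(LINT t:{..c}|lborel. d t) = 0" unfolding set_lebesgue_integral_def
    proof cases
      case 1
      show "(LBINT t. indicator {..c} t *\<^sub>R d t) = 0"
      proof (rule integral_eq_zero_AE)
        show "AE t in lborel. indicator {..c} t *\<^sub>R d t = 0"
          using AE_lborel_singleton[of 0]
          by eventually_elim (use 1 in \<open>auto simp: d_def H_def w_def indicator_def\<close>)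
      qed
    next
      case 3
      then show "(LBINT t. indicator {..c} t *\<^sub>R d t) = 0" using tot dB[of c] by simp
    qed (rule dz)
  qed
  then have "AE t in lborel. t \<in> {0..B} \<longrightarrow> u t - u0 = frac_conv \<alpha> f t"
    using hH by eventually_elim (auto simp: d_def h_def w_def)
  moreover have "AE s in lborel. s \<in> {0..B} \<longrightarrow> f s = v s"
    using kf by eventually_elim (auto simp: k_def)
  ultimately show ?thesis using that fi fs by blast
qed

lemma strong_solution_unique:
  fixes \<phi> :: "'a::{real_inner, banach, second_countable_topology} \<Rightarrow> real"
  assumes \<alpha>: "0 < \<alpha>" "\<alpha> < 1" and conv: "convex_on UNIV \<phi>" and T: "0 < T"
    and u: "strong_solution \<alpha> \<phi> u0 T u" and w: "strong_solution \<alpha> \<phi> u0 T w"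
  shows "AE t in lebesgue. t \<in> {0..<T} \<longrightarrow> w t = u t"
proof -
  obtain v where uL: "L1_loc T u" and v: "has_caputo_derivative \<alpha> T u0 u v"
    and vs: "AE t in lebesgue. t \<in> {0..<T} \<longrightarrow> v t \<in> uminus ` frechet_subdiff \<phi> (u t)"
    using u by (auto simp: strong_solution_def)
  obtain v' where wL: "L1_loc T w" and v': "has_caputo_derivative \<alpha> T u0 w v'"
    and vs': "AE t in lebesgue. t \<in> {0..<T} \<longrightarrow> v' t \<in> uminus ` frechet_subdiff \<phi> (w t)"
    using w by (auto simp: strong_solution_def)
  \<comment> \<open>The derivatives are only locally integrable on \<open>[0, T)\<close>, so the
    comparison runs on \<open>[0, B]\<close> and \<open>B\<close> then increases to \<open>T\<close>
    along a sequence.\<close>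
  have "AE t in lborel. t \<in> {0..B} \<longrightarrow> w t = u t" if B: "0 < B" "B < T" for B
  proof -
    obtain f where f: "integrable lborel f" "\<forall>s. s \<notin> {0..B} \<longrightarrow> f s = 0"
      "AE s in lborel. s \<in> {0..B} \<longrightarrow> f s = v s" "AE t in lborel. t \<in> {0..B} \<longrightarrow> u t - u0 = frac_conv \<alpha> f t"
      by (rule caputo_derivative_imp_volterra[OF \<alpha> uL v B])
    obtain f' where f': "integrable lborel f'" "\<forall>s. s \<notin> {0..B} \<longrightarrow> f' s = 0"
      "AE s in lborel. s \<in> {0..B} \<longrightarrow> f' s = v' s" "AE t in lborel. t \<in> {0..B} \<longrightarrow> w t - u0 = frac_conv \<alpha> f' t"
      by (rule caputo_derivative_imp_volterra[OF \<alpha> wL v' B])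
    define F where "F s = f s - f' s" for s
    have F: "integrable lborel F" "\<forall>s. s \<notin> {0..B} \<longrightarrow> F s = 0"
      unfolding F_def using f(1,2) f'(1,2) by (simp_all add: Bochner_Integration.integrable_diff)
    have cF: "AE t in lborel. t \<in> {0..B} \<longrightarrow> frac_conv \<alpha> F t = u t - w t"
      using f(4) f'(4) frac_conv_diff_AE[OF \<alpha>(1) f(1,2) f'(1,2)]
      unfolding F_def by eventually_elim (auto simp: algebra_simps)
    \<comment> \<open>Monotonicity of the subdifferential, from adding the two subgradient
      inequalities at \<open>u s\<close> and \<open>w s\<close>. The factor 0 fits the comparison
      inequality with zero defect.\<close>
    have "AE s in lborel. s \<in> {0..B} \<longrightarrow> frac_conv \<alpha> F s \<bullet> F s \<le> 0 * norm (F s)"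
      using cF f(3) f'(3) vs[unfolded AE_completion_iff] vs'[unfolded AE_completion_iff]
    proof eventually_elim
      case (elim s)
      show ?case
      proof
        assume s: "s \<in> {0..B}"
        then have sT: "s \<in> {0..<T}" using B by auto
        obtain \<xi> where \<xi>: "v s = - \<xi>" "\<xi> \<in> frechet_subdiff \<phi> (u s)" using elim(4) sT by auto
        obtain \<xi>' where \<xi>': "v' s = - \<xi>'" "\<xi>' \<in> frechet_subdiff \<phi> (w s)" using elim(5) sT by auto
        have "\<phi> (u s) + \<xi> \<bullet> (w s - u s) \<le> \<phi> (w s)" using \<xi>(2) frechet_subdiff_convex[OF conv] by blast
        moreover have "\<phi> (w s) + \<xi>' \<bullet> (u s - w s) \<le> \<phi> (u s)" using \<xi>'(2) frechet_subdiff_convex[OF conv] by blast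
        moreover have "frac_conv \<alpha> F s \<bullet> F s = \<xi> \<bullet> (w s - u s) + \<xi>' \<bullet> (u s - w s)"
          using elim s \<xi> \<xi>' by (simp add: F_def inner_diff_left inner_diff_right inner_commute)
        ultimately show "frac_conv \<alpha> F s \<bullet> F s \<le> 0 * norm (F s)" by simp
      qed
    qed
    from frac_conv_energy_comparison[OF \<alpha> F order_refl this] cF
    show ?thesis by eventually_elim auto
  qed
  moreover have "0 < T - T / real (n + 2)" "T - T / real (n + 2) < T" for n using T by (auto simp: field_simps add_pos_nonneg)
  ultimately have "AE t in lborel. \<forall>n. t \<in> {0..T - T / real (n + 2)} \<longrightarrow> w t = u t"
    unfolding AE_all_countable by blast
  then have "AE t in lborel. t \<in> {0..<T} \<longrightarrow> w t = u t"
  proof eventually_elim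
    case (elim t)
    show ?case
    proof
      assume t: "t \<in> {0..<T}"
      have "(\<lambda>n. T - T * (1 / real (n + 2))) \<longlonglongrightarrow> T - T * 0"
        by (intro tendsto_intros LIMSEQ_ignore_initial_segment[OF lim_1_over_n])
      then have "\<forall>\<^sub>F n in sequentially. t < T - T * (1 / real (n + 2))" using t by (intro order_tendstoD) auto
      then obtain n where "t < T - T * (1 / real (n + 2))" using eventually_happens trivial_limit_sequentially by blast
      then show "w t = u t" using elim t by (auto intro: less_imp_le)
    qed
  qed
  then show ?thesis by (rule AE_completion)
qed

subsection \<open>Approximate flows\<close>

lemma AE_exists_in_interval:
  assumes "AE x in lborel. P (x::real)" "a < b"
  shows "\<exists>x\<in>{a<..<b}. P x"
proof (rule ccontr)
  assume n: "\<not> (\<exists>x\<in>{a<..<b}. P x)"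
  from assms(1) have "AE x in lborel. x \<notin> {a<..<b}" by eventually_elim (use n in blast)
  then have "{a<..<b} \<in> null_sets lborel" by (subst (asm) AE_iff_null_sets[symmetric]) auto
  then show False using assms(2) by (simp add: null_sets_def)
qed

text \<open>By continuity a violation would fill a whole relative neighbourhood, and a null set
  contains no interval.\<close>

lemma AE_le_continuous:
  fixes g :: "real \<Rightarrow> real"
  assumes ae: "AE t in lborel. t \<in> {0..T} \<longrightarrow> g t \<le> c" and g: "continuous_on {0..T} g" and T: "0 < T"
    and t: "t \<in> {0..T}"
  shows "g t \<le> c"
proof (rule ccontr)
  assume "\<not> g t \<le> c"
  then have "0 < g t - c" by simp
  then obtain d where d: "0 < d" "\<And>s. s \<in> {0..T} \<Longrightarrow> dist s t < d \<Longrightarrow> dist (g s) (g t) < g t - c"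
    using g t unfolding continuous_on_iff by metis
  have "max 0 (t - d) < min T (t + d)" using d T t by auto
  then obtain s where s: "s \<in> {max 0 (t - d)<..<min T (t + d)}" "s \<in> {0..T} \<longrightarrow> g s \<le> c"
    using AE_exists_in_interval[OF ae] by metis
  then have "s \<in> {0..T}" "dist s t < d" by (auto simp: dist_real_def)
  from d(2)[OF this] s this show False by (auto simp: dist_real_def)
qed

text \<open>By separability, closed balls are countable intersections of half-spaces.\<close>

lemma borel_measurable_weak:
  fixes f :: "'b \<Rightarrow> 'a::{real_inner, second_countable_topology}"
  assumes f: "\<And>y. (\<lambda>t. f t \<bullet> y) \<in> borel_measurable M"
  shows "f \<in> borel_measurable M"
proof -
  obtain D :: "'a set" where D: "countable D" "\<And>X. open X \<Longrightarrow> X \<noteq> {} \<Longrightarrow> \<exists>d\<in>D. d \<in> X"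
    using countable_dense_setE by blast
  have norm_le: "norm x \<le> r" if h: "\<And>d. d \<in> D \<Longrightarrow> x \<bullet> d \<le> r * norm d" and r: "0 \<le> r" for x :: 'a and r
  proof -
    have "x \<bullet> x \<le> r * norm x"
    proof (rule ccontr)
      assume "\<not> x \<bullet> x \<le> r * norm x"
      then have ne: "{y. r * norm y < x \<bullet> y} \<noteq> {}" by (auto simp: not_le)
      have "open {y. r * norm y < x \<bullet> y}" by (intro open_Collect_less continuous_intros)
      from D(2)[OF this ne] h show False by force
    qed
    then have "norm x * norm x \<le> r * norm x" by (simp add: power2_norm_eq_inner[symmetric] power2_eq_square)
    then show ?thesis using r by (cases "x = 0") auto
  qed
  have cb: "{t \<in> space M. f t \<in> cball z r} \<in> sets M" if r: "0 \<le> r" for z r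
  proof -
    have "f t \<in> cball z r \<longleftrightarrow> (\<forall>d\<in>D. f t \<bullet> d - z \<bullet> d \<le> r * norm d)" for t
    proof
      assume "f t \<in> cball z r"
      then have "norm (f t - z) \<le> r" by (simp add: dist_norm norm_minus_commute)
      then have "norm (f t - z) * norm d \<le> r * norm d" for d :: 'a by (intro mult_right_mono) auto
      then have "(f t - z) \<bullet> d \<le> r * norm d" for d by (meson norm_cauchy_schwarz order_trans)
      then show "\<forall>d\<in>D. f t \<bullet> d - z \<bullet> d \<le> r * norm d" by (simp add: inner_diff_left)
    next
      assume "\<forall>d\<in>D. f t \<bullet> d - z \<bullet> d \<le> r * norm d"
      then have "norm (f t - z) \<le> r" by (intro norm_le r) (simp add: inner_diff_left)
      then show "f t \<in> cball z r" by (simp add: dist_norm norm_minus_commute)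
    qed
    then have "{t \<in> space M. f t \<in> cball z r} = {t \<in> space M. \<forall>d\<in>D. f t \<bullet> d - z \<bullet> d \<le> r * norm d}" by simp
    moreover have "{t \<in> space M. \<forall>d\<in>D. f t \<bullet> d - z \<bullet> d \<le> r * norm d} \<in> sets M"
    proof (rule sets.sets_Collect_countable_All'[OF _ D(1)])
      fix d
      note [measurable] = f[of d]
      show "{t \<in> space M. f t \<bullet> d - z \<bullet> d \<le> r * norm d} \<in> sets M" by measurable
    qed
    ultimately show ?thesis by simp
  qed
  show ?thesis
  proof (rule borel_measurableI)
    fix S :: "'a set" assume S: "open S"
    define I where "I = {(d, q). d \<in> D \<and> q \<in> \<rat> \<and> 0 \<le> q \<and> cball d q \<subseteq> S}"
    have I: "countable I"
      by (rule countable_subset[of _ "D \<times> \<rat>"]) (auto simp: I_def D(1) countable_rat)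
    have "f -` S \<inter> space M = (\<Union>(d, q)\<in>I. {t \<in> space M. f t \<in> cball d q})"
    proof
      show "(\<Union>(d, q)\<in>I. {t \<in> space M. f t \<in> cball d q}) \<subseteq> f -` S \<inter> space M" by (auto simp: I_def)
      show "f -` S \<inter> space M \<subseteq> (\<Union>(d, q)\<in>I. {t \<in> space M. f t \<in> cball d q})"
      proof
        fix t assume t: "t \<in> f -` S \<inter> space M"
        then obtain e where e: "0 < e" "ball (f t) e \<subseteq> S" using S openE by blast
        have "ball (f t) (e / 3) \<noteq> {}" using e by simp
        then obtain d where d: "d \<in> D" "dist (f t) d < e / 3" using D(2)[of "ball (f t) (e / 3)"] by auto
        obtain q where q: "q \<in> \<rat>" "e / 3 < q" "q < e / 2"
          using Rats_dense_in_real[of "e / 3" "e / 2"] e by auto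
        have "cball d q \<subseteq> ball (f t) e"
        proof
          fix y assume "y \<in> cball d q"
          then show "y \<in> ball (f t) e" using d q dist_triangle[of "f t" y d] e by simp
        qed
        then have "(d, q) \<in> I" using d q e by (auto simp: I_def)
        moreover have "f t \<in> cball d q" using d q by (simp add: dist_commute)
        ultimately show "t \<in> (\<Union>(d, q)\<in>I. {t \<in> space M. f t \<in> cball d q})" using t by blast
      qed
    qed
    moreover have "(\<Union>(d, q)\<in>I. {t \<in> space M. f t \<in> cball d q}) \<in> sets M"
      by (rule sets.countable_UN'[OF I]) (use cb in \<open>auto simp: I_def\<close>)
    ultimately show "f -` S \<inter> space M \<in> sets M" by simp
  qed
qed

lemma frac_conv_inner:
  fixes f :: "real \<Rightarrow> 'a::{real_inner, banach, second_countable_topology}"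
  assumes "0 < \<beta>" "f \<in> borel_measurable lborel" "\<And>s. norm (f s) \<le> M" "\<And>s. s < 0 \<Longrightarrow> f s = 0"
  shows "frac_conv \<beta> (\<lambda>s. f s \<bullet> y) t = frac_conv \<beta> f t \<bullet> y"
  unfolding frac_conv_def
  by (subst integral_inner_left[symmetric]) (auto intro!: frac_conv_integrable(1)[OF assms])

lemma frac_conv_add_bounded:
  fixes f g :: "real \<Rightarrow> 'a::{banach, second_countable_topology}"
  assumes "0 < \<beta>" "f \<in> borel_measurable lborel" "\<And>s. norm (f s) \<le> M" "\<And>s. s < 0 \<Longrightarrow> f s = 0"
    "g \<in> borel_measurable lborel" "\<And>s. norm (g s) \<le> M'" "\<And>s. s < 0 \<Longrightarrow> g s = 0"
  shows "frac_conv \<beta> (\<lambda>s. f s + g s) t = frac_conv \<beta> f t + frac_conv \<beta> g t"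
    and "frac_conv \<beta> (\<lambda>s. f s - g s) t = frac_conv \<beta> f t - frac_conv \<beta> g t"
proof -
  note int = frac_conv_integrable(1)[OF assms(1-4)] frac_conv_integrable(1)[OF assms(1,5-7)]
  show "frac_conv \<beta> (\<lambda>s. f s + g s) t = frac_conv \<beta> f t + frac_conv \<beta> g t"
    unfolding frac_conv_def scaleR_add_right by (rule Bochner_Integration.integral_add[OF int])
  show "frac_conv \<beta> (\<lambda>s. f s - g s) t = frac_conv \<beta> f t - frac_conv \<beta> g t"
    unfolding frac_conv_def scaleR_diff_right by (rule Bochner_Integration.integral_diff[OF int])
qed

lemma frac_conv_mono_bounded:
  fixes f g :: "real \<Rightarrow> real"
  assumes "0 < \<beta>" "f \<in> borel_measurable lborel" "\<And>s. norm (f s) \<le> M" "\<And>s. s < 0 \<Longrightarrow> f s = 0"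
    "g \<in> borel_measurable lborel" "\<And>s. norm (g s) \<le> M'" "\<And>s. s < 0 \<Longrightarrow> g s = 0" "\<And>s. f s \<le> g s"
  shows "frac_conv \<beta> f t \<le> frac_conv \<beta> g t"
  unfolding frac_conv_def
  by (intro integral_mono frac_conv_integrable(1)[OF assms(1-4)] frac_conv_integrable(1)[OF assms(1,5-7)])
    (use assms in \<open>auto intro!: mult_left_mono\<close>)

text \<open>\<open>v\<close> is the Caputo derivative of the curve \<open>u0 + g\<^sub>\<alpha> * v\<close>, which solves the inclusion up to moving the
  base point of the subdifferential by \<open>\<epsilon>\<close>.\<close>

definition approximate_flow ::
  "real \<Rightarrow> ('a::{real_inner, banach, second_countable_topology} \<Rightarrow> real) \<Rightarrow> 'a \<Rightarrow> real \<Rightarrow> real \<Rightarrow> real \<Rightarrow> (real \<Rightarrow> 'a) \<Rightarrow> bool" where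
  "approximate_flow \<alpha> \<phi> u0 T E \<epsilon> v \<longleftrightarrow>
     v \<in> borel_measurable lborel \<and> (\<exists>M. \<forall>s. norm (v s) \<le> M) \<and> (\<forall>s. s \<notin> {0..T} \<longrightarrow> v s = 0) \<and>
     (\<forall>t\<in>{0..T}. frac_conv \<alpha> (\<lambda>s. (norm (v s))\<^sup>2) t \<le> E) \<and>
     (\<forall>t\<in>{0<..T}. \<exists>x. norm (u0 + frac_conv \<alpha> v t - x) \<le> \<epsilon> \<and> (\<forall>w. \<phi> x - v t \<bullet> (w - x) \<le> \<phi> w))"

lemma bounded_supported_integrable:
  fixes v :: "real \<Rightarrow> 'a::{banach, second_countable_topology}"
  assumes [measurable]: "v \<in> borel_measurable lborel" and "\<And>s. norm (v s) \<le> M" "\<forall>s. s \<notin> {0..T} \<longrightarrow> v s = 0"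
  shows "integrable lborel v"
proof (rule Bochner_Integration.integrable_bound)
  show "integrable lborel (\<lambda>s. M * indicator {0..T} s)"
    by (intro integrable_mult_right integrable_real_indicator) (auto simp: emeasure_lborel_Icc_eq)
  show "AE s in lborel. norm (v s) \<le> norm (M * indicator {0..T} s)"
    using assms(2,3) by (intro AE_I2) (auto simp: indicator_def intro: order_trans[OF _ abs_ge_self])
qed measurable

text \<open>From \<open>2 * norm v \<le> 1 + (norm v)^2\<close>; the constant 1 contributes the
  primitive of the kernel. It bounds the right-hand side of the comparison inequality by the
  energy.\<close>

lemma frac_conv_norm_le_energy:
  fixes v :: "real \<Rightarrow> 'a::{banach, second_countable_topology}"
  assumes \<alpha>: "0 < \<alpha>" and [measurable]: "v \<in> borel_measurable lborel" and M: "\<And>s. norm (v s) \<le> M"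
    and neg: "\<And>s. s < 0 \<Longrightarrow> v s = 0" and E: "frac_conv \<alpha> (\<lambda>s. (norm (v s))\<^sup>2) t \<le> E" and t: "t \<le> T"
  shows "frac_conv \<alpha> (\<lambda>s. norm (v s)) t \<le> (frac_kernel_prim \<alpha> T + E) / 2"
proof -
  let ?q = "\<lambda>s. indicator {0..} s / 2 + (norm (v s))\<^sup>2 / 2 :: real"
  have M0: "0 \<le> M" using M[of 0] norm_ge_zero order_trans by blast
  have v2: "(norm (v s))\<^sup>2 \<le> M\<^sup>2" for s using M[of s] by (intro power_mono) auto
  have a: "norm (v s) \<le> ?q s" for s
  proof (cases "s < 0")
    case False
    have "2 * norm (v s) * 1 \<le> (norm (v s))\<^sup>2 + 1\<^sup>2" by (rule sum_squares_bound)
    then show ?thesis using False by simp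
  qed (use neg in simp)
  have "frac_conv \<alpha> (\<lambda>s. norm (v s)) t \<le> frac_conv \<alpha> ?q t"
  proof (rule frac_conv_mono_bounded[where M = M and M' = "1 / 2 + M\<^sup>2 / 2"])
    show "norm (?q s) \<le> 1 / 2 + M\<^sup>2 / 2" for s using v2[of s] by (auto simp: indicator_def)
  qed (use \<alpha> M neg a in auto)
  also have "\<dots> = (LBINT s. (indicator {0..} s * frac_kernel \<alpha> (t - s)) / 2 + (frac_kernel \<alpha> (t - s) *\<^sub>R (norm (v s))\<^sup>2) / 2)"
    unfolding frac_conv_def by (intro Bochner_Integration.integral_cong) (auto simp: field_simps)
  also have "\<dots> = frac_kernel_prim \<alpha> t / 2 + frac_conv \<alpha> (\<lambda>s. (norm (v s))\<^sup>2) t / 2"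
  proof -
    have i: "integrable lborel (\<lambda>s. frac_kernel \<alpha> (t - s) *\<^sub>R (norm (v s))\<^sup>2)"
      by (rule frac_conv_integrable(1)[where M = "M\<^sup>2"]) (use \<alpha> v2 neg in auto)
    have k: "has_bochner_integral lborel (\<lambda>s. indicator {0..} s * frac_kernel \<alpha> (t - s)) (frac_kernel_prim \<alpha> t)"
      using has_integral_frac_kernel_reflect(1)[OF \<alpha>, of 0 t] by simp
    have "has_bochner_integral lborel (\<lambda>s. (indicator {0..} s * frac_kernel \<alpha> (t - s)) / 2 + (frac_kernel \<alpha> (t - s) *\<^sub>R (norm (v s))\<^sup>2) / 2)
       (frac_kernel_prim \<alpha> t / 2 + frac_conv \<alpha> (\<lambda>s. (norm (v s))\<^sup>2) t / 2)"
      unfolding frac_conv_def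
      by (intro has_bochner_integral_add has_bochner_integral_divide_zero k has_bochner_integral_integrable i)
    then show ?thesis by (rule has_bochner_integral_integral_eq)
  qed
  also have "\<dots> \<le> (frac_kernel_prim \<alpha> T + E) / 2"
    using E frac_kernel_prim_mono[OF \<alpha> t] by simp
  finally show ?thesis .
qed

lemma frac_conv_continuous:
  fixes f :: "real \<Rightarrow> 'a::{banach, second_countable_topology}"
  assumes \<beta>: "0 < \<beta>" "\<beta> \<le> 1" and f: "f \<in> borel_measurable lborel"
    and M: "\<And>s. norm (f s) \<le> M" and neg: "\<And>s. s < 0 \<Longrightarrow> f s = 0"
  shows "continuous_on {0..} (frac_conv \<beta> f)"
proof -
  have b: "norm (frac_conv \<beta> f s - frac_conv \<beta> f t) \<le> 2 * M * frac_kernel_prim \<beta> \<bar>s - t\<bar>" if "0 \<le> s" "0 \<le> t" for s t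
  proof (cases "s \<le> t")
    case True
    then show ?thesis using frac_conv_hoelder_bounded[OF \<beta> f M neg that(1) True] by (simp add: norm_minus_commute abs_minus_commute)
  next
    case False
    then show ?thesis using frac_conv_hoelder_bounded[OF \<beta> f M neg that(2), of s] by simp
  qed
  show ?thesis unfolding continuous_on_def
  proof
    fix t :: real assume t: "t \<in> {0..}"
    have "((\<lambda>s. frac_conv \<beta> f s - frac_conv \<beta> f t) \<longlongrightarrow> 0) (at t within {0..})"
    proof (rule Lim_null_comparison)
      show "\<forall>\<^sub>F s in at t within {0..}. norm (frac_conv \<beta> f s - frac_conv \<beta> f t) \<le> 2 * M * frac_kernel_prim \<beta> \<bar>s - t\<bar>"
        using b t by (auto simp: eventually_at intro!: exI[of _ 1])
      have "continuous_on UNIV (\<lambda>s. 2 * M * frac_kernel_prim \<beta> \<bar>s - t\<bar>)"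
        by (intro continuous_intros continuous_on_compose2[OF frac_kernel_prim_continuous[OF \<beta>(1)]]) auto
      then have "continuous_on {0..} (\<lambda>s. 2 * M * frac_kernel_prim \<beta> \<bar>s - t\<bar>)" by (rule continuous_on_subset) simp
      then have "((\<lambda>s. 2 * M * frac_kernel_prim \<beta> \<bar>s - t\<bar>) \<longlongrightarrow> 2 * M * frac_kernel_prim \<beta> \<bar>t - t\<bar>) (at t within {0..})"
        unfolding continuous_on_def using t by blast
      then show "((\<lambda>s. 2 * M * frac_kernel_prim \<beta> \<bar>s - t\<bar>) \<longlongrightarrow> 0) (at t within {0..})" using \<beta> by simp
    qed
    then show "(frac_conv \<beta> f \<longlongrightarrow> frac_conv \<beta> f t) (at t within {0..})" using LIM_zero_iff by blast
  qed
qed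

text \<open>The subgradients belong to shifted base points \<open>x\<close> and \<open>y\<close>,
  for which monotonicity gives a nonpositive pairing. The difference of the curves deviates from
  \<open>x - y\<close> by at most \<open>\<epsilon>1 + \<epsilon>2\<close>, which is the defect in
  the comparison inequality; the remaining factor is two energy bounds of half size. Continuity
  upgrades almost every time to every time.\<close>

lemma approximate_flow_comparison:
  fixes \<phi> :: "'a::{real_inner, banach, second_countable_topology} \<Rightarrow> real"
  assumes \<alpha>: "0 < \<alpha>" "\<alpha> < 1" and T: "0 < T"
    and a1: "approximate_flow \<alpha> \<phi> u0 T E \<epsilon>1 v1" and a2: "approximate_flow \<alpha> \<phi> u0 T E \<epsilon>2 v2"
    and \<epsilon>: "0 \<le> \<epsilon>1" "0 \<le> \<epsilon>2" and t: "t \<in> {0..T}"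
  shows "(norm (frac_conv \<alpha> v1 t - frac_conv \<alpha> v2 t))\<^sup>2 \<le> 2 * (\<epsilon>1 + \<epsilon>2) * (frac_kernel_prim \<alpha> T + E)"
proof -
  obtain M1 where v1 [measurable]: "v1 \<in> borel_measurable lborel" and M1: "\<And>s. norm (v1 s) \<le> M1"
    and s1: "\<forall>s. s \<notin> {0..T} \<longrightarrow> v1 s = 0" and E1: "\<And>t. t \<in> {0..T} \<Longrightarrow> frac_conv \<alpha> (\<lambda>s. (norm (v1 s))\<^sup>2) t \<le> E"
    and x1: "\<And>t. t \<in> {0<..T} \<Longrightarrow> \<exists>x. norm (u0 + frac_conv \<alpha> v1 t - x) \<le> \<epsilon>1 \<and> (\<forall>w. \<phi> x - v1 t \<bullet> (w - x) \<le> \<phi> w)"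
    using a1 unfolding approximate_flow_def by blast
  obtain M2 where v2 [measurable]: "v2 \<in> borel_measurable lborel" and M2: "\<And>s. norm (v2 s) \<le> M2"
    and s2: "\<forall>s. s \<notin> {0..T} \<longrightarrow> v2 s = 0" and E2: "\<And>t. t \<in> {0..T} \<Longrightarrow> frac_conv \<alpha> (\<lambda>s. (norm (v2 s))\<^sup>2) t \<le> E"
    and x2: "\<And>t. t \<in> {0<..T} \<Longrightarrow> \<exists>x. norm (u0 + frac_conv \<alpha> v2 t - x) \<le> \<epsilon>2 \<and> (\<forall>w. \<phi> x - v2 t \<bullet> (w - x) \<le> \<phi> w)"
    using a2 unfolding approximate_flow_def by blast
  have n1: "s < 0 \<Longrightarrow> v1 s = 0" and n2: "s < 0 \<Longrightarrow> v2 s = 0" for s using s1 s2 by auto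
  define f where "f s = v1 s - v2 s" for s
  have [measurable]: "f \<in> borel_measurable lborel" unfolding f_def by measurable
  have fM: "norm (f s) \<le> M1 + M2" for s
    unfolding f_def using M1[of s] M2[of s] norm_triangle_ineq4[of "v1 s" "v2 s"] by linarith
  have fs: "\<forall>s. s \<notin> {0..T} \<longrightarrow> f s = 0" using s1 s2 by (simp add: f_def)
  have fi: "integrable lborel f" by (rule bounded_supported_integrable[OF _ fM fs]) simp
  have cf: "frac_conv \<alpha> f r = frac_conv \<alpha> v1 r - frac_conv \<alpha> v2 r" for r
    unfolding f_def by (rule frac_conv_add_bounded(2)[OF \<alpha>(1) v1 M1 n1 v2 M2 n2])
  have "AE s in lborel. s \<in> {0..T} \<longrightarrow> frac_conv \<alpha> f s \<bullet> f s \<le> (\<epsilon>1 + \<epsilon>2) * norm (f s)"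
    using AE_lborel_singleton[of 0]
  proof eventually_elim
    case (elim s)
    show ?case
    proof
      assume "s \<in> {0..T}"
      then have s: "s \<in> {0<..T}" using elim by auto
      obtain x where x: "norm (u0 + frac_conv \<alpha> v1 s - x) \<le> \<epsilon>1" "\<And>w. \<phi> x - v1 s \<bullet> (w - x) \<le> \<phi> w" using x1[OF s] by blast
      obtain y where y: "norm (u0 + frac_conv \<alpha> v2 s - y) \<le> \<epsilon>2" "\<And>w. \<phi> y - v2 s \<bullet> (w - y) \<le> \<phi> w" using x2[OF s] by blast
      have "(x - y) \<bullet> f s \<le> 0"
        using x(2)[of y] y(2)[of x] by (simp add: f_def inner_diff_left inner_diff_right inner_commute)
      moreover have "((u0 + frac_conv \<alpha> v1 s - x) - (u0 + frac_conv \<alpha> v2 s - y)) \<bullet> f s \<le> (\<epsilon>1 + \<epsilon>2) * norm (f s)"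
      proof -
        have "norm ((u0 + frac_conv \<alpha> v1 s - x) - (u0 + frac_conv \<alpha> v2 s - y)) \<le> \<epsilon>1 + \<epsilon>2"
          using x(1) y(1) norm_triangle_ineq4[of "u0 + frac_conv \<alpha> v1 s - x" "u0 + frac_conv \<alpha> v2 s - y"] by linarith
        then show ?thesis by (meson norm_cauchy_schwarz mult_right_mono norm_ge_zero order_trans)
      qed
      moreover have "frac_conv \<alpha> f s = ((u0 + frac_conv \<alpha> v1 s - x) - (u0 + frac_conv \<alpha> v2 s - y)) + (x - y)"
        by (simp add: cf)
      ultimately show "frac_conv \<alpha> f s \<bullet> f s \<le> (\<epsilon>1 + \<epsilon>2) * norm (f s)" by (simp only: inner_add_left)
    qed
  qed
  from frac_conv_energy_comparison[OF \<alpha> fi fs _ this] \<epsilon>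
  have ae: "AE t in lborel. t \<in> {0..T} \<longrightarrow> (norm (frac_conv \<alpha> f t))\<^sup>2 \<le> 2 * (\<epsilon>1 + \<epsilon>2) * frac_conv \<alpha> (\<lambda>s. norm (f s)) t" by simp
  have fb: "frac_conv \<alpha> (\<lambda>s. norm (f s)) r \<le> frac_kernel_prim \<alpha> T + E" if r: "r \<in> {0..T}" for r
  proof -
    have "frac_conv \<alpha> (\<lambda>s. norm (f s)) r \<le> frac_conv \<alpha> (\<lambda>s. norm (v1 s) + norm (v2 s)) r"
    proof (rule frac_conv_mono_bounded[where M = "M1 + M2" and M' = "M1 + M2"])
      show "norm (f s) \<le> norm (v1 s) + norm (v2 s)" for s unfolding f_def by (rule norm_triangle_ineq4)
      show "norm (norm (v1 s) + norm (v2 s)) \<le> M1 + M2" for s using M1[of s] M2[of s] by simp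
    qed (use \<alpha> fM n1 n2 in \<open>auto simp: f_def\<close>)
    also have "\<dots> = frac_conv \<alpha> (\<lambda>s. norm (v1 s)) r + frac_conv \<alpha> (\<lambda>s. norm (v2 s)) r"
      by (rule frac_conv_add_bounded(1)[where M = M1 and M' = M2]) (use \<alpha> M1 M2 n1 n2 in auto)
    also have "\<dots> \<le> (frac_kernel_prim \<alpha> T + E) / 2 + (frac_kernel_prim \<alpha> T + E) / 2"
      using r by (intro add_mono frac_conv_norm_le_energy[OF \<alpha>(1) v1 M1 n1 E1] frac_conv_norm_le_energy[OF \<alpha>(1) v2 M2 n2 E2]) auto
    finally show ?thesis by simp
  qed
  have "AE t in lborel. t \<in> {0..T} \<longrightarrow> (norm (frac_conv \<alpha> f t))\<^sup>2 \<le> 2 * (\<epsilon>1 + \<epsilon>2) * (frac_kernel_prim \<alpha> T + E)"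
    using ae
  proof eventually_elim
    case (elim r)
    then show ?case using mult_left_mono[OF fb[of r], of "2 * (\<epsilon>1 + \<epsilon>2)"] \<epsilon> by auto
  qed
  moreover have "continuous_on {0..T} (\<lambda>t. (norm (frac_conv \<alpha> f t))\<^sup>2)"
    using \<alpha> fM fs by (intro continuous_intros continuous_on_subset[OF frac_conv_continuous[where M = "M1 + M2"]]) auto
  ultimately have "(norm (frac_conv \<alpha> f t))\<^sup>2 \<le> 2 * (\<epsilon>1 + \<epsilon>2) * (frac_kernel_prim \<alpha> T + E)"
    by (rule AE_le_continuous[OF _ _ T t])
  then show ?thesis by (simp only: cf)
qed

subsection \<open>Convergence of the scheme\<close>

text \<open>The chain inequality applied to \<phi> itself gives the energy bound
  \<open>\<phi> u0 - B\<close> at grid times, and the passage to all times doubles it to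
  \<open>E\<close>. The energy Hoelder estimate yields \<open>C\<close>, and the defect
  \<open>C * k powr (\<alpha>/2)\<close> is the distance travelled from \<open>t\<close> to the end
  of its cell.\<close>

lemma numerical_solution_approximate_flow:
  fixes \<phi> :: "'a::{real_inner, banach, second_countable_topology} \<Rightarrow> real"
  assumes \<alpha>: "0 < \<alpha>" "\<alpha> < 1" and conv: "convex_on UNIV \<phi>" and B: "\<And>x. B \<le> \<phi> x"
    and T: "0 < T" and N: "1 \<le> N" and k: "k = T / real N" and U: "numerical_solution \<alpha> \<phi> u0 k U"
  defines "E \<equiv> 2 * (\<phi> u0 - B)"
  defines "C \<equiv> 1 / Gamma (1 + \<alpha>) + E"
  obtains v where "approximate_flow \<alpha> \<phi> u0 T E (C * k powr (\<alpha> / 2)) v"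
    and "\<And>n. n \<le> N \<Longrightarrow> U n = u0 + frac_conv \<alpha> v (real n * k)"
    and "\<And>t t'. 0 \<le> t \<Longrightarrow> t \<le> t' \<Longrightarrow> t' \<le> T \<Longrightarrow>
      norm (frac_conv \<alpha> v t' - frac_conv \<alpha> v t) \<le> C * (t' - t) powr (\<alpha> / 2)"
proof -
  have k0: "0 < k" and NkT: "real N * k = T" using T N by (auto simp: k)
  have U0: "U 0 = u0" using U by (simp add: numerical_solution_def)
  obtain V where V0: "V 0 = 0"
    and VU: "\<And>n. U n - u0 = (\<Sum>j=0..n. coeff_a \<alpha> j *\<^sub>R (k powr \<alpha> *\<^sub>R V (n - j)))"
    and Vs: "\<And>n w. 1 \<le> n \<Longrightarrow> \<phi> (U n) - V n \<bullet> (w - U n) \<le> \<phi> w"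
    by (rule numerical_solution_subgradients[OF \<alpha>(1) conv k0 U]) blast
  define v where "v = step_fun k N V"
  have vm: "v \<in> borel_measurable lborel" unfolding v_def by measurable
  obtain M where M: "\<And>s. norm (v s) \<le> M" unfolding v_def using step_fun_bounded[OF k0] by metis
  have vs: "\<forall>s. s \<notin> {0..T} \<longrightarrow> v s = 0" by (auto simp: v_def step_fun_def NkT)
  have vneg: "s < 0 \<Longrightarrow> v s = 0" for s using vs by auto
  have Uv: "U n = u0 + frac_conv \<alpha> v (real n * k)" if "n \<le> N" for n
    unfolding v_def frac_conv_step_fun[where V = V, OF \<alpha>(1) k0 that V0] VU[symmetric] by simp
  define e where "e m = (norm (V m))\<^sup>2" for m
  have e: "(norm (v s))\<^sup>2 = step_fun k N e s" for s by (simp add: v_def e_def step_fun_def)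
  have grid: "frac_conv \<alpha> (step_fun k N e) (real n * k) \<le> \<phi> u0 - B" if n: "n \<le> N" for n
  proof -
    \<comment> \<open>The slope is \<open>- V\<close> and the discrete derivative is a multiple of
      \<open>V\<close>, so each summand is minus a squared norm: dissipation.\<close>
    have "\<phi> (U n) - \<phi> (U 0) \<le> (\<Sum>j=0..n. coeff_a \<alpha> j * ((- V (n - j)) \<bullet> (k powr \<alpha> *\<^sub>R V (n - j))))"
    proof (rule discrete_chain_inequality[OF \<alpha>])
      show "U n - U 0 = (\<Sum>j=0..n. coeff_a \<alpha> j *\<^sub>R (k powr \<alpha> *\<^sub>R V (n - j)))" for n using VU U0 by simp
      show "k powr \<alpha> *\<^sub>R V 0 = 0" using V0 by simp
      show "\<phi> (U n) + (- V n) \<bullet> (U m - U n) \<le> \<phi> (U m)" if "1 \<le> n" for n m using Vs[OF that, of "U m"] by simp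
    qed
    also have "\<dots> = - (\<Sum>j=0..n. coeff_a \<alpha> j *\<^sub>R (k powr \<alpha> *\<^sub>R e (n - j)))"
      by (simp add: e_def power2_norm_eq_inner sum_negf)
    also have "(\<Sum>j=0..n. coeff_a \<alpha> j *\<^sub>R (k powr \<alpha> *\<^sub>R e (n - j))) = frac_conv \<alpha> (step_fun k N e) (real n * k)"
      by (rule frac_conv_step_fun[symmetric]) (use \<alpha> k0 n V0 in \<open>auto simp: e_def\<close>)
    finally show ?thesis using B[of "U n"] U0 by simp
  qed
  have energy: "frac_conv \<alpha> (\<lambda>s. (norm (v s))\<^sup>2) t \<le> E" if "t \<in> {0..T}" for t
    unfolding e E_def
    by (rule frac_conv_step_fun_le_twice[OF \<alpha> k0 _ _ grid]) (use that NkT V0 in \<open>auto simp: e_def\<close>)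
  have hoelder: "norm (frac_conv \<alpha> v t' - frac_conv \<alpha> v t) \<le> C * (t' - t) powr (\<alpha> / 2)"
    if "0 \<le> t" "t \<le> t'" "t' \<le> T" for t t'
    unfolding C_def
    by (rule frac_conv_hoelder_energy[OF _ _ vm M vneg]) (use \<alpha> that energy in auto)
  have G: "0 < Gamma (1 + \<alpha>)" using \<alpha> by (intro Gamma_real_pos) auto
  have C0: "0 \<le> C" using B[of u0] G by (simp add: C_def E_def)
  \<comment> \<open>The base point is \<open>U n\<close> for the cell ending at \<open>n k\<close>,
    where \<open>v t = V n\<close>. Time 0 lies in no cell and is excluded.\<close>
  have "\<exists>x. norm (u0 + frac_conv \<alpha> v t - x) \<le> C * k powr (\<alpha> / 2) \<and> (\<forall>w. \<phi> x - v t \<bullet> (w - x) \<le> \<phi> w)" if t: "t \<in> {0<..T}" for t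
  proof -
    define n where "n = nat \<lceil>t / k\<rceil>"
    have "0 < t / k" "t / k \<le> real N" using t k0 NkT by (auto simp: field_simps)
    then have n: "1 \<le> n" "n \<le> N" by (auto simp: n_def ceiling_le_iff nat_le_iff Suc_le_eq)
    have tn: "(real n - 1) * k < t" "t \<le> real n * k"
      using grid_index_iff[OF k0 n(1), of t] t by (auto simp: n_def)
    have nT: "real n * k \<le> T" using n k0 NkT by (metis mult_right_mono less_imp_le of_nat_mono)
    have "v t = V n" using t NkT by (simp add: v_def step_fun_def n_def)
    moreover have "norm (u0 + frac_conv \<alpha> v t - U n) \<le> C * k powr (\<alpha> / 2)"
    proof -
      have "norm (u0 + frac_conv \<alpha> v t - U n) = norm (frac_conv \<alpha> v (real n * k) - frac_conv \<alpha> v t)"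
        using Uv[OF n(2)] by (simp add: norm_minus_commute)
      also have "\<dots> \<le> C * (real n * k - t) powr (\<alpha> / 2)" using t tn nT by (intro hoelder) auto
      also have "\<dots> \<le> C * k powr (\<alpha> / 2)"
        using C0 tn \<alpha> by (intro mult_left_mono powr_mono2) (auto simp: algebra_simps)
      finally show ?thesis .
    qed
    ultimately show ?thesis using Vs[OF n(1)] by (intro exI[of _ "U n"]) auto
  qed
  then have "approximate_flow \<alpha> \<phi> u0 T E (C * k powr (\<alpha> / 2)) v"
    unfolding approximate_flow_def using vm M vs energy by blast
  with Uv hoelder that show ?thesis by blast
qed

lemma powr_dyadic_tendsto:
  fixes T a :: real
  assumes "0 < T" "0 < a"
  shows "(\<lambda>m. (T / 2 ^ m) powr a) \<longlonglongrightarrow> 0"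
proof -
  have "(\<lambda>m. T * (1 / 2) ^ m) \<longlonglongrightarrow> T * 0" by (intro tendsto_intros) auto
  then have z: "(\<lambda>m. T / 2 ^ m) \<longlonglongrightarrow> 0" by (simp add: power_divide)
  have "(\<lambda>m. (T / 2 ^ m) powr a) \<longlonglongrightarrow> 0 powr a"
    by (rule tendsto_powr'[OF z tendsto_const]) (use assms in auto)
  then show ?thesis by simp
qed

text \<open>The comparison of two grids makes the curves uniformly Cauchy. The derivatives converge
  only weakly and only pointwise in time, so three facts must be supplied separately: a bound
  uniform in time and step, measurability of the limit, and preservation of the inclusion.\<close>

lemma fractional_gradient_flow_limit:
  fixes \<phi> :: "'a::{real_inner, banach, second_countable_topology} \<Rightarrow> real" and u0 :: 'a and \<alpha> T :: real
  assumes \<alpha>: "0 < \<alpha>" "\<alpha> < 1"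
    and lsc: "lower_semicontinuous \<phi>" and conv: "convex_on UNIV \<phi>" and bdd: "bdd_below (range \<phi>)"
    and weak: "\<forall>(vs :: nat \<Rightarrow> 'a) v \<xi>s. vs \<longlonglongrightarrow> v \<longrightarrow> (\<forall>n. \<xi>s n \<in> frechet_subdiff \<phi> (vs n)) \<longrightarrow>
           (\<exists>\<xi>. weakly_tendsto \<xi>s \<xi>)"
    and T: "0 < T"
  obtains v M C where "v \<in> borel_measurable lborel" "\<And>s. norm (v s) \<le> M" "\<forall>s. s \<notin> {0..T} \<longrightarrow> v s = 0"
    and "\<And>t. t \<in> {0<..T} \<Longrightarrow> - v t \<in> frechet_subdiff \<phi> (u0 + frac_conv \<alpha> v t)"
    and "\<And>t t'. 0 \<le> t \<Longrightarrow> t \<le> t' \<Longrightarrow> t' \<le> T \<Longrightarrow>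
      norm (frac_conv \<alpha> v t' - frac_conv \<alpha> v t) \<le> C * (t' - t) powr (\<alpha> / 2)"
    and "\<And>m U n. numerical_solution \<alpha> \<phi> u0 (T / 2 ^ m) U \<Longrightarrow> n \<le> 2 ^ m \<Longrightarrow>
      norm (U n - (u0 + frac_conv \<alpha> v (real n * (T / 2 ^ m)))) \<le> C * (T / 2 ^ m) powr (\<alpha> / 4)"
proof -
  obtain B where B: "\<And>x. B \<le> \<phi> x" using bdd by (auto simp: bdd_below_def)
  define E where "E = 2 * (\<phi> u0 - B)"
  define C where "C = 1 / Gamma (1 + \<alpha>) + E"
  have G: "0 < Gamma (1 + \<alpha>)" using \<alpha> by (intro Gamma_real_pos) auto
  have E0: "0 \<le> E" using B[of u0] by (simp add: E_def)
  have C0: "0 \<le> C" using E0 G by (simp add: C_def)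
  define k where "k m = T / 2 ^ m" for m :: nat
  have k0: "0 < k m" for m using T by (simp add: k_def)
  have "\<forall>m. \<exists>v. approximate_flow \<alpha> \<phi> u0 T E (C * k m powr (\<alpha> / 2)) v \<and>
     (\<forall>U n. numerical_solution \<alpha> \<phi> u0 (k m) U \<longrightarrow> n \<le> 2 ^ m \<longrightarrow> U n = u0 + frac_conv \<alpha> v (real n * k m)) \<and>
     (\<forall>t t'. 0 \<le> t \<longrightarrow> t \<le> t' \<longrightarrow> t' \<le> T \<longrightarrow> norm (frac_conv \<alpha> v t' - frac_conv \<alpha> v t) \<le> C * (t' - t) powr (\<alpha> / 2))"
  proof
    fix m
    obtain U where U: "numerical_solution \<alpha> \<phi> u0 (k m) U" "\<And>U'. numerical_solution \<alpha> \<phi> u0 (k m) U' \<Longrightarrow> U' = U"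
      using numerical_solution_exists_unique[OF \<alpha>(1) lsc conv bdd k0[of m]] by blast
    have kN: "k m = T / real (2 ^ m)" by (simp add: k_def)
    obtain v where v: "approximate_flow \<alpha> \<phi> u0 T E (C * k m powr (\<alpha> / 2)) v"
      "\<And>n. n \<le> 2 ^ m \<Longrightarrow> U n = u0 + frac_conv \<alpha> v (real n * k m)"
      "\<And>t t'. 0 \<le> t \<Longrightarrow> t \<le> t' \<Longrightarrow> t' \<le> T \<Longrightarrow>
        norm (frac_conv \<alpha> v t' - frac_conv \<alpha> v t) \<le> C * (t' - t) powr (\<alpha> / 2)"
      unfolding C_def E_def
      by (rule numerical_solution_approximate_flow[OF \<alpha> conv B T _ kN U(1)]) auto
    show "\<exists>v. approximate_flow \<alpha> \<phi> u0 T E (C * k m powr (\<alpha> / 2)) v \<and>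
     (\<forall>U n. numerical_solution \<alpha> \<phi> u0 (k m) U \<longrightarrow> n \<le> 2 ^ m \<longrightarrow> U n = u0 + frac_conv \<alpha> v (real n * k m)) \<and>
     (\<forall>t t'. 0 \<le> t \<longrightarrow> t \<le> t' \<longrightarrow> t' \<le> T \<longrightarrow> norm (frac_conv \<alpha> v t' - frac_conv \<alpha> v t) \<le> C * (t' - t) powr (\<alpha> / 2))"
      using v U(2) by (intro exI[of _ v]) auto
  qed
  then obtain vn where vn: "\<And>m. approximate_flow \<alpha> \<phi> u0 T E (C * k m powr (\<alpha> / 2)) (vn m)"
    and Uvn: "\<And>m U n. numerical_solution \<alpha> \<phi> u0 (k m) U \<Longrightarrow> n \<le> 2 ^ m \<Longrightarrow> U n = u0 + frac_conv \<alpha> (vn m) (real n * k m)"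
    and hn: "\<And>m t t'. 0 \<le> t \<Longrightarrow> t \<le> t' \<Longrightarrow> t' \<le> T \<Longrightarrow> norm (frac_conv \<alpha> (vn m) t' - frac_conv \<alpha> (vn m) t) \<le> C * (t' - t) powr (\<alpha> / 2)"
    by metis
  have vnm [measurable]: "vn m \<in> borel_measurable lborel" and vnM: "\<exists>M. \<forall>s. norm (vn m s) \<le> M"
    and vns: "\<forall>s. s \<notin> {0..T} \<longrightarrow> vn m s = 0"
    and vnx: "t \<in> {0<..T} \<Longrightarrow> \<exists>x. norm (u0 + frac_conv \<alpha> (vn m) t - x) \<le> C * k m powr (\<alpha> / 2) \<and> (\<forall>w. \<phi> x - vn m t \<bullet> (w - x) \<le> \<phi> w)" for m t
    using vn[of m] unfolding approximate_flow_def by blast+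
  have vnneg: "s < 0 \<Longrightarrow> vn m s = 0" for m s using vns by auto
  define un where "un m t = u0 + frac_conv \<alpha> (vn m) t" for m t
  define K where "K = frac_kernel_prim \<alpha> T + E"
  have K0: "0 \<le> K" using \<alpha> E0 by (simp add: K_def)
  \<comment> \<open>From \<open>2 * (2 * C * k powr (\<alpha>/2)) * K\<close>, the finer defect
    being bounded by the coarser one, followed by a square root.\<close>
  define C2 where "C2 = sqrt (4 * C * K)"
  have cauchy: "norm (un m t - un l t) \<le> C2 * k m powr (\<alpha> / 4)" if "m \<le> l" "t \<in> {0..T}" for m l t
  proof -
    have "k l \<le> k m" unfolding k_def using that T by (intro divide_left_mono power_increasing) auto
    then have kl: "k l powr (\<alpha> / 2) \<le> k m powr (\<alpha> / 2)" using k0[of l] \<alpha> by (intro powr_mono2) auto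
    have "(norm (un m t - un l t))\<^sup>2 \<le> 2 * (C * k m powr (\<alpha> / 2) + C * k l powr (\<alpha> / 2)) * K"
      using approximate_flow_comparison[OF \<alpha> T vn[of m] vn[of l] _ _ that(2)] C0 by (simp add: un_def K_def)
    also have "\<dots> \<le> 2 * (C * k m powr (\<alpha> / 2) + C * k m powr (\<alpha> / 2)) * K"
      using kl C0 K0 by (intro mult_right_mono mult_left_mono add_left_mono) auto
    also have "\<dots> = (C2 * k m powr (\<alpha> / 4))\<^sup>2"
      using C0 K0 by (simp add: C2_def power_mult_distrib) (simp add: power2_eq_square powr_add[symmetric])
    finally show ?thesis
      by (rule power2_le_imp_le) (use C0 K0 in \<open>simp add: C2_def\<close>)
  qed
  have klim: "(\<lambda>m. c * k m powr a) \<longlonglongrightarrow> 0" if "0 < a" for a c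
    using tendsto_mult_left[OF powr_dyadic_tendsto[OF T that], of c] by (simp add: k_def)
  have C20: "0 \<le> C2" using C0 K0 by (simp add: C2_def)
  have "\<exists>l. (\<lambda>m. un m t) \<longlonglongrightarrow> l" if t: "t \<in> {0..T}" for t
  proof -
    have "Cauchy (\<lambda>m. un m t)"
    proof (rule CauchyI')
      fix \<epsilon> :: real assume "0 < \<epsilon>"
      then have "\<forall>\<^sub>F m in sequentially. C2 * k m powr (\<alpha> / 4) < \<epsilon>"
        using \<alpha> by (intro order_tendstoD(2)[OF klim]) auto
      then obtain m0 where m0: "\<And>m. m0 \<le> m \<Longrightarrow> C2 * k m powr (\<alpha> / 4) < \<epsilon>" by (auto simp: eventually_sequentially)
      show "\<exists>M. \<forall>m\<ge>M. \<forall>n>m. dist (un m t) (un n t) < \<epsilon>"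
        unfolding dist_norm using m0 cauchy[OF _ t] by (intro exI[of _ m0]) (meson le_less_trans less_imp_le)
    qed
    then show ?thesis using Cauchy_convergent convergent_def by blast
  qed
  then obtain u where u: "\<And>t. t \<in> {0..T} \<Longrightarrow> (\<lambda>m. un m t) \<longlonglongrightarrow> u t" by metis
  have uerr: "norm (un m t - u t) \<le> C2 * k m powr (\<alpha> / 4)" if t: "t \<in> {0..T}" for m t
  proof -
    have "(\<lambda>l. norm (un m t - un l t)) \<longlonglongrightarrow> norm (un m t - u t)" by (intro tendsto_intros u t)
    then show ?thesis
      by (rule LIMSEQ_le_const2) (use cauchy[OF _ t] in blast)
  qed
  have uh: "norm (u t' - u t) \<le> C * (t' - t) powr (\<alpha> / 2)" if "0 \<le> t" "t \<le> t'" "t' \<le> T" for t t'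
  proof -
    have "(\<lambda>l. norm (un l t' - un l t)) \<longlonglongrightarrow> norm (u t' - u t)" using that by (intro tendsto_intros u) auto
    then show ?thesis
      by (rule LIMSEQ_le_const2) (use hn[OF that] in \<open>auto simp: un_def\<close>)
  qed
  \<comment> \<open>The base points at which \<open>- vn m t\<close> is a subgradient. They, and not
    the curves \<open>un\<close>, enter the weak convergence hypothesis.\<close>
  define x where "x m t = (SOME x. norm (un m t - x) \<le> C * k m powr (\<alpha> / 2) \<and> (\<forall>w. \<phi> x - vn m t \<bullet> (w - x) \<le> \<phi> w))" for m t
  have x: "norm (un m t - x m t) \<le> C * k m powr (\<alpha> / 2) \<and> (\<forall>w. \<phi> (x m t) - vn m t \<bullet> (w - x m t) \<le> \<phi> w)"
    if "t \<in> {0<..T}" for m t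
    unfolding x_def un_def by (rule someI_ex[OF vnx[OF that]])
  have xn: "norm (un m t - x m t) \<le> C * k m powr (\<alpha> / 2)" and xs: "\<phi> (x m t) - vn m t \<bullet> (w - x m t) \<le> \<phi> w"
    if "t \<in> {0<..T}" for m t w using x[OF that] by auto
  define \<epsilon> where "\<epsilon> m = C * k m powr (\<alpha> / 2) + C2 * k m powr (\<alpha> / 4)" for m
  have \<epsilon>0: "\<epsilon> \<longlonglongrightarrow> 0" unfolding \<epsilon>_def using tendsto_add[OF klim[of "\<alpha> / 2" C] klim[of "\<alpha> / 4" C2]] \<alpha> by simp
  have xu: "norm (x m t - u t) \<le> \<epsilon> m" if "t \<in> {0<..T}" for m t
  proof -
    have "norm (x m t - u t) \<le> norm (un m t - x m t) + norm (un m t - u t)"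
      using norm_triangle_ineq4[of "un m t - u t" "un m t - x m t"] by simp
    then show ?thesis using xn[OF that, of m] uerr[of t m] that unfolding \<epsilon>_def by auto
  qed
  have xlim: "(\<lambda>m. x m t) \<longlonglongrightarrow> u t" if "t \<in> {0<..T}" for t
    by (rule LIM_zero_cancel, rule Lim_null_comparison[OF _ \<epsilon>0]) (use xu[OF that] in auto)
  \<comment> \<open>Otherwise derivatives of norm above \<open>j\<close> occur at times
    \<open>tj j\<close> and levels \<open>mj j \<ge> j\<close>. A subsequence of the times converges
    to some \<open>ts\<close>, the base points converge to \<open>u ts\<close> by uniform
    convergence and Hoelder continuity, and the local bound for subgradients there is
    violated.\<close>
  obtain m0 M where M: "\<And>m t. m0 \<le> m \<Longrightarrow> t \<in> {0<..T} \<Longrightarrow> norm (vn m t) \<le> M"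
  proof (rule ccontr)
    assume n: "\<not> thesis"
    have "\<exists>m t. j \<le> m \<and> t \<in> {0<..T} \<and> real j < norm (vn m t)" for j :: nat
      using n that[of j "real j"] by (meson not_le)
    then obtain mj tj where mt: "\<And>j. j \<le> mj j" "\<And>j. tj j \<in> {0<..T}" "\<And>j. real j < norm (vn (mj j) (tj j))" by metis
    have "\<forall>j. tj j \<in> {0..T}" using mt(2) by (meson greaterThanAtMost_iff atLeastAtMost_iff less_imp_le)
    then obtain ts r where r: "ts \<in> {0..T}" "strict_mono r" "(tj \<circ> r) \<longlonglongrightarrow> ts"
      using compact_Icc[of 0 T] unfolding compact_def by meson
    have "(\<lambda>j. u (tj (r j))) \<longlonglongrightarrow> u ts"
    proof (rule LIM_zero_cancel, rule Lim_null_comparison)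
      show "\<forall>\<^sub>F j in sequentially. norm (u (tj (r j)) - u ts) \<le> C * \<bar>tj (r j) - ts\<bar> powr (\<alpha> / 2)"
      proof (intro always_eventually allI)
        fix j
        have tT: "0 \<le> tj (r j)" "tj (r j) \<le> T" using mt(2)[of "r j"] by auto
        show "norm (u (tj (r j)) - u ts) \<le> C * \<bar>tj (r j) - ts\<bar> powr (\<alpha> / 2)"
        proof (cases "ts \<le> tj (r j)")
          case True
          then show ?thesis using uh[of ts "tj (r j)"] tT r(1) by simp
        next
          case False
          then show ?thesis using uh[of "tj (r j)" ts] tT r(1) by (simp add: norm_minus_commute)
        qed
      qed
      have "(\<lambda>j. C * \<bar>tj (r j) - ts\<bar> powr (\<alpha> / 2)) \<longlonglongrightarrow> C * \<bar>ts - ts\<bar> powr (\<alpha> / 2)"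
        using r(3) \<alpha> by (intro tendsto_mult tendsto_const tendsto_powr' tendsto_rabs tendsto_diff) (auto simp: o_def)
      then show "(\<lambda>j. C * \<bar>tj (r j) - ts\<bar> powr (\<alpha> / 2)) \<longlonglongrightarrow> 0" using \<alpha> by simp
    qed
    moreover have "(\<lambda>j. x (mj (r j)) (tj (r j)) - u (tj (r j))) \<longlonglongrightarrow> 0"
    proof (rule Lim_null_comparison)
      show "\<forall>\<^sub>F j in sequentially. norm (x (mj (r j)) (tj (r j)) - u (tj (r j))) \<le> \<epsilon> (mj (r j))"
        using xu mt(2) by auto
      have "filterlim (\<lambda>j. mj (r j)) at_top sequentially"
        by (rule filterlim_at_top_mono[OF filterlim_subseq[OF r(2)]]) (use mt(1) in auto)
      then show "(\<lambda>j. \<epsilon> (mj (r j))) \<longlonglongrightarrow> 0" by (rule filterlim_compose[OF \<epsilon>0])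
    qed
    ultimately have lim: "(\<lambda>j. x (mj (r j)) (tj (r j))) \<longlonglongrightarrow> u ts" using tendsto_add by fastforce
    obtain \<rho> Mb where \<rho>: "0 < \<rho>" "\<And>y \<xi>. dist y (u ts) < \<rho> \<Longrightarrow> (\<And>w. \<phi> y + \<xi> \<bullet> (w - y) \<le> \<phi> w) \<Longrightarrow> norm \<xi> \<le> Mb"
      by (rule subgradients_locally_bounded[OF lsc conv bdd, of "u ts"]) blast
    have "\<forall>\<^sub>F j in sequentially. dist (x (mj (r j)) (tj (r j))) (u ts) < \<rho>" using lim \<rho>(1) by (rule tendstoD)
    moreover have "\<forall>\<^sub>F j in sequentially. Mb < real j" by (rule eventually_gt_at_top[THEN filterlim_real_sequentially[THEN eventually_compose_filterlim[rotated]]])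
    ultimately have "\<forall>\<^sub>F j in sequentially. False"
    proof eventually_elim
      case (elim j)
      have "norm (- vn (mj (r j)) (tj (r j))) \<le> Mb"
        by (rule \<rho>(2)[OF elim(1)]) (use xs[OF mt(2)] in simp)
      moreover have "real j \<le> real (r j)" using seq_suble[OF r(2)] by simp
      ultimately show False using mt(3)[of "r j"] elim(2) by simp
    qed
    then show False by simp
  qed
  define M' where "M' = max M 0"
  have M'0: "0 \<le> M'" by (simp add: M'_def)
  have vM': "norm (vn (m + m0) s) \<le> M'" if "s \<noteq> 0" for m s
    using M[of "m + m0" s] vns[of "m + m0"] that by (cases "s \<in> {0<..T}") (auto simp: M'_def)
  have "\<exists>\<xi>. weakly_tendsto (\<lambda>m. - vn (m + m0) t) \<xi>" if t: "t \<in> {0<..T}" for t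
  proof (rule weak[rule_format])
    show "(\<lambda>m. x (m + m0) t) \<longlonglongrightarrow> u t" by (rule LIMSEQ_ignore_initial_segment[OF xlim[OF t]])
    show "- vn (m + m0) t \<in> frechet_subdiff \<phi> (x (m + m0) t)" for m
      unfolding frechet_subdiff_convex[OF conv] using xs[OF t] by simp
  qed
  then obtain \<xi> where \<xi>: "\<And>t. t \<in> {0<..T} \<Longrightarrow> weakly_tendsto (\<lambda>m. - vn (m + m0) t) (\<xi> t)" by metis
  define v where "v t = (if t \<in> {0<..T} then - \<xi> t else 0)" for t
  \<comment> \<open>The uniform bound covers only positive times, so the value at 0 is erased; no
    integral notices.\<close>
  define wn where "wn m t = indicator (- {0}) t *\<^sub>R vn (m + m0) t" for m t
  have wnm [measurable]: "wn m \<in> borel_measurable lborel" for m unfolding wn_def by measurable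
  have wnM: "norm (wn m s) \<le> M'" for m s using vM'[of s m] M'0 by (cases "s = 0") (auto simp: wn_def)
  have wnneg: "s < 0 \<Longrightarrow> wn m s = 0" for m s by (simp add: wn_def vnneg)
  have wconv: "frac_conv \<alpha> (wn m) t = frac_conv \<alpha> (vn (m + m0)) t" for m t
    unfolding frac_conv_def
  proof (rule integral_cong_AE)
    show "AE s in lborel. frac_kernel \<alpha> (t - s) *\<^sub>R wn m s = frac_kernel \<alpha> (t - s) *\<^sub>R vn (m + m0) s"
      using AE_lborel_singleton[of 0] by eventually_elim (simp add: wn_def)
  qed measurable
  have vlim: "(\<lambda>m. wn m t \<bullet> y) \<longlonglongrightarrow> v t \<bullet> y" for t y
  proof (cases "t \<in> {0<..T}")
    case True
    have "(\<lambda>m. - ((- vn (m + m0) t) \<bullet> y)) \<longlonglongrightarrow> - (\<xi> t \<bullet> y)"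
      using \<xi>[OF True] unfolding weakly_tendsto_def by (intro tendsto_minus) blast
    then show ?thesis using True by (simp add: v_def wn_def)
  next
    case False
    then have "wn m t = 0" for m using vns[of "m + m0"] by (cases "t = 0") (auto simp: wn_def)
    moreover have "v t = 0" unfolding v_def using False by (rule if_not_P)
    ultimately show ?thesis by simp
  qed
  \<comment> \<open>The weak limit is measurable along each vector; separability makes this
    enough.\<close>
  have vm [measurable]: "v \<in> borel_measurable lborel"
  proof (rule borel_measurable_weak)
    fix y
    show "(\<lambda>t. v t \<bullet> y) \<in> borel_measurable lborel"
      by (rule borel_measurable_LIMSEQ_real[where u = "\<lambda>m t. wn m t \<bullet> y"]) (use vlim in auto)
  qed
  have vM: "norm (v t) \<le> M'" for t
  proof -
    \<comment> \<open>Weak lower semicontinuity of the norm, by testing the weak limit against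
      itself.\<close>
    have "v t \<bullet> v t \<le> M' * norm (v t)"
    proof (rule LIMSEQ_le_const2[OF vlim])
      have "wn m t \<bullet> v t \<le> M' * norm (v t)" for m
        using wnM[of m t] by (meson mult_right_mono norm_cauchy_schwarz norm_ge_zero order_trans)
      then show "\<exists>N. \<forall>m\<ge>N. wn m t \<bullet> v t \<le> M' * norm (v t)" by blast
    qed
    then have "norm (v t) * norm (v t) \<le> M' * norm (v t)" by (simp add: power2_norm_eq_inner[symmetric] power2_eq_square)
    then show ?thesis using M'0 by (cases "v t = 0") auto
  qed
  have vs: "\<forall>s. s \<notin> {0..T} \<longrightarrow> v s = 0" by (auto simp: v_def)
  have vneg: "s < 0 \<Longrightarrow> v s = 0" for s by (simp add: v_def)
  \<comment> \<open>The strong limit of the curves and the fractional integral of the weak limit are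
    both limits of the same inner products, the latter by dominated convergence with the bound
    \<open>M' * norm y\<close>.\<close>
  have uv: "u t = u0 + frac_conv \<alpha> v t" if t: "t \<in> {0..T}" for t
  proof -
    have "(u t - u0) \<bullet> y = frac_conv \<alpha> v t \<bullet> y" for y
    proof (rule LIMSEQ_unique)
      have i1: "frac_conv \<alpha> (\<lambda>s. wn m s \<bullet> y) t = frac_conv \<alpha> (wn m) t \<bullet> y" for m
        by (rule frac_conv_inner[OF \<alpha>(1) wnm wnM]) (rule wnneg)
      have i2: "frac_conv \<alpha> (\<lambda>s. v s \<bullet> y) t = frac_conv \<alpha> v t \<bullet> y"
        by (rule frac_conv_inner[OF \<alpha>(1) vm vM]) (rule vneg)
      have "(\<lambda>m. (un (m + m0) t - u0) \<bullet> y) \<longlonglongrightarrow> (u t - u0) \<bullet> y"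
        by (intro tendsto_intros LIMSEQ_ignore_initial_segment[OF u[OF t]])
      then show "(\<lambda>m. frac_conv \<alpha> (wn m) t \<bullet> y) \<longlonglongrightarrow> (u t - u0) \<bullet> y" by (simp add: un_def wconv)
      have "(\<lambda>m. frac_conv \<alpha> (\<lambda>s. wn m s \<bullet> y) t) \<longlonglongrightarrow> frac_conv \<alpha> (\<lambda>s. v s \<bullet> y) t"
      proof (rule frac_conv_tendsto[where M = "M' * norm y"])
        show "norm (wn m s \<bullet> y) \<le> M' * norm y" for m s
          using wnM[of m s] by (metis Cauchy_Schwarz_ineq2 mult_right_mono norm_ge_zero order_trans real_norm_def)
      qed (use \<alpha> wnneg vlim in auto)
      then show "(\<lambda>m. frac_conv \<alpha> (wn m) t \<bullet> y) \<longlonglongrightarrow> frac_conv \<alpha> v t \<bullet> y"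
        unfolding i1 i2 .
    qed
    then have "u t - u0 = frac_conv \<alpha> v t" by (metis vector_eq_rdot)
    then show ?thesis by (simp add: algebra_simps)
  qed
  have sub: "- v t \<in> frechet_subdiff \<phi> (u0 + frac_conv \<alpha> v t)" if t: "t \<in> {0<..T}" for t
  proof -
    have "\<phi> (u t) + \<xi> t \<bullet> (w - u t) \<le> \<phi> w" for w
    proof (rule subgradient_weak_limit[OF lsc])
      show "(\<lambda>m. x (m + m0) t) \<longlonglongrightarrow> u t" by (rule LIMSEQ_ignore_initial_segment[OF xlim[OF t]])
      show "\<phi> (x (m + m0) t) + (- vn (m + m0) t) \<bullet> (w - x (m + m0) t) \<le> \<phi> w" for m w using xs[OF t] by simp
      show "norm (- vn (m + m0) t) \<le> M'" for m using vM'[of t m] t by simp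
      show "weakly_tendsto (\<lambda>m. - vn (m + m0) t) (\<xi> t)" by (rule \<xi>[OF t])
    qed
    then show ?thesis unfolding frechet_subdiff_convex[OF conv] using uv[of t] t by (simp add: v_def)
  qed
  show ?thesis
  proof (rule that[OF vm vM vs sub, where C = "max C C2"])
    fix t t' assume t: "0 \<le> t" "t \<le> t'" "t' \<le> T"
    have "norm (frac_conv \<alpha> v t' - frac_conv \<alpha> v t) \<le> C * (t' - t) powr (\<alpha> / 2)"
      using uh[OF t] uv[of t] uv[of t'] t by simp
    also have "\<dots> \<le> max C C2 * (t' - t) powr (\<alpha> / 2)" by (intro mult_right_mono) auto
    finally show "norm (frac_conv \<alpha> v t' - frac_conv \<alpha> v t) \<le> max C C2 * (t' - t) powr (\<alpha> / 2)" .
  next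
    fix m U and n :: nat assume U: "numerical_solution \<alpha> \<phi> u0 (T / 2 ^ m) U" and n: "n \<le> 2 ^ m"
    have "real n * k m \<le> real (2 ^ m) * k m" using n k0[of m] by (intro mult_right_mono) auto
    moreover have "real (2 ^ m) * k m = T" by (simp add: k_def)
    moreover have "0 \<le> real n * k m" using k0[of m] by simp
    ultimately have nk: "real n * k m \<in> {0..T}" by simp
    have "U n = un m (real n * k m)" using Uvn[of m U n] U n by (simp add: k_def un_def)
    then have "norm (U n - (u0 + frac_conv \<alpha> v (real n * k m))) \<le> C2 * k m powr (\<alpha> / 4)"
      using uerr[OF nk, of m] uv[OF nk] by simp
    also have "\<dots> \<le> max C C2 * k m powr (\<alpha> / 4)" by (intro mult_right_mono) auto
    finally show "norm (U n - (u0 + frac_conv \<alpha> v (real n * (T / 2 ^ m)))) \<le> max C C2 * (T / 2 ^ m) powr (\<alpha> / 4)"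
      by (simp add: k_def)
  qed auto
qed

lemma frac_conv_strong_solution:
  fixes \<phi> :: "'a::{real_inner, banach, second_countable_topology} \<Rightarrow> real"
  assumes \<alpha>: "0 < \<alpha>" "\<alpha> < 1"
    and v: "v \<in> borel_measurable lborel" and M: "\<And>s. norm (v s) \<le> M" and vs: "\<forall>s. s \<notin> {0..T} \<longrightarrow> v s = 0"
    and sub: "\<And>t. t \<in> {0<..T} \<Longrightarrow> - v t \<in> frechet_subdiff \<phi> (u0 + frac_conv \<alpha> v t)"
  shows "strong_solution \<alpha> \<phi> u0 T (\<lambda>t. u0 + frac_conv \<alpha> v t)"
proof -
  note [measurable] = v
  let ?u = "\<lambda>t. u0 + frac_conv \<alpha> v t"
  have vneg: "s < 0 \<Longrightarrow> v s = 0" for s using vs by auto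
  have M0: "0 \<le> M" using M[of 0] norm_ge_zero order_trans by blast
  have cm [measurable]: "frac_conv \<alpha> v \<in> borel_measurable lborel" unfolding frac_conv_def by measurable
  have cb: "norm (frac_conv \<alpha> v s) \<le> M * frac_kernel_prim \<alpha> t" if "s \<le> t" for s t
    using frac_conv_integrable(2)[OF \<alpha>(1) v M vneg, of s] mult_left_mono[OF frac_kernel_prim_mono[OF \<alpha>(1) that] M0]
    by linarith
  have si: "integrable lborel (\<lambda>s. indicator {0..b} s *\<^sub>R ?u s)" for b
  proof (rule bounded_supported_integrable[where M = "norm u0 + M * frac_kernel_prim \<alpha> b" and T = b])
    show "norm (indicator {0..b} s *\<^sub>R ?u s) \<le> norm u0 + M * frac_kernel_prim \<alpha> b" for s
    proof (cases "s \<in> {0..b}")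
      case True
      then show ?thesis using cb[of s b] norm_triangle_ineq[of u0 "frac_conv \<alpha> v s"] by simp
    qed (use M0 \<alpha> in simp)
  qed (use cm in auto)
  have L: "L1_loc T ?u"
    unfolding L1_loc_def set_integrable_def
    using si by (auto simp: integrable_completion borel_measurable_integrable)
  \<comment> \<open>Bounded \<open>v\<close> gives
    \<open>norm (u s - u0) \<le> M * frac_kernel_prim \<alpha> t\<close> on \<open>[0, t]\<close>,
    which bounds the mean and tends to 0.\<close>
  have mean: "((\<lambda>t. 1 / t * (LINT s:{0..t}|lebesgue. norm (?u s - u0))) \<longlongrightarrow> 0) (at_right 0)"
  proof (rule Lim_null_comparison)
    show "\<forall>\<^sub>F t in at_right 0. norm (1 / t * (LINT s:{0..t}|lebesgue. norm (?u s - u0))) \<le> M * frac_kernel_prim \<alpha> t"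
      unfolding eventually_at_right[OF zero_less_one]
    proof (intro exI[of _ 1] conjI allI impI zero_less_one)
      fix t :: real assume t: "0 < t"
      have m: "(\<lambda>s. indicator {0..t} s * norm (frac_conv \<alpha> v s)) \<in> borel_measurable lborel" by measurable
      have e: "(LINT s:{0..t}|lebesgue. norm (?u s - u0)) = (LBINT s. indicator {0..t} s * norm (frac_conv \<alpha> v s))"
        unfolding set_lebesgue_integral_def using integral_completion[OF m] by simp
      have le: "indicator {0..t} s * norm (frac_conv \<alpha> v s) \<le> indicator {0..t} s * (M * frac_kernel_prim \<alpha> t)" for s
        using cb[of s t] by (auto simp: indicator_def)
      have i2: "has_bochner_integral lborel (\<lambda>s. indicator {0..t} s * (M * frac_kernel_prim \<alpha> t)) (measure lborel {0..t} * (M * frac_kernel_prim \<alpha> t))"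
        by (intro has_bochner_integral_mult_left has_bochner_integral_real_indicator) (auto simp: emeasure_lborel_Icc_eq)
      have i1: "integrable lborel (\<lambda>s. indicator {0..t} s * norm (frac_conv \<alpha> v s))"
      proof (rule Bochner_Integration.integrable_bound)
        show "integrable lborel (\<lambda>s. indicator {0..t} s * (M * frac_kernel_prim \<alpha> t))" using i2 by (simp only: has_bochner_integral_iff)
        show "AE s in lborel. norm (indicator {0..t} s * norm (frac_conv \<alpha> v s)) \<le> norm (indicator {0..t} s * (M * frac_kernel_prim \<alpha> t))"
          using cb[of _ t] M0 \<alpha> by (intro AE_I2) (auto simp: indicator_def)
      qed measurable
      have "(LBINT s. indicator {0..t} s * norm (frac_conv \<alpha> v s)) \<le> (LBINT s. indicator {0..t} s * (M * frac_kernel_prim \<alpha> t))"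
        by (rule integral_mono[OF i1 _ le]) (use i2 in \<open>simp only: has_bochner_integral_iff\<close>)
      also have "\<dots> = t * (M * frac_kernel_prim \<alpha> t)"
        using has_bochner_integral_integral_eq[OF i2] t by simp
      finally have "(LINT s:{0..t}|lebesgue. norm (?u s - u0)) \<le> t * (M * frac_kernel_prim \<alpha> t)" unfolding e .
      moreover have "0 \<le> (LINT s:{0..t}|lebesgue. norm (?u s - u0))"
        unfolding e by (intro Bochner_Integration.integral_nonneg) simp
      ultimately show "norm (1 / t * (LINT s:{0..t}|lebesgue. norm (?u s - u0))) \<le> M * frac_kernel_prim \<alpha> t"
        using t by (simp add: field_simps)
    qed
    have "isCont (frac_kernel_prim \<alpha>) 0"
      using frac_kernel_prim_continuous[OF \<alpha>(1)] by (simp add: continuous_on_eq_continuous_at)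
    then have "(frac_kernel_prim \<alpha> \<longlongrightarrow> frac_kernel_prim \<alpha> 0) (at_right 0)"
      unfolding isCont_def by (rule filterlim_mono) (auto simp: at_within_le_at)
    from tendsto_mult_left[OF this, of M] show "((\<lambda>t. M * frac_kernel_prim \<alpha> t) \<longlongrightarrow> 0) (at_right 0)" using \<alpha> by simp
  qed
  have cap: "has_caputo_derivative \<alpha> T u0 ?u v"
    by (rule frac_conv_has_caputo_derivative[OF \<alpha> bounded_supported_integrable[OF v M vs] vs]) simp
  have "AE t in lborel. t \<in> {0..<T} \<longrightarrow> v t \<in> uminus ` frechet_subdiff \<phi> (?u t)"
    using AE_lborel_singleton[of 0]
  proof eventually_elim
    case (elim t)
    show ?case
    proof
      assume "t \<in> {0..<T}"
      then have "- v t \<in> frechet_subdiff \<phi> (?u t)" using elim by (intro sub) auto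
      then show "v t \<in> uminus ` frechet_subdiff \<phi> (?u t)" by (rule rev_image_eqI) simp
    qed
  qed
  then have "AE t in lebesgue. t \<in> {0..<T} \<longrightarrow> v t \<in> uminus ` frechet_subdiff \<phi> (?u t)" by (rule AE_completion)
  with L mean cap show ?thesis unfolding strong_solution_def by blast
qed

text \<open>The representative \<open>u0 + frac_conv \<alpha> v\<close> is continuous on all
  nonnegative times, so its value at \<open>T\<close> is the continuous extension in the error
  bound. The unique existence of \<open>U\<close> makes the minimization scheme well defined before
  its error is measured.\<close>

theorem theorem5p1:
  fixes \<phi> :: "'a::{real_inner, banach, second_countable_topology} \<Rightarrow> real"
    and u0 :: 'a and \<alpha> T :: real
  assumes "0 < \<alpha>" "\<alpha> < 1"
    and "lower_semicontinuous \<phi>" "convex_on UNIV \<phi>" "bdd_below (range \<phi>)"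
    and "\<And>(vs :: nat \<Rightarrow> 'a) v \<xi>s. vs \<longlonglongrightarrow> v \<Longrightarrow> (\<And>n. \<xi>s n \<in> frechet_subdiff \<phi> (vs n)) \<Longrightarrow>
           \<exists>\<xi>. weakly_tendsto \<xi>s \<xi>"
    and "T > 0"
  shows "\<exists>u. strong_solution \<alpha> \<phi> u0 T u \<and>
    (\<forall>w. strong_solution \<alpha> \<phi> u0 T w \<longrightarrow> (AE t in lebesgue. t \<in> {0..<T} \<longrightarrow> w t = u t)) \<and>
    (\<exists>C. \<forall>t \<delta>. t \<in> {0..<T} \<longrightarrow> t + \<delta> \<in> {0..<T} \<longrightarrow>
       norm (u (t + \<delta>) - u t) \<le> C * \<bar>\<delta>\<bar> powr (\<alpha> / 2)) \<and>
    (u \<longlongrightarrow> u T) (at_left T) \<and>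
    (\<forall>k\<in>dyadic_steps T. \<exists>!U. numerical_solution \<alpha> \<phi> u0 k U) \<and>
    (\<exists>C. \<forall>k\<in>dyadic_steps T. \<forall>U. numerical_solution \<alpha> \<phi> u0 k U \<longrightarrow>
       (\<forall>n. real n * k \<le> T \<longrightarrow> norm (U n - u (real n * k)) \<le> C * k powr (\<alpha> / 4)))"
proof -
  note \<alpha> = assms(1,2) and T = assms(7)
  have weak: "\<forall>(vs :: nat \<Rightarrow> 'a) v \<xi>s. vs \<longlonglongrightarrow> v \<longrightarrow> (\<forall>n. \<xi>s n \<in> frechet_subdiff \<phi> (vs n)) \<longrightarrow>
      (\<exists>\<xi>. weakly_tendsto \<xi>s \<xi>)"
    using assms(6) by blast
  obtain v M C where v: "v \<in> borel_measurable lborel" and M: "\<And>s. norm (v s) \<le> M" and vs: "\<forall>s. s \<notin> {0..T} \<longrightarrow> v s = 0"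
    and sub: "\<And>t. t \<in> {0<..T} \<Longrightarrow> - v t \<in> frechet_subdiff \<phi> (u0 + frac_conv \<alpha> v t)"
    and hoelder: "\<And>t t'. 0 \<le> t \<Longrightarrow> t \<le> t' \<Longrightarrow> t' \<le> T \<Longrightarrow>
      norm (frac_conv \<alpha> v t' - frac_conv \<alpha> v t) \<le> C * (t' - t) powr (\<alpha> / 2)"
    and err: "\<And>m U n. numerical_solution \<alpha> \<phi> u0 (T / 2 ^ m) U \<Longrightarrow> n \<le> 2 ^ m \<Longrightarrow>
      norm (U n - (u0 + frac_conv \<alpha> v (real n * (T / 2 ^ m)))) \<le> C * (T / 2 ^ m) powr (\<alpha> / 4)"
    by (rule fractional_gradient_flow_limit[OF assms(1-5) weak T, of u0]) blast
  let ?u = "\<lambda>t. u0 + frac_conv \<alpha> v t"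
  have vneg: "s < 0 \<Longrightarrow> v s = 0" for s using vs by auto
  show ?thesis
  proof (intro exI[of _ ?u] conjI)
    show sol: "strong_solution \<alpha> \<phi> u0 T ?u" by (rule frac_conv_strong_solution[OF \<alpha> v M vs sub])
    show "\<forall>w. strong_solution \<alpha> \<phi> u0 T w \<longrightarrow> (AE t in lebesgue. t \<in> {0..<T} \<longrightarrow> w t = ?u t)"
      using strong_solution_unique[OF \<alpha> assms(4) T sol] by blast
    show "\<exists>C. \<forall>t \<delta>. t \<in> {0..<T} \<longrightarrow> t + \<delta> \<in> {0..<T} \<longrightarrow> norm (?u (t + \<delta>) - ?u t) \<le> C * \<bar>\<delta>\<bar> powr (\<alpha> / 2)"
    proof (intro exI[of _ C] allI impI)
      fix t \<delta> assume t: "t \<in> {0..<T}" "t + \<delta> \<in> {0..<T}"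
      show "norm (?u (t + \<delta>) - ?u t) \<le> C * \<bar>\<delta>\<bar> powr (\<alpha> / 2)"
      proof (cases "0 \<le> \<delta>")
        case True
        then show ?thesis using hoelder[of t "t + \<delta>"] t by simp
      next
        case False
        then show ?thesis using hoelder[of "t + \<delta>" t] t by (simp add: norm_minus_commute)
      qed
    qed
    show "(?u \<longlongrightarrow> ?u T) (at_left T)"
    proof -
      have "continuous_on {0..} (frac_conv \<alpha> v)"
        by (rule frac_conv_continuous[OF _ _ v M vneg]) (use \<alpha> in auto)
      then have "(frac_conv \<alpha> v \<longlongrightarrow> frac_conv \<alpha> v T) (at T within {0..})"
        using T by (simp add: continuous_on_def)
      moreover have "at T within {0..} = at T" using T by (intro at_within_interior) simp
      ultimately have "(frac_conv \<alpha> v \<longlongrightarrow> frac_conv \<alpha> v T) (at_left T)"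
        by (metis filterlim_at_split)
      then show ?thesis by (intro tendsto_intros)
    qed
    show "\<forall>k\<in>dyadic_steps T. \<exists>!U. numerical_solution \<alpha> \<phi> u0 k U"
    proof
      fix k assume "k \<in> dyadic_steps T"
      then have "0 < k" using T by (auto simp: dyadic_steps_def)
      then show "\<exists>!U. numerical_solution \<alpha> \<phi> u0 k U"
        by (rule numerical_solution_exists_unique[OF \<alpha>(1) assms(3-5)])
    qed
    show "\<exists>C. \<forall>k\<in>dyadic_steps T. \<forall>U. numerical_solution \<alpha> \<phi> u0 k U \<longrightarrow>
       (\<forall>n. real n * k \<le> T \<longrightarrow> norm (U n - ?u (real n * k)) \<le> C * k powr (\<alpha> / 4))"
    proof (intro exI[of _ C] ballI allI impI)
      fix k U n assume k: "k \<in> dyadic_steps T" and U: "numerical_solution \<alpha> \<phi> u0 k U" and n: "real n * k \<le> T"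
      obtain m where m: "k = T / 2 ^ m" using k by (auto simp: dyadic_steps_def)
      have "real n \<le> 2 ^ m" using n T by (simp add: m field_simps)
      then have "n \<le> 2 ^ m" by simp
      then show "norm (U n - ?u (real n * k)) \<le> C * k powr (\<alpha> / 4)" using err[of m U n] U by (simp add: m)
    qed
  qed
qed

end
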